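(* Let $q$ and $\lambda$ be generic and $\mu,\mu'\in(\mathbb C^* )^r$. The $q$-Whittaker function $W_\lambda^{\mu,\mu'}(\phi;q)={}^{\mu'}_\lambda\langle w|\prod_{i=1}^r(K_i)^{-\phi_i}|w\rangle^\mu_\lambda$ of $U_q(\mathfrak{sl}_{r+1})$ is $$W_\lambda^{\mu,\mu'}(\phi;q)=\sum_{\beta\in Q_+}\Big(\prod_{i=1}^r(\mu_i\mu_i')^{\beta_i}\Big)q^{-(\lambda-\beta|\phi)}\,\widetilde Z_\beta ,$$ where $\phi=\sum_{i=1}^r\phi_i\alpha_i$, $\beta=\sum_i\beta_i\alpha_i$, and $\widetilde Z_\beta$ is the partition function of the edge-weight path model with weights $\widetilde v^{(i)}(\beta)=q^{-\tau_i(\beta)}v_{q^{-1}}(\beta)$, that is $$\widetilde Z_\beta=\sum_{\mathbf p=(p_0,\dots,p_N)\in\mathcal P_\beta}\ \prod_{k=1}^N\frac1{\widetilde v^{(i_k)}(p_k)},\qquad p_k-p_{k-1}=\alpha_{i_k}.$$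
   Context: Roots and weights. $C$ is the Cartan matrix of type $A_r$, $\alpha_1,\dots,\alpha_r$ the simple roots with $(\alpha_i|\alpha_j)=C_{i,j}$, $\omega_i$ the fundamental weights, $(\omega_i|\alpha_j)=\delta_{i,j}$, $\omega_0=\omega_{r+1}=0$, $\rho=\sum_i\omega_i$, $Q_+=\bigoplus_i\mathbb Z_{\ge0}\alpha_i$, $\lambda_i=(\lambda|\alpha_i)$. Algebra. $U_q(\mathfrak{sl}_{r+1})$ is generated by $E_i,F_i,K_i^{\pm1}$, $1\le i\le r$, with commuting $K_i$'s and $[E_i,F_j]=\delta_{i,j}\frac{K_i-K_i^{-1}}{q-q^{-1}}$, $K_iE_j=q^{C_{j,i}}E_jK_i$, $K_iF_j=q^{-C_{j,i}}F_jK_i$, and the standard quantum Serre relations. $V_\lambda$ is the (irreducible) Verma module generated by the $F_i$ from $|\lambda\rangle$ with $E_i|\lambda\rangle=0$, $K_i|\lambda\rangle=q^{\lambda_i}|\lambda\rangle$; its completion is the product of its weight spaces. The dual right module $V_\lambda^*$ is generated by the $E_i$ from $\langle\lambda|$ with $\langle\lambda|F_i=0$, $\langle\lambda|K_i=q^{\lambda_i}\langle\lambda|$, $\langle\lambda|\lambda\rangle=1$, similarly completed, with pairing $(\langle\lambda|a)(b|\lambda\rangle)=\langle\lambda|ab|\lambda\rangle$. Whittaker vectors. $|w\rangle_\lambda^\mu$ is the unique element of the completion of $V_\lambda$ with $\langle\lambda|w\rangle=1$ and $E_i|w\rangle=\mu_i(K_i)^{i-1}|w\rangle$ for all $i$.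 ${}^{\mu'}_\lambda\langle w|$ is the unique element of the completion of $V_\lambda^*$ with $\langle w|\lambda\rangle=1$ and $\langle w|F_i=\mu_i'\langle w|(K_i)^{-(i-1)}$ for all $i$. The $\phi_i$ are formal variables; the matrix element is the formal series obtained by summing over $\beta$ the pairings of the components of weight $\lambda-\beta$, on which $\prod_iK_i^{-\phi_i}$ acts by $q^{-(\lambda-\beta|\phi)}$. Paths and weights. $\mathcal P_\beta$ is the set of sequences $\mathbf p=(p_0,\dots,p_N)$ in $Q_+$ with $p_0=0$, $p_N=\beta$, each $p_k-p_{k-1}$ a simple root. $v_q(\beta)=\frac1{(q-q^{-1})^2}\sum_{i=0}^rq^{2(\lambda+\rho|\omega_i-\omega_{i+1})}\big(1-q^{2(\beta|\omega_{i+1}-\omega_i)}\big)$ and $\tau_i(\beta)=(\lambda+\rho-\beta|\omega_{i+1}-\omega_{i-1})$; $v_{q^{-1}}$ is $v_q$ with $q$ replaced by $q^{-1}$. A determination of $\log q$ is fixed so that $q^x$ is defined. "Generic" means $q\ne0$ is not a root of unity, $V_\lambda$ is irreducible, and $v_q(\beta)\neq0$, $v_{q^{-1}}(\beta)\ne0$ for all $\beta\in Q_+\setminus\{0\}$. *)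

theory Defs
  imports Complex_Main "HOL-Library.Poly_Mapping" "HOL-Library.Set_Algebras" "HOL-Library.FuncSet"
begin

section \<open>Roots and weights of type \<open>A\<^sub>r\<close>\<close>

text \<open>
  A weight is given by its complex coordinates in the basis of simple roots: \<open>\<nu>\<close> stands for
  \<open>\<Sum>i=1..r. (lookup \<nu> i) \<alpha>\<^sub>i\<close>.
\<close>

type_synonym weight = "nat \<Rightarrow>\<^sub>0 complex"

definition weights :: "nat \<Rightarrow> weight set" where
  "weights r = {\<nu>. Poly_Mapping.keys \<nu> \<subseteq> {1..r}}"

definition cartan :: "nat \<Rightarrow> nat \<Rightarrow> int" where
  "cartan i j = (if i = j then 2 else if i = Suc j \<or> j = Suc i then -1 else 0)"

definition wform :: "nat \<Rightarrow> weight \<Rightarrow> weight \<Rightarrow> complex" where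
  "wform r x y = (\<Sum>i=1..r. \<Sum>j=1..r.
     Poly_Mapping.lookup x i * of_int (cartan i j) * Poly_Mapping.lookup y j)"

definition sroot :: "nat \<Rightarrow> weight" where
  "sroot i = Poly_Mapping.single i 1"

text \<open>
  The coordinates of \<open>\<omega>\<^sub>i\<close> form the \<open>i\<close>-th row of the inverse Cartan matrix; the formula also gives
  \<open>\<omega>\<^sub>0 = \<omega>\<^bsub>r+1\<^esub> = 0\<close>.
\<close>

definition fweight :: "nat \<Rightarrow> nat \<Rightarrow> weight" where
  "fweight r i = (\<Sum>j=1..r. Poly_Mapping.single j
     (of_nat (min i j) - of_nat (i * j) / of_nat (r + 1)))"

definition weyl_vector :: "nat \<Rightarrow> weight" where
  "weyl_vector r = (\<Sum>i=1..r. fweight r i)"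

lemma lookup_fweight:
  "Poly_Mapping.lookup (fweight r i) j =
     (if j \<in> {1..r} then of_nat (min i j) - of_nat (i * j) / of_nat (r + 1) else 0)"
  by (simp add: fweight_def lookup_sum lookup_single when_def)

lemma fweight_0: "fweight r 0 = 0"
  by (simp add: fweight_def)

lemma fweight_Suc_r: "fweight r (Suc r) = 0"
proof (rule poly_mapping_eqI)
  fix j
  have "of_nat (Suc r * j) / of_nat (r + 1) = (of_nat j :: complex)"
    by (simp only: of_nat_mult Suc_eq_plus1 nonzero_mult_div_cancel_left of_nat_eq_0_iff)
  then   show "Poly_Mapping.lookup (fweight r (Suc r)) j = Poly_Mapping.lookup 0 j"
    by (auto simp: lookup_fweight min_def simp del: of_nat_Suc of_nat_mult mult_Suc)
qed

lemma wform_sroot_sroot: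
  assumes "i \<in> {1..r}" "j \<in> {1..r}"
  shows "wform r (sroot i) (sroot j) = of_int (cartan i j)"
proof -
  have "wform r (sroot i) (sroot j) =
      (\<Sum>k=1..r. \<Sum>l=1..r. if l = j then if k = i then of_int (cartan k l) else 0 else 0)"
    unfolding wform_def sroot_def lookup_single when_def
    by (intro sum.cong refl) auto
  then show ?thesis using assms by simp
qed

lemma wform_fweight_sroot:
  assumes "i \<in> {1..r}" "j \<in> {1..r}"
  shows "wform r (fweight r i) (sroot j) = (if i = j then 1 else 0)"
proof -
  define g :: "nat \<Rightarrow> complex" where "g k = of_nat (min i k) - of_nat (i * k) / of_nat (r + 1)" for k
  have "of_nat (i * (r + 1)) / of_nat (r + 1) = (of_nat i :: complex)"
    by (simp only: of_nat_mult nonzero_mult_div_cancel_right of_nat_eq_0_iff)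
  then have gr: "g (r + 1) = 0"
    using assms by (simp add: g_def min_def del: of_nat_Suc of_nat_mult mult_Suc of_nat_add mult_Suc_right)
  have g0: "g 0 = 0"
    by (simp add: g_def)
  have "wform r (fweight r i) (sroot j) = (\<Sum>k=1..r. g k * of_int (cartan k j))"
    unfolding wform_def
  proof (intro sum.cong refl)
    fix k assume k: "k \<in> {1..r}"
    have "(\<Sum>l=1..r. Poly_Mapping.lookup (fweight r i) k * of_int (cartan k l)
             * Poly_Mapping.lookup (sroot j) l)
        = (\<Sum>l=1..r. if l = j then g k * of_int (cartan k l) else 0)"
      using k by (intro sum.cong refl)
        (auto simp: lookup_fweight sroot_def lookup_single when_def g_def)
    then show "(\<Sum>l=1..r. Poly_Mapping.lookup (fweight r i) k * of_int (cartan k l)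
             * Poly_Mapping.lookup (sroot j) l) = g k * of_int (cartan k j)"
      using assms by simp
  qed
  also have "\<dots> = (\<Sum>k=0..r+1. g k * of_int (cartan k j))"
    using g0 gr by (simp add: sum.atLeast_Suc_atMost[of 0])
  also have "\<dots> = (\<Sum>k\<in>{j-1, j, j+1}. g k * of_int (cartan k j))"
    using assms by (intro sum.mono_neutral_right) (auto simp: cartan_def)
  also have "\<dots> = 2 * g j - g (j - 1) - g (j + 1)"
    using assms by (cases j) (auto simp: cartan_def)
  also have "\<dots> = (if i = j then 1 else 0)"
  proof -
    obtain m where m: "j = Suc m" using assms by (cases j) auto
    have "2 * (of_nat (i * Suc m) / of_nat (r + 1)) - of_nat (i * m) / of_nat (r + 1)
        - of_nat (i * (m + 2)) / of_nat (r + 1) = (0::complex)"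
      by (simp add: divide_inverse algebra_simps)
    then have "2 * g j - g (j - 1) - g (j + 1)
        = of_nat (2 * min i (Suc m)) - of_nat (min i m) - of_nat (min i (m + 2))"
      unfolding g_def m by (simp add: algebra_simps)
    moreover have "i \<le> m \<or> i = Suc m \<or> i = m + 2 \<or> i > m + 2" by linarith
    ultimately show ?thesis unfolding m by (auto simp: min_def)
  qed
  finally show ?thesis .
qed

text \<open>Elements of \<open>Q\<^sub>+\<close>, again by their coordinates in the basis of simple roots.\<close>

definition Qplus :: "nat \<Rightarrow> (nat \<Rightarrow>\<^sub>0 nat) set" where
  "Qplus r = {\<beta>. Poly_Mapping.keys \<beta> \<subseteq> {1..r}}"

definition qroot :: "nat \<Rightarrow> (nat \<Rightarrow>\<^sub>0 nat)" where
  "qroot i = Poly_Mapping.single i 1"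

definition wt :: "(nat \<Rightarrow>\<^sub>0 nat) \<Rightarrow> weight" where
  "wt \<beta> = Poly_Mapping.map of_nat \<beta>"


section \<open>The quantum group \<open>U\<^sub>q(sl\<^bsub>r+1\<^esub>)\<close>\<close>

text \<open>
  The free associative algebra on a set of letters is the monoid algebra of words, whose product is
  concatenation.
\<close>

instantiation list :: (type) monoid_add
begin

definition zero_list :: "'a list" where "zero_list = []"

definition plus_list :: "'a list \<Rightarrow> 'a list \<Rightarrow> 'a list" where "plus_list = (@)"

instance by standard (simp_all add: zero_list_def plus_list_def)

end

datatype letter = LE nat | LF nat | LK nat | LKinv nat

type_synonym freealg = "letter list \<Rightarrow>\<^sub>0 complex"

definition const :: "complex \<Rightarrow> freealg" where
  "const c = Poly_Mapping.single [] c"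

definition gen :: "letter \<Rightarrow> freealg" where
  "gen x = Poly_Mapping.single [x] 1"

abbreviation "gE i \<equiv> gen (LE i)"
abbreviation "gF i \<equiv> gen (LF i)"
abbreviation "gK i \<equiv> gen (LK i)"
abbreviation "gKinv i \<equiv> gen (LKinv i)"

definition free_carrier :: "nat \<Rightarrow> freealg set" where
  "free_carrier r = {a. \<forall>w\<in>Poly_Mapping.keys a.
     set w \<subseteq> LE ` {1..r} \<union> LF ` {1..r} \<union> LK ` {1..r} \<union> LKinv ` {1..r}}"

text \<open>Ideals of a subalgebra \<open>A\<close> generated by a set \<open>S\<close>: two-sided, left, right.\<close>

inductive_set ideal_gen :: "freealg set \<Rightarrow> freealg set \<Rightarrow> freealg set" for A S where
  zero: "0 \<in> ideal_gen A S"
| base: "s \<in> S \<Longrightarrow> s \<in> ideal_gen A S"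
| add: "x \<in> ideal_gen A S \<Longrightarrow> y \<in> ideal_gen A S \<Longrightarrow> x + y \<in> ideal_gen A S"
| lmult: "a \<in> A \<Longrightarrow> x \<in> ideal_gen A S \<Longrightarrow> a * x \<in> ideal_gen A S"
| rmult: "a \<in> A \<Longrightarrow> x \<in> ideal_gen A S \<Longrightarrow> x * a \<in> ideal_gen A S"

inductive_set left_ideal_gen :: "freealg set \<Rightarrow> freealg set \<Rightarrow> freealg set" for A S where
  zero: "0 \<in> left_ideal_gen A S"
| base: "s \<in> S \<Longrightarrow> s \<in> left_ideal_gen A S"
| add: "x \<in> left_ideal_gen A S \<Longrightarrow> y \<in> left_ideal_gen A S \<Longrightarrow> x + y \<in> left_ideal_gen A S"
| lmult: "a \<in> A \<Longrightarrow> x \<in> left_ideal_gen A S \<Longrightarrow> a * x \<in> left_ideal_gen A S"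

inductive_set right_ideal_gen :: "freealg set \<Rightarrow> freealg set \<Rightarrow> freealg set" for A S where
  zero: "0 \<in> right_ideal_gen A S"
| base: "s \<in> S \<Longrightarrow> s \<in> right_ideal_gen A S"
| add: "x \<in> right_ideal_gen A S \<Longrightarrow> y \<in> right_ideal_gen A S \<Longrightarrow> x + y \<in> right_ideal_gen A S"
| rmult: "a \<in> A \<Longrightarrow> x \<in> right_ideal_gen A S \<Longrightarrow> x * a \<in> right_ideal_gen A S"

definition serre :: "complex \<Rightarrow> (nat \<Rightarrow> letter) \<Rightarrow> nat \<Rightarrow> nat \<Rightarrow> freealg" where
  "serre q L i j =
     (if cartan i j = -1
      then gen (L i) ^ 2 * gen (L j) - const (q + inverse q) * gen (L i) * gen (L j) * gen (L i)
             + gen (L j) * gen (L i) ^ 2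
      else gen (L i) * gen (L j) - gen (L j) * gen (L i))"

definition uq_relations :: "nat \<Rightarrow> complex \<Rightarrow> freealg set" where
  "uq_relations r q = (\<Union>i\<in>{1..r}. \<Union>j\<in>{1..r}.
     {gK i * gKinv i - 1,
      gKinv i * gK i - 1,
      gK i * gK j - gK j * gK i,
      gE i * gF j - gF j * gE i
        - (if i = j then const (inverse (q - inverse q)) * (gK i - gKinv i) else 0),
      gK i * gE j - const (q powi cartan j i) * gE j * gK i,
      gK i * gF j - const (q powi (- cartan j i)) * gF j * gK i}
     \<union> (if i = j then {} else {serre q LE i j, serre q LF i j}))"

text \<open>\<open>U\<^sub>q(sl\<^bsub>r+1\<^esub>)\<close> is the quotient of \<^term>\<open>free_carrier r\<close> by the following ideal.\<close>

definition uq_ideal :: "nat \<Rightarrow> complex \<Rightarrow> freealg set" where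
  "uq_ideal r q = ideal_gen (free_carrier r) (uq_relations r q)"


section \<open>Verma modules\<close>

text \<open>
  Throughout, \<open>lam\<close> is the weight \<open>\<lambda>\<close>, and \<open>h\<close> is the chosen determination of \<open>log q\<close>: the
  parameter \<open>q\<close> is \<open>exp h\<close>, a general nonzero complex number. Replacing \<open>q\<close> by
  \<open>q\<inverse>\<close> amounts to replacing \<open>h\<close> by \<open>-h\<close>.
\<close>

definition qpow :: "complex \<Rightarrow> complex \<Rightarrow> complex" where
  "qpow h x = exp (x * h)"

text \<open>
  The Verma module \<open>U\<^sub>q / (\<Sum>\<^sub>i U\<^sub>q E\<^sub>i + \<Sum>\<^sub>i U\<^sub>q (K\<^sub>i - q\<^bsup>\<lambda>\<^sub>i\<^esup>))\<close> is written as a quotient of the free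
  algebra, by a left ideal containing \<^const>\<open>uq_ideal\<close>; its vectors are cosets. Dually for the right
  module \<open>V\<^sub>\<lambda>\<^sup>*\<close>.
\<close>

definition ket_ideal :: "nat \<Rightarrow> complex \<Rightarrow> weight \<Rightarrow> freealg set" where
  "ket_ideal r h lam = left_ideal_gen (free_carrier r)
     (uq_ideal r (exp h) \<union> gE ` {1..r}
        \<union> (\<lambda>i. gK i - const (qpow h (wform r lam (sroot i)))) ` {1..r})"

definition bra_ideal :: "nat \<Rightarrow> complex \<Rightarrow> weight \<Rightarrow> freealg set" where
  "bra_ideal r h lam = right_ideal_gen (free_carrier r)
     (uq_ideal r (exp h) \<union> gF ` {1..r}
        \<union> (\<lambda>i. gK i - const (qpow h (wform r lam (sroot i)))) ` {1..r})"

definition verma :: "nat \<Rightarrow> complex \<Rightarrow> weight \<Rightarrow> freealg set set" where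
  "verma r h lam = {a +o ket_ideal r h lam | a. a \<in> free_carrier r}"

definition dual_verma :: "nat \<Rightarrow> complex \<Rightarrow> weight \<Rightarrow> freealg set set" where
  "dual_verma r h lam = {a +o bra_ideal r h lam | a. a \<in> free_carrier r}"

text \<open>
  The cosets of \<open>1\<close> are \<open>|\<lambda>\<rangle>\<close> and \<open>\<langle>\<lambda>|\<close>. Addition of cosets is \<open>(+)\<close> on sets, from
  \<^theory>\<open>HOL-Library.Set_Algebras\<close>; complex scalars act through \<^const>\<open>const\<close>.
\<close>

definition ket_vac :: "nat \<Rightarrow> complex \<Rightarrow> weight \<Rightarrow> freealg set" where
  "ket_vac r h lam = 1 +o ket_ideal r h lam"

definition bra_vac :: "nat \<Rightarrow> complex \<Rightarrow> weight \<Rightarrow> freealg set" where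
  "bra_vac r h lam = 1 +o bra_ideal r h lam"

definition ket_act :: "nat \<Rightarrow> complex \<Rightarrow> weight \<Rightarrow> freealg \<Rightarrow> freealg set \<Rightarrow> freealg set" where
  "ket_act r h lam a X = (\<lambda>x. a * x) ` X + ket_ideal r h lam"

definition bra_act :: "nat \<Rightarrow> complex \<Rightarrow> weight \<Rightarrow> freealg set \<Rightarrow> freealg \<Rightarrow> freealg set" where
  "bra_act r h lam X a = (\<lambda>x. x * a) ` X + bra_ideal r h lam"

definition verma_submodule :: "nat \<Rightarrow> complex \<Rightarrow> weight \<Rightarrow> freealg set set \<Rightarrow> bool" where
  "verma_submodule r h lam S \<longleftrightarrow>
     S \<subseteq> verma r h lam \<and> ket_ideal r h lam \<in> S \<and>
     (\<forall>X\<in>S. \<forall>Y\<in>S. X + Y \<in> S) \<and>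
     (\<forall>a\<in>free_carrier r. \<forall>X\<in>S. ket_act r h lam a X \<in> S)"

definition verma_irreducible :: "nat \<Rightarrow> complex \<Rightarrow> weight \<Rightarrow> bool" where
  "verma_irreducible r h lam \<longleftrightarrow>
     verma r h lam \<noteq> {ket_ideal r h lam} \<and>
     (\<forall>S. verma_submodule r h lam S \<longrightarrow> S = {ket_ideal r h lam} \<or> S = verma r h lam)"

text \<open>
  \<open>\<langle>\<lambda>|x|\<lambda>\<rangle>\<close> is the class of \<open>x\<close> in \<open>V\<^sub>\<lambda>\<^sup>* \<otimes>\<^bsub>U\<^esub> V\<^sub>\<lambda> = U / (bra ideal + ket ideal)\<close>, which is spanned by
  the class of \<open>1\<close>, normalised by \<open>\<langle>\<lambda>|\<lambda>\<rangle> = 1\<close>.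
\<close>

definition vev :: "nat \<Rightarrow> complex \<Rightarrow> weight \<Rightarrow> freealg \<Rightarrow> complex" where
  "vev r h lam x = (THE c. x - const c \<in> bra_ideal r h lam + ket_ideal r h lam)"

definition pairing :: "nat \<Rightarrow> complex \<Rightarrow> weight \<Rightarrow> freealg set \<Rightarrow> freealg set \<Rightarrow> complex" where
  "pairing r h lam X Y = (THE c. \<exists>a\<in>X. \<exists>b\<in>Y. c = vev r h lam (a * b))"


section \<open>Completions and Whittaker vectors\<close>

text \<open>The weight spaces of weight \<open>\<lambda> - \<beta>\<close>.\<close>

definition ket_space :: "nat \<Rightarrow> complex \<Rightarrow> weight \<Rightarrow> (nat \<Rightarrow>\<^sub>0 nat) \<Rightarrow> freealg set set" where
  "ket_space r h lam \<beta> = {X \<in> verma r h lam. \<forall>i\<in>{1..r}.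
     ket_act r h lam (gK i) X
       = ket_act r h lam (const (qpow h (wform r (lam - wt \<beta>) (sroot i)))) X}"

definition bra_space :: "nat \<Rightarrow> complex \<Rightarrow> weight \<Rightarrow> (nat \<Rightarrow>\<^sub>0 nat) \<Rightarrow> freealg set set" where
  "bra_space r h lam \<beta> = {X \<in> dual_verma r h lam. \<forall>i\<in>{1..r}.
     bra_act r h lam X (gK i)
       = bra_act r h lam X (const (qpow h (wform r (lam - wt \<beta>) (sroot i))))}"

definition ket_completion :: "nat \<Rightarrow> complex \<Rightarrow> weight \<Rightarrow> ((nat \<Rightarrow>\<^sub>0 nat) \<Rightarrow> freealg set) set" where
  "ket_completion r h lam = (\<Pi>\<^sub>E \<beta>\<in>Qplus r. ket_space r h lam \<beta>)"

definition bra_completion :: "nat \<Rightarrow> complex \<Rightarrow> weight \<Rightarrow> ((nat \<Rightarrow>\<^sub>0 nat) \<Rightarrow> freealg set) set" where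
  "bra_completion r h lam = (\<Pi>\<^sub>E \<beta>\<in>Qplus r. bra_space r h lam \<beta>)"

text \<open>
  The equations between elements of the completions are written componentwise: the component of
  weight \<open>\<lambda> - \<beta>\<close> of \<open>E\<^sub>i|w\<rangle>\<close> is \<open>E\<^sub>i\<close> applied to the component of weight \<open>\<lambda> - (\<beta> + \<alpha>\<^sub>i)\<close> of \<open>|w\<rangle>\<close>,
  and likewise for \<open>\<langle>w|F\<^sub>i\<close>, while the \<open>K\<^sub>i\<close> preserve the components. Only the component of weight
  \<open>\<lambda>\<close> pairs nontrivially with \<open>\<langle>\<lambda>|\<close> or \<open>|\<lambda>\<rangle>\<close>.
\<close>

definition is_whittaker_ket ::
  "nat \<Rightarrow> complex \<Rightarrow> weight \<Rightarrow> (nat \<Rightarrow> complex) \<Rightarrow> ((nat \<Rightarrow>\<^sub>0 nat) \<Rightarrow> freealg set) \<Rightarrow> bool" where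
  "is_whittaker_ket r h lam \<mu> w \<longleftrightarrow>
     w \<in> ket_completion r h lam \<and>
     pairing r h lam (bra_vac r h lam) (w 0) = 1 \<and>
     (\<forall>i\<in>{1..r}. \<forall>\<beta>\<in>Qplus r.
        ket_act r h lam (gE i) (w (\<beta> + qroot i))
          = ket_act r h lam (const (\<mu> i) * gK i ^ (i - 1)) (w \<beta>))"

definition is_whittaker_bra ::
  "nat \<Rightarrow> complex \<Rightarrow> weight \<Rightarrow> (nat \<Rightarrow> complex) \<Rightarrow> ((nat \<Rightarrow>\<^sub>0 nat) \<Rightarrow> freealg set) \<Rightarrow> bool" where
  "is_whittaker_bra r h lam \<mu>' w \<longleftrightarrow>
     w \<in> bra_completion r h lam \<and>
     pairing r h lam (w 0) (ket_vac r h lam) = 1 \<and>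
     (\<forall>i\<in>{1..r}. \<forall>\<beta>\<in>Qplus r.
        bra_act r h lam (w (\<beta> + qroot i)) (gF i)
          = bra_act r h lam (w \<beta>) (const (\<mu>' i) * gKinv i ^ (i - 1)))"

definition whittaker_ket ::
  "nat \<Rightarrow> complex \<Rightarrow> weight \<Rightarrow> (nat \<Rightarrow> complex) \<Rightarrow> (nat \<Rightarrow>\<^sub>0 nat) \<Rightarrow> freealg set" where
  "whittaker_ket r h lam \<mu> = (THE w. is_whittaker_ket r h lam \<mu> w)"

definition whittaker_bra ::
  "nat \<Rightarrow> complex \<Rightarrow> weight \<Rightarrow> (nat \<Rightarrow> complex) \<Rightarrow> (nat \<Rightarrow>\<^sub>0 nat) \<Rightarrow> freealg set" where
  "whittaker_bra r h lam \<mu>' = (THE w. is_whittaker_bra r h lam \<mu>' w)"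


section \<open>Formal series and the Whittaker function\<close>

text \<open>
  A formal series in the variables \<open>\<phi>\<^sub>1, \<dots>, \<phi>\<^sub>r\<close> assigns to each exponent vector \<open>x\<close>, extensional on
  \<open>{1..r}\<close>, the coefficient of the formal exponential \<open>\<Prod>\<^sub>i q\<^bsup>-x\<^sub>i\<phi>\<^sub>i\<^esup>\<close>. For \<open>\<phi> = \<Sum>\<^sub>i \<phi>\<^sub>i \<alpha>\<^sub>i\<close>, the monomial
  \<open>q\<^bsup>-(\<nu>|\<phi>)\<^esup>\<close> has exponents \<open>x\<^sub>i = (\<nu>|\<alpha>\<^sub>i)\<close>. The Cartan matrix being invertible, the weights
  \<open>\<lambda> - \<beta>\<close> have distinct exponent vectors, so a sum over \<open>Q\<^sub>+\<close> of multiples of their monomials has at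
  most one nonzero term for each exponent vector.
\<close>

type_synonym fseries = "(nat \<Rightarrow> complex) \<Rightarrow> complex"

definition qpow_phi :: "nat \<Rightarrow> weight \<Rightarrow> fseries" where
  "qpow_phi r \<nu> = (\<lambda>x. if x = (\<lambda>i\<in>{1..r}. wform r \<nu> (sroot i)) then 1 else 0)"

definition fscale :: "complex \<Rightarrow> fseries \<Rightarrow> fseries" where
  "fscale c f = (\<lambda>x. c * f x)"

definition fsum :: "nat \<Rightarrow> ((nat \<Rightarrow>\<^sub>0 nat) \<Rightarrow> fseries) \<Rightarrow> fseries" where
  "fsum r f = (\<lambda>x. \<Sum>\<beta> | \<beta> \<in> Qplus r \<and> f \<beta> x \<noteq> 0. f \<beta> x)"

definition whittaker_function ::
  "nat \<Rightarrow> complex \<Rightarrow> weight \<Rightarrow> (nat \<Rightarrow> complex) \<Rightarrow> (nat \<Rightarrow> complex) \<Rightarrow> fseries" where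
  "whittaker_function r h lam \<mu> \<mu>' =
     fsum r (\<lambda>\<beta>. fscale (pairing r h lam (whittaker_bra r h lam \<mu>' \<beta>) (whittaker_ket r h lam \<mu> \<beta>))
       (qpow_phi r (lam - wt \<beta>)))"


section \<open>The path model\<close>

definition path_v :: "nat \<Rightarrow> complex \<Rightarrow> weight \<Rightarrow> (nat \<Rightarrow>\<^sub>0 nat) \<Rightarrow> complex" where
  "path_v r h lam \<beta> = 1 / (exp h - inverse (exp h))\<^sup>2 *
     (\<Sum>i=0..r. qpow h (2 * wform r (lam + weyl_vector r) (fweight r i - fweight r (i + 1)))
       * (1 - qpow h (2 * wform r (wt \<beta>) (fweight r (i + 1) - fweight r i))))"

definition path_tau :: "nat \<Rightarrow> weight \<Rightarrow> nat \<Rightarrow> (nat \<Rightarrow>\<^sub>0 nat) \<Rightarrow> complex" where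
  "path_tau r lam i \<beta> =
     wform r (lam + weyl_vector r - wt \<beta>) (fweight r (i + 1) - fweight r (i - 1))"

definition path_weight :: "nat \<Rightarrow> complex \<Rightarrow> weight \<Rightarrow> nat \<Rightarrow> (nat \<Rightarrow>\<^sub>0 nat) \<Rightarrow> complex" where
  "path_weight r h lam i \<beta> = qpow h (- path_tau r lam i \<beta>) * path_v r (- h) lam \<beta>"

definition paths :: "nat \<Rightarrow> (nat \<Rightarrow>\<^sub>0 nat) \<Rightarrow> (nat \<Rightarrow>\<^sub>0 nat) list set" where
  "paths r \<beta> = {p. p \<noteq> [] \<and> set p \<subseteq> Qplus r \<and> hd p = 0 \<and> last p = \<beta> \<and>
     (\<forall>k\<in>{1..length p - 1}. \<exists>i\<in>{1..r}. p ! k = p ! (k - 1) + qroot i)}"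

definition path_step :: "(nat \<Rightarrow>\<^sub>0 nat) list \<Rightarrow> nat \<Rightarrow> nat" where
  "path_step p k = (THE i. p ! k = p ! (k - 1) + qroot i)"

definition path_Z :: "nat \<Rightarrow> complex \<Rightarrow> weight \<Rightarrow> (nat \<Rightarrow>\<^sub>0 nat) \<Rightarrow> complex" where
  "path_Z r h lam \<beta> =
     (\<Sum>p\<in>paths r \<beta>. \<Prod>k=1..length p - 1. 1 / path_weight r h lam (path_step p k) (p ! k))"

definition generic :: "nat \<Rightarrow> complex \<Rightarrow> weight \<Rightarrow> bool" where
  "generic r h lam \<longleftrightarrow>
     (\<forall>n>0. exp h ^ n \<noteq> 1) \<and> verma_irreducible r h lam \<and>
     (\<forall>\<beta>\<in>Qplus r - {0}. path_v r h lam \<beta> \<noteq> 0 \<and> path_v r (- h) lam \<beta> \<noteq> 0)"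

end

theory Submission
  imports Defs
begin

text \<open>
  The equation \<open>E\<^sub>i|w\<rangle> = \<mu>\<^sub>i K\<^sub>i\<^bsup>i-1\<^esup>|w\<rangle>\<close> is solved by the components with \<open>|w\<rangle>\<^sub>0 = |\<lambda>\<rangle>\<close> and
  \<open>v\<^sub>q(\<beta>) |w\<rangle>\<^sub>\<beta> = \<Sum>\<^sub>i \<mu>\<^sub>i c\<^sub>i(\<beta>) F\<^sub>i |w\<rangle>\<^bsub>\<beta>-\<alpha>\<^sub>i\<^esub>\<close>, where \<open>c\<^sub>i(\<beta>)\<close> is \<open>q\<^bsup>-\<tau>\<^sub>i(\<beta>)\<^esup>\<close> times the eigenvalue of
  \<open>K\<^sub>i\<^bsup>i-1\<^esup>\<close> on the weight \<open>\<lambda> - \<beta> + \<alpha>\<^sub>i\<close>: only two of the exponentials in \<open>v\<^sub>q\<close> change when \<open>\<alpha>\<^sub>j\<close> is added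
  to \<open>\<beta>\<close>, and \<open>v\<^sub>q(\<beta> + \<alpha>\<^sub>j) - v\<^sub>q(\<beta>)\<close> is \<open>q\<^bsup>-\<tau>\<^sub>j(\<beta>+\<alpha>\<^sub>j)\<^esup>\<close> times the eigenvalue of \<open>[E\<^sub>j,F\<^sub>j]\<close> on
  the weight \<open>\<lambda> - \<beta>\<close>. So neither a Casimir element nor a PBW basis is needed. Uniqueness holds because a
  difference of two solutions has a singular lowest component, which vanishes in an irreducible Verma
  module. The anti-automorphism exchanging \<open>E\<^sub>i\<close> and \<open>F\<^sub>i\<close> carries all this over to \<open>\<langle>w|\<close>, with \<open>q\<close> replaced
  by \<open>q\<inverse>\<close> in \<open>v\<^sub>q\<close>, \<open>c\<^sub>i\<close>; pairing the recursion for \<open>\<langle>w|\<close> with \<open>|w\<rangle>\<close> gives the recursion of the path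
  partition function over the last step of a path.
\<close>

section \<open>The free algebra\<close>

lemma const_0 [simp]: "const 0 = 0"
  by (simp add: const_def)

lemma const_1 [simp]: "const 1 = 1"
  by (metis const_def single_one zero_list_def)

lemma const_add: "const (c + d) = const c + const d"
  by (simp add: const_def single_add)

lemma const_diff: "const (c - d) = const c - const d"
  by (simp add: const_def single_diff)

lemma const_uminus: "const (- c) = - const c"
  by (simp add: const_def single_uminus)

lemma const_mult: "const (c * d) = const c * const d"
  by (simp add: const_def mult_single plus_list_def)

lemma const_mult_left: "const c * (const d * x) = const (c * d) * x"
  by (simp add: const_mult mult.assoc)

lemma const_sum: "const (\<Sum>i\<in>I. f i) = (\<Sum>i\<in>I. const (f i))"
  by (induction I rule: infinite_finite_induct) (simp_all add: const_add)

lemma single_Cons: "Poly_Mapping.single (l # w) c = gen l * Poly_Mapping.single w c"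
  by (simp add: gen_def mult_single plus_list_def)

text \<open>An element is a finite sum of monomials, met one new word at a time. Keeping the words
  inside \<open>W\<close> lets one induction serve the whole free algebra as well as
  \<open>free_carrier\<close>.\<close>

lemma freealg_induct_keys:
  assumes a: "Poly_Mapping.keys a \<subseteq> W"
    and zero: "P 0"
    and single: "\<And>w c. w \<in> W \<Longrightarrow> P (Poly_Mapping.single w c)"
    and add: "\<And>a b. P a \<Longrightarrow> P b \<Longrightarrow> P (a + b)"
  shows "P (a :: freealg)"
  using a
proof (induction a rule: update_induct)
  case const
  show ?case by (rule zero)
next
  case (update f w c)
  \<comment> \<open>The word \<open>w\<close> is new to \<open>f\<close>, so setting its coefficient
    amounts to adding a monomial.\<close>
  have eq: "Poly_Mapping.update w c f = Poly_Mapping.single w c + f"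
  proof (rule poly_mapping_eqI)
    fix k
    show "Poly_Mapping.lookup (Poly_Mapping.update w c f) k
        = Poly_Mapping.lookup (Poly_Mapping.single w c + f) k"
      using update(1) by (auto simp: lookup_update lookup_add lookup_single when_def in_keys_iff)
  qed
  have k: "w \<in> W" "Poly_Mapping.keys f \<subseteq> W"
    using update(2,4) by (auto simp: keys_update)
  show ?case
    unfolding eq by (intro add single k update.IH)
qed

lemma freealg_induct [case_names zero single add]:
  assumes "P 0" and "\<And>w c. P (Poly_Mapping.single w c)" and "\<And>a b. P a \<Longrightarrow> P b \<Longrightarrow> P (a + b)"
  shows "P (a :: freealg)"
  by (rule freealg_induct_keys[where W = UNIV]) (use assms in auto)

text \<open>Complex coefficients commute with words, so scalars are central and can be moved freely
  between left and right actions.\<close>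

lemma const_commute: "x * const c = const c * x"
  by (induction x rule: freealg_induct)
    (simp_all add: const_def mult_single plus_list_def distrib_left distrib_right mult.commute)

lemma const_left_commute: "x * (const c * y) = const c * (x * y)"
  by (metis const_commute mult.assoc)

section \<open>The subalgebra on the letters with index in 1..r\<close>

abbreviation letters :: "nat \<Rightarrow> letter set" where
  "letters r \<equiv> LE ` {1..r} \<union> LF ` {1..r} \<union> LK ` {1..r} \<union> LKinv ` {1..r}"

lemma free_carrier_zero [simp]: "0 \<in> free_carrier r"
  by (simp add: free_carrier_def)

lemma free_carrier_const [simp]: "const c \<in> free_carrier r"
  by (auto simp: free_carrier_def const_def split: if_splits)

lemma free_carrier_one [simp]: "1 \<in> free_carrier r"
  using free_carrier_const[of 1] by simp

lemma free_carrier_gen: "l \<in> letters r \<Longrightarrow> gen l \<in> free_carrier r"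
  by (simp add: free_carrier_def gen_def)

lemma free_carrier_gens [simp]:
  assumes "i \<in> {1..r}"
  shows "gE i \<in> free_carrier r" "gF i \<in> free_carrier r" "gK i \<in> free_carrier r" "gKinv i \<in> free_carrier r"
  using assms by (auto intro!: free_carrier_gen)

lemma free_carrier_add [simp]:
  "a \<in> free_carrier r \<Longrightarrow> b \<in> free_carrier r \<Longrightarrow> a + b \<in> free_carrier r"
  unfolding free_carrier_def using Poly_Mapping.keys_add[of a b] by blast

lemma free_carrier_mult [simp]:
  assumes "a \<in> free_carrier r" "b \<in> free_carrier r"
  shows "a * b \<in> free_carrier r"
  unfolding free_carrier_def
proof (safe del: subsetI)
  fix w assume "w \<in> Poly_Mapping.keys (a * b)"
  then obtain u v where "w = u @ v" "u \<in> Poly_Mapping.keys a" "v \<in> Poly_Mapping.keys b"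
    using keys_mult[of a b] by (auto simp: plus_list_def)
  with assms show "set w \<subseteq> letters r"
    unfolding free_carrier_def by auto
qed

lemma free_carrier_uminus [simp]: "a \<in> free_carrier r \<Longrightarrow> - a \<in> free_carrier r"
  using free_carrier_mult[OF free_carrier_const[of "-1"]] by (simp add: const_uminus)

lemma free_carrier_diff [simp]:
  "a \<in> free_carrier r \<Longrightarrow> b \<in> free_carrier r \<Longrightarrow> a - b \<in> free_carrier r"
  using free_carrier_add[of a r "- b"] by simp

lemma free_carrier_power [simp]: "a \<in> free_carrier r \<Longrightarrow> a ^ n \<in> free_carrier r"
  by (induction n) auto

text \<open>Words grow by a letter on the left, the order in which operators are applied to a vector
  of a left module.\<close>

lemma free_carrier_induct [consumes 1, case_names const add gen]:
  assumes a: "a \<in> free_carrier r"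
    and const: "\<And>c. P (const c)"
    and add: "\<And>a b. a \<in> free_carrier r \<Longrightarrow> b \<in> free_carrier r \<Longrightarrow> P a \<Longrightarrow> P b \<Longrightarrow> P (a + b)"
    and gen: "\<And>l a. l \<in> letters r \<Longrightarrow> a \<in> free_carrier r \<Longrightarrow> P a \<Longrightarrow> P (gen l * a)"
  shows "P a"
proof -
  have single: "Poly_Mapping.single w c \<in> free_carrier r \<and> P (Poly_Mapping.single w c)"
    if "set w \<subseteq> letters r" for w c
    using that
  proof (induction w)
    case Nil
    show ?case using const[of c] free_carrier_const[of c r] by (simp add: const_def)
  next
    case (Cons l w)
    then show ?case unfolding single_Cons by (auto intro!: gen free_carrier_gen)
  qed
  have "a \<in> free_carrier r \<and> P a"
  proof (rule freealg_induct_keys[where W = "{w. set w \<subseteq> letters r}"])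
    show "Poly_Mapping.keys a \<subseteq> {w. set w \<subseteq> letters r}"
      using a by (auto simp: free_carrier_def)
    show "0 \<in> free_carrier r \<and> P 0" using const[of 0] by simp
  qed (use single add in auto)
  then show ?thesis by simp
qed

section \<open>Congruences modulo the ideals\<close>

lemma serre_in_carrier:
  assumes "gen (L i) \<in> free_carrier r" "gen (L j) \<in> free_carrier r"
  shows "serre q L i j \<in> free_carrier r"
  using assms by (simp add: serre_def)

lemma uq_relations_subset: "uq_relations r q \<subseteq> free_carrier r"
  by (auto simp: uq_relations_def serre_in_carrier split: if_splits)

lemma uq_ideal_subset: "uq_ideal r q \<subseteq> free_carrier r"
proof
  fix x assume "x \<in> uq_ideal r q"
  then show "x \<in> free_carrier r"
    unfolding uq_ideal_def
    by (induction rule: ideal_gen.induct) (use uq_relations_subset in auto)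
qed

lemma ket_ideal_subset: "ket_ideal r h lam \<subseteq> free_carrier r"
proof
  fix x assume "x \<in> ket_ideal r h lam"
  then show "x \<in> free_carrier r"
    unfolding ket_ideal_def
    by (induction rule: left_ideal_gen.induct) (use uq_ideal_subset in auto)
qed

section \<open>Equality in the Verma module as a congruence\<close>

locale verma_params =
  fixes r :: nat and h :: complex and lam :: weight
begin

text \<open>Equality of vectors of the Verma module, expressed through representatives so that
  calculations can be chained without cosets.\<close>

definition keq :: "freealg \<Rightarrow> freealg \<Rightarrow> bool" where
  "keq x y \<longleftrightarrow> x - y \<in> ket_ideal r h lam"

lemma ket_ideal_zero [simp]: "0 \<in> ket_ideal r h lam"
  unfolding ket_ideal_def by (rule left_ideal_gen.zero)

lemma ket_ideal_add: "x \<in> ket_ideal r h lam \<Longrightarrow> y \<in> ket_ideal r h lam \<Longrightarrow> x + y \<in> ket_ideal r h lam"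
  unfolding ket_ideal_def by (rule left_ideal_gen.add)

lemma ket_ideal_lmult: "a \<in> free_carrier r \<Longrightarrow> x \<in> ket_ideal r h lam \<Longrightarrow> a * x \<in> ket_ideal r h lam"
  unfolding ket_ideal_def by (rule left_ideal_gen.lmult)

lemma ket_ideal_uminus: "x \<in> ket_ideal r h lam \<Longrightarrow> - x \<in> ket_ideal r h lam"
  using ket_ideal_lmult[of "const (-1)" x] by (simp add: const_uminus)

lemma ket_ideal_diff: "x \<in> ket_ideal r h lam \<Longrightarrow> y \<in> ket_ideal r h lam \<Longrightarrow> x - y \<in> ket_ideal r h lam"
  using ket_ideal_add[of x "- y"] ket_ideal_uminus[of y] by simp

lemma ket_ideal_const_cancel: "const c * x \<in> ket_ideal r h lam \<Longrightarrow> c \<noteq> 0 \<Longrightarrow> x \<in> ket_ideal r h lam"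
  using ket_ideal_lmult[of "const (inverse c)" "const c * x"] by (simp add: const_mult_left)

text \<open>Although \<open>ket_ideal\<close> is only a left ideal, it contains the two-sided ideal
  of the relations. So a relation may be applied in front of any vector \<open>y\<close>, and then,
  by \<open>keq_lmult\<close>, under further operators.\<close>

lemma uq_relation_ket: "s \<in> uq_relations r (exp h) \<Longrightarrow> y \<in> free_carrier r \<Longrightarrow> s * y \<in> ket_ideal r h lam"
  unfolding ket_ideal_def uq_ideal_def
  by (intro left_ideal_gen.base UnI1 ideal_gen.rmult ideal_gen.base)

lemma keq_refl [simp]: "keq x x"
  by (simp add: keq_def)

lemma keq_sym: "keq x y \<Longrightarrow> keq y x"
  unfolding keq_def using ket_ideal_uminus[of "x - y"] by simp

lemma keq_trans [trans]: "keq x y \<Longrightarrow> keq y z \<Longrightarrow> keq x z"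
  unfolding keq_def using ket_ideal_add[of "x - y" "y - z"] by simp

lemma keq_add: "keq x y \<Longrightarrow> keq x' y' \<Longrightarrow> keq (x + x') (y + y')"
  unfolding keq_def using ket_ideal_add[of "x - y" "x' - y'"] by (simp add: algebra_simps)

lemma keq_diff: "keq x y \<Longrightarrow> keq x' y' \<Longrightarrow> keq (x - x') (y - y')"
  unfolding keq_def using ket_ideal_diff[of "x - y" "x' - y'"] by (simp add: algebra_simps)

lemma keq_lmult: "keq x y \<Longrightarrow> a \<in> free_carrier r \<Longrightarrow> keq (a * x) (a * y)"
  unfolding keq_def using ket_ideal_lmult[of a "x - y"] by (simp add: algebra_simps)

lemma keq_sum: "(\<And>i. i \<in> I \<Longrightarrow> keq (f i) (g i)) \<Longrightarrow> keq (\<Sum>i\<in>I. f i) (\<Sum>i\<in>I. g i)"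
  by (induction I rule: infinite_finite_induct) (auto intro: keq_add)

lemma keq_zero_iff: "keq x 0 \<longleftrightarrow> x \<in> ket_ideal r h lam"
  by (simp add: keq_def)

lemma keq_ket_ideal: "keq x y \<Longrightarrow> x \<in> ket_ideal r h lam \<longleftrightarrow> y \<in> ket_ideal r h lam"
  by (metis keq_zero_iff keq_sym keq_trans)

lemma keq_const_cancel: "keq (const c * x) (const c * y) \<Longrightarrow> c \<noteq> 0 \<Longrightarrow> keq x y"
  unfolding keq_def by (rule ket_ideal_const_cancel) (auto simp: algebra_simps)

lemma keq_EF:
  assumes "i \<in> {1..r}" "j \<in> {1..r}" "y \<in> free_carrier r"
  shows "keq (gE i * (gF j * y)) (gF j * (gE i * y) +
    (if i = j then const (inverse (exp h - inverse (exp h))) * (gK i * y - gKinv i * y) else 0))"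
proof -
  have "gE i * gF j - gF j * gE i - (if i = j then const (inverse (exp h - inverse (exp h))) * (gK i - gKinv i) else 0)
     \<in> uq_relations r (exp h)"
    using assms(1,2) unfolding uq_relations_def by blast
  from uq_relation_ket[OF this assms(3)] show ?thesis
    unfolding keq_def by (auto simp: algebra_simps)
qed

lemma keq_KE:
  assumes "i \<in> {1..r}" "j \<in> {1..r}" "y \<in> free_carrier r"
  shows "keq (gK i * (gE j * y)) (const (exp h powi cartan j i) * (gE j * (gK i * y)))"
proof -
  have "gK i * gE j - const (exp h powi cartan j i) * gE j * gK i \<in> uq_relations r (exp h)"
    using assms(1,2) unfolding uq_relations_def by blast
  from uq_relation_ket[OF this assms(3)] show ?thesis
    unfolding keq_def by (auto simp: algebra_simps)
qed

lemma keq_KF: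
  assumes "i \<in> {1..r}" "j \<in> {1..r}" "y \<in> free_carrier r"
  shows "keq (gK i * (gF j * y)) (const (exp h powi (- cartan j i)) * (gF j * (gK i * y)))"
proof -
  have "gK i * gF j - const (exp h powi (- cartan j i)) * gF j * gK i \<in> uq_relations r (exp h)"
    using assms(1,2) unfolding uq_relations_def by blast
  from uq_relation_ket[OF this assms(3)] show ?thesis
    unfolding keq_def by (auto simp: algebra_simps)
qed

lemma keq_KinvK:
  assumes "i \<in> {1..r}" "y \<in> free_carrier r"
  shows "keq (gKinv i * (gK i * y)) y"
proof -
  have "gKinv i * gK i - 1 \<in> uq_relations r (exp h)"
    using assms(1) unfolding uq_relations_def by blast
  from uq_relation_ket[OF this assms(2)] show ?thesis
    unfolding keq_def by (auto simp: algebra_simps)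
qed

lemma gE_in_ket_ideal: "i \<in> {1..r} \<Longrightarrow> gE i \<in> ket_ideal r h lam"
  unfolding ket_ideal_def by (intro left_ideal_gen.base) auto

lemma keq_K_vac: "i \<in> {1..r} \<Longrightarrow> keq (gK i) (const (qpow h (wform r lam (sroot i))))"
  unfolding keq_def ket_ideal_def by (intro left_ideal_gen.base) auto

end

section \<open>Weight spaces\<close>

lemma wform_add_left: "wform r (x + y) z = wform r x z + wform r y z"
  by (simp add: wform_def lookup_add algebra_simps sum.distrib)

lemma wform_diff_left: "wform r (x - y) z = wform r x z - wform r y z"
  by (simp add: wform_def lookup_minus algebra_simps sum_subtractf)

lemma cartan_commute: "cartan i j = cartan j i"
  by (auto simp: cartan_def)

lemma wform_commute: "wform r x y = wform r y x"
  unfolding wform_def by (subst sum.swap) (simp add: cartan_commute mult.commute mult.left_commute)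

lemma wform_diff_right: "wform r z (x - y) = wform r z x - wform r z y"
  by (simp add: wform_commute[of r z] wform_diff_left)

lemma wform_sroot_right:
  assumes "i \<in> {1..r}"
  shows "wform r x (sroot i) = (\<Sum>k=1..r. Poly_Mapping.lookup x k * of_int (cartan k i))"
  unfolding wform_def
proof (intro sum.cong refl)
  fix k
  have "(\<Sum>j = 1..r. Poly_Mapping.lookup x k * of_int (cartan k j) * Poly_Mapping.lookup (sroot i) j)
     = (\<Sum>j = 1..r. if j = i then Poly_Mapping.lookup x k * of_int (cartan k j) else 0)"
    by (intro sum.cong refl) (simp add: sroot_def lookup_single when_def)
  then show "(\<Sum>j = 1..r. Poly_Mapping.lookup x k * of_int (cartan k j) * Poly_Mapping.lookup (sroot i) j)
     = Poly_Mapping.lookup x k * of_int (cartan k i)"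
    using assms by simp
qed

lemma wform_expand_right:
  "wform r x y = (\<Sum>i=1..r. Poly_Mapping.lookup y i * wform r x (sroot i))"
proof -
  have "wform r x y = (\<Sum>j=1..r. \<Sum>k=1..r. Poly_Mapping.lookup y j * (Poly_Mapping.lookup x k * of_int (cartan k j)))"
    unfolding wform_def by (subst sum.swap) (simp add: mult_ac)
  also have "\<dots> = (\<Sum>i=1..r. Poly_Mapping.lookup y i * wform r x (sroot i))"
    by (intro sum.cong refl) (simp add: wform_sroot_right sum_distrib_left)
  finally show ?thesis .
qed

text \<open>The fundamental weights are dual to the simple roots, so this pairing reads off a
  coordinate.\<close>

lemma wform_fweight:
  assumes "i \<in> {1..r}"
  shows "wform r x (fweight r i) = Poly_Mapping.lookup x i"
proof -
  have "wform r x (fweight r i) = (\<Sum>j=1..r. Poly_Mapping.lookup x j * wform r (fweight r i) (sroot j))"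
    by (subst wform_commute, rule wform_expand_right)
  also have "\<dots> = (\<Sum>j=1..r. if j = i then Poly_Mapping.lookup x j else 0)"
    using assms by (intro sum.cong refl) (auto simp: wform_fweight_sroot)
  finally show ?thesis using assms by simp
qed

text \<open>Nondegeneracy of the form: a coordinate is the pairing with a fundamental weight, which
  is itself a combination of simple roots.\<close>

lemma wform_sroot_zero_imp_zero:
  assumes "\<And>i. i \<in> {1..r} \<Longrightarrow> wform r x (sroot i) = 0" "k \<in> {1..r}"
  shows "Poly_Mapping.lookup x k = 0"
proof -
  have "Poly_Mapping.lookup x k = (\<Sum>i=1..r. Poly_Mapping.lookup (fweight r k) i * wform r x (sroot i))"
    by (simp add: wform_fweight[OF assms(2), symmetric] wform_expand_right[of r x "fweight r k"])
  then show ?thesis using assms(1) by simp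
qed

lemma lookup_wt [simp]: "Poly_Mapping.lookup (wt \<beta>) i = of_nat (Poly_Mapping.lookup \<beta> i)"
  by (simp add: wt_def Poly_Mapping.map.rep_eq when_def)

lemma wt_0 [simp]: "wt 0 = 0"
  by (rule poly_mapping_eqI) simp

lemma wt_add: "wt (\<beta> + \<gamma>) = wt \<beta> + wt \<gamma>"
  by (rule poly_mapping_eqI) (simp add: lookup_add)

lemma wt_qroot: "wt (qroot i) = sroot i"
  by (rule poly_mapping_eqI) (simp add: qroot_def sroot_def lookup_single when_def)

lemma Qplus_zero [simp]: "0 \<in> Qplus r"
  by (simp add: Qplus_def)

lemma Qplus_add [simp]: "\<beta> \<in> Qplus r \<Longrightarrow> \<gamma> \<in> Qplus r \<Longrightarrow> \<beta> + \<gamma> \<in> Qplus r"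
  unfolding Qplus_def using Poly_Mapping.keys_add[of \<beta> \<gamma>] by blast

lemma Qplus_qroot [simp]: "i \<in> {1..r} \<Longrightarrow> qroot i \<in> Qplus r"
  by (simp add: Qplus_def qroot_def)

section \<open>Powers of q and the separation of weights\<close>

lemma qpow_add: "qpow h (x + y) = qpow h x * qpow h y"
  by (simp add: qpow_def distrib_right exp_add)

lemma qpow_minus: "qpow h (- x) = inverse (qpow h x)"
  by (simp add: qpow_def exp_minus)

lemma qpow_diff: "qpow h (x - y) = qpow h x / qpow h y"
  by (simp add: qpow_def left_diff_distrib exp_diff)

lemma qpow_nonzero [simp]: "qpow h x \<noteq> 0"
  by (simp add: qpow_def)

lemma qpow_0 [simp]: "qpow h 0 = 1"
  by (simp add: qpow_def)

lemma qpow_of_int: "qpow h (of_int n) = exp h powi n"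
  by (cases n rule: int_cases2) (simp_all add: qpow_def power_int_minus exp_of_nat_mult exp_minus)

lemma qpow_power: "qpow h x ^ n = qpow h (of_nat n * x)"
  by (simp add: qpow_def exp_of_nat_mult[symmetric] mult.assoc)

lemma exp_powi_eq_1_imp:
  assumes "\<forall>n>0. exp h ^ n \<noteq> (1::complex)" "exp h powi n = 1"
  shows "n = 0"
proof (rule ccontr)
  assume "n \<noteq> 0"
  then have "exp h ^ nat \<bar>n\<bar> = 1"
    using assms(2) by (cases n rule: int_cases2) (auto simp: power_int_minus)
  with assms(1) \<open>n \<noteq> 0\<close> show False by auto
qed

text \<open>The difference of the two weights has integer coordinates, so it pairs integrally with
  each simple root. As q is not a root of unity, an integral power equal to 1 has exponent 0, and
  nondegeneracy finishes the argument. For arbitrary complex differences equal powers of q would not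
  give equal exponents.\<close>

lemma weights_separated:
  assumes gen: "\<forall>n>0. exp h ^ n \<noteq> (1::complex)"
    and eq: "\<And>i. i \<in> {1..r} \<Longrightarrow> qpow h (wform r x (sroot i)) = qpow h (wform r y (sroot i))"
    and int: "\<And>k. k \<in> {1..r} \<Longrightarrow> Poly_Mapping.lookup x k - Poly_Mapping.lookup y k = of_int (m k)"
    and k: "k \<in> {1..r}"
  shows "m k = 0"
proof -
  have "wform r (x - y) (sroot i) = 0" if i: "i \<in> {1..r}" for i
  proof -
    have n: "wform r (x - y) (sroot i) = of_int (\<Sum>k=1..r. m k * cartan k i)"
      using i int by (simp add: wform_sroot_right lookup_minus)
    have "qpow h (wform r (x - y) (sroot i)) = 1"
      using eq[OF i] by (simp add: wform_diff_left qpow_diff)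
    then have "(\<Sum>k=1..r. m k * cartan k i) = 0"
      unfolding n qpow_of_int by (rule exp_powi_eq_1_imp[OF gen])
    then show ?thesis using n by simp
  qed
  then have "Poly_Mapping.lookup (x - y) k = 0"
    using k by (rule wform_sroot_zero_imp_zero)
  then show ?thesis using int[OF k] by (simp add: lookup_minus)
qed

section \<open>Weight vectors and the action of the generators on them\<close>

context verma_params
begin

text \<open>The eigenvalue of \<open>K_i\<close> on the weight \<nu>.\<close>

definition chi :: "weight \<Rightarrow> nat \<Rightarrow> complex" where
  "chi \<nu> i = qpow h (wform r \<nu> (sroot i))"

lemma chi_nonzero [simp]: "chi \<nu> i \<noteq> 0"
  by (simp add: chi_def)

lemma chi_add_sroot:
  assumes "i \<in> {1..r}" "j \<in> {1..r}"
  shows "chi (\<nu> + sroot j) i = exp h powi cartan j i * chi \<nu> i"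
  using assms
  by (simp add: chi_def wform_add_left wform_sroot_sroot qpow_add qpow_of_int mult.commute)

lemma chi_diff_sroot:
  assumes "i \<in> {1..r}" "j \<in> {1..r}"
  shows "chi (\<nu> - sroot j) i = exp h powi (- cartan j i) * chi \<nu> i"
  using assms
  by (simp add: chi_def wform_diff_left wform_sroot_sroot qpow_diff qpow_of_int power_int_minus field_simps)

text \<open>The preimage of a weight space in the free algebra; it contains the whole ideal and is
  closed under \<open>keq\<close>.\<close>

definition wspace :: "weight \<Rightarrow> freealg set" where
  "wspace \<nu> = {x \<in> free_carrier r. \<forall>i\<in>{1..r}. keq (gK i * x) (const (chi \<nu> i) * x)}"

lemma wspace_carrier: "x \<in> wspace \<nu> \<Longrightarrow> x \<in> free_carrier r"
  by (simp add: wspace_def)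

lemma keq_K: "x \<in> wspace \<nu> \<Longrightarrow> i \<in> {1..r} \<Longrightarrow> keq (gK i * x) (const (chi \<nu> i) * x)"
  by (simp add: wspace_def)

lemma keq_carrier:
  assumes "keq x y" "y \<in> free_carrier r" shows "x \<in> free_carrier r"
proof -
  have "x - y \<in> free_carrier r" using assms(1) ket_ideal_subset unfolding keq_def by blast
  from free_carrier_add[OF this assms(2)] show ?thesis by simp
qed

lemma wspace_keq:
  assumes "x \<in> wspace \<nu>" "keq y x"
  shows "y \<in> wspace \<nu>"
  unfolding wspace_def
proof (safe)
  show "y \<in> free_carrier r" using keq_carrier[OF assms(2)] assms(1) by (simp add: wspace_def)
  fix i assume i: "i \<in> {1..r}"
  have "keq (gK i * y) (gK i * x)" using assms i by (intro keq_lmult) auto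
  also have "keq (gK i * x) (const (chi \<nu> i) * x)" using assms i by (intro keq_K)
  also have "keq (const (chi \<nu> i) * x) (const (chi \<nu> i) * y)"
    using keq_sym[OF assms(2)] by (intro keq_lmult) auto
  finally show "keq (gK i * y) (const (chi \<nu> i) * y)" .
qed

lemma wspaceI:
  "x \<in> free_carrier r \<Longrightarrow> (\<And>i. i \<in> {1..r} \<Longrightarrow> keq (gK i * x) (const (chi \<nu> i) * x)) \<Longrightarrow> x \<in> wspace \<nu>"
  by (simp add: wspace_def)

lemma wspace_add:
  assumes "x \<in> wspace \<nu>" "y \<in> wspace \<nu>" shows "x + y \<in> wspace \<nu>"
proof (rule wspaceI)
  fix i assume "i \<in> {1..r}"
  with assms have "keq (gK i * x + gK i * y) (const (chi \<nu> i) * x + const (chi \<nu> i) * y)"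
    by (intro keq_add keq_K)
  then show "keq (gK i * (x + y)) (const (chi \<nu> i) * (x + y))" by (simp only: distrib_left)
qed (use assms[THEN wspace_carrier] in simp)

lemma wspace_const:
  assumes "x \<in> wspace \<nu>" shows "const c * x \<in> wspace \<nu>"
proof (rule wspaceI)
  fix i assume "i \<in> {1..r}"
  with assms have "keq (const c * (gK i * x)) (const c * (const (chi \<nu> i) * x))"
    by (intro keq_lmult keq_K free_carrier_const)
  then show "keq (gK i * (const c * x)) (const (chi \<nu> i) * (const c * x))"
    by (simp only: const_left_commute[of "gK i"] const_left_commute[of "const (chi \<nu> i)"])
qed (use assms[THEN wspace_carrier] in simp)

lemma wspace_diff:
  assumes "x \<in> wspace \<nu>" "y \<in> wspace \<nu>" shows "x - y \<in> wspace \<nu>"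
  using wspace_add[OF assms(1) wspace_const[OF assms(2), of "-1"]] by (simp add: const_uminus)

lemma wspace_zero: "0 \<in> wspace \<nu>"
  by (simp add: wspace_def)

lemma wspace_sum: "(\<And>i. i \<in> I \<Longrightarrow> f i \<in> wspace \<nu>) \<Longrightarrow> (\<Sum>i\<in>I. f i) \<in> wspace \<nu>"
  by (induction I rule: infinite_finite_induct) (auto intro: wspace_add wspace_zero)

lemma wspace_one: "1 \<in> wspace lam"
  by (auto simp: wspace_def chi_def intro: keq_K_vac)

lemma wspace_F:
  assumes x: "x \<in> wspace \<nu>" and j: "j \<in> {1..r}"
  shows "gF j * x \<in> wspace (\<nu> - sroot j)"
  unfolding wspace_def
proof (safe)
  show "gF j * x \<in> free_carrier r" using assms wspace_carrier by auto
  fix i assume i: "i \<in> {1..r}"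
  have "keq (gK i * (gF j * x)) (const (exp h powi (- cartan j i)) * (gF j * (gK i * x)))"
    using assms i wspace_carrier by (intro keq_KF)
  also have "keq \<dots> (const (exp h powi (- cartan j i)) * (gF j * (const (chi \<nu> i) * x)))"
    using assms i by (intro keq_lmult keq_K) auto
  also have "\<dots> = const (chi (\<nu> - sroot j) i) * (gF j * x)"
    by (simp add: const_left_commute[of "gF j"] const_mult_left chi_diff_sroot[OF i j])
  finally show "keq (gK i * (gF j * x)) (const (chi (\<nu> - sroot j) i) * (gF j * x))" .
qed

lemma wspace_E:
  assumes x: "x \<in> wspace \<nu>" and j: "j \<in> {1..r}"
  shows "gE j * x \<in> wspace (\<nu> + sroot j)"
  unfolding wspace_def
proof (safe)
  show "gE j * x \<in> free_carrier r" using assms wspace_carrier by auto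
  fix i assume i: "i \<in> {1..r}"
  have "keq (gK i * (gE j * x)) (const (exp h powi (cartan j i)) * (gE j * (gK i * x)))"
    using assms i wspace_carrier by (intro keq_KE)
  also have "keq \<dots> (const (exp h powi (cartan j i)) * (gE j * (const (chi \<nu> i) * x)))"
    using assms i by (intro keq_lmult keq_K) auto
  also have "\<dots> = const (chi (\<nu> + sroot j) i) * (gE j * x)"
    by (simp add: const_left_commute[of "gE j"] const_mult_left chi_add_sroot[OF i j])
  finally show "keq (gK i * (gE j * x)) (const (chi (\<nu> + sroot j) i) * (gE j * x))" .
qed

text \<open>Multiplied by the eigenvalue of \<open>K_i\<close>, both sides reduce to
  \<open>x\<close>, by the relation for the inverse; the eigenvalue is nonzero and cancels.\<close>

lemma keq_Kinv:
  assumes x: "x \<in> wspace \<nu>" and i: "i \<in> {1..r}"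
  shows "keq (gKinv i * x) (const (inverse (chi \<nu> i)) * x)"
proof (rule keq_const_cancel)
  have "const (chi \<nu> i) * (gKinv i * x) = gKinv i * (const (chi \<nu> i) * x)"
    by (simp add: const_left_commute)
  also have "keq \<dots> (gKinv i * (gK i * x))"
    using assms by (intro keq_lmult keq_sym[OF keq_K]) auto
  also have "keq \<dots> x" using assms wspace_carrier by (intro keq_KinvK)
  finally have "keq (const (chi \<nu> i) * (gKinv i * x)) x" .
  moreover have "const (chi \<nu> i) * (const (inverse (chi \<nu> i)) * x) = x"
    by (simp add: const_mult_left)
  ultimately show "keq (const (chi \<nu> i) * (gKinv i * x)) (const (chi \<nu> i) * (const (inverse (chi \<nu> i)) * x))"
    by simp
qed simp

text \<open>The q-number of (\<nu>|\<alpha>_i), the scalar by which the commutator of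
  \<open>E_i\<close> and \<open>F_i\<close> acts on the weight \<nu>.\<close>

definition qbracket :: "weight \<Rightarrow> nat \<Rightarrow> complex" where
  "qbracket \<nu> i = (chi \<nu> i - inverse (chi \<nu> i)) / (exp h - inverse (exp h))"

lemma keq_EF_wspace:
  assumes "i \<in> {1..r}" "j \<in> {1..r}" "x \<in> wspace \<nu>"
  shows "keq (gE i * (gF j * x)) (gF j * (gE i * x) + const (if i = j then qbracket \<nu> i else 0) * x)"
proof -
  let ?c = "inverse (exp h - inverse (exp h))"
  have "keq (gE i * (gF j * x)) (gF j * (gE i * x) + (if i = j then const ?c * (gK i * x - gKinv i * x) else 0))"
    using assms wspace_carrier by (intro keq_EF)
  also have "keq \<dots> (gF j * (gE i * x) + (if i = j then const ?c * (const (chi \<nu> i) * x - const (inverse (chi \<nu> i)) * x) else 0))"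
    using assms by (auto intro!: keq_add keq_lmult keq_diff keq_K keq_Kinv)
  also have "const ?c * (const (chi \<nu> i) * x - const (inverse (chi \<nu> i)) * x) = const (qbracket \<nu> i) * x"
  proof -
    have "qbracket \<nu> i = ?c * (chi \<nu> i - inverse (chi \<nu> i))"
      by (simp add: qbracket_def divide_inverse)
    then show ?thesis
      by (simp only: const_mult const_diff left_diff_distrib right_diff_distrib mult.assoc)
  qed
  finally show ?thesis by (cases "i = j") auto
qed

text \<open>Sums of weight vectors are separated by applying products of operators \<open>K\<^sub>i - c\<close>.\<close>

fun kshift :: "(nat \<times> complex) list \<Rightarrow> freealg \<Rightarrow> freealg" where
  "kshift [] x = x"
| "kshift ((i, c) # L) x = gK i * kshift L x - const c * kshift L x"

lemma kshift_add: "kshift L (x + y) = kshift L x + kshift L y"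
  by (induction L x rule: kshift.induct) (simp_all add: algebra_simps)

lemma kshift_wspace:
  assumes "fst ` set L \<subseteq> {1..r}" "x \<in> wspace \<nu>"
  shows "keq (kshift L x) (const (\<Prod>(i, c)\<leftarrow>L. chi \<nu> i - c) * x)"
  using assms
proof (induction L x rule: kshift.induct)
  case (2 i c L x)
  then have IH: "keq (kshift L x) (const (\<Prod>(i, c)\<leftarrow>L. chi \<nu> i - c) * x)" (is "keq _ ?y")
    and i: "i \<in> {1..r}" by auto
  have y: "?y \<in> wspace \<nu>" using 2 wspace_const by blast
  have "keq (kshift ((i, c) # L) x) (gK i * ?y - const c * ?y)"
    unfolding kshift.simps using i by (intro keq_diff keq_lmult IH) auto
  also have "keq \<dots> (const (chi \<nu> i) * ?y - const c * ?y)"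
    using i y by (intro keq_diff keq_K) auto
  also have "\<dots> = const (\<Prod>(i, c)\<leftarrow>(i, c) # L. chi \<nu> i - c) * x"
    by (simp add: const_mult const_diff algebra_simps)
  finally show ?case .
qed auto

text \<open>The sum of the weight spaces with weights in \<open>\<Gamma>\<close>, given without
  fixing a decomposition. The ideal is included so that membership depends on the congruence class
  only.\<close>

inductive_set wsum :: "weight set \<Rightarrow> freealg set" for \<Gamma> where
  base: "x \<in> ket_ideal r h lam \<Longrightarrow> x \<in> wsum \<Gamma>"
| step: "\<gamma> \<in> \<Gamma> \<Longrightarrow> x \<in> wspace \<gamma> \<Longrightarrow> y \<in> wsum \<Gamma> \<Longrightarrow> x + y \<in> wsum \<Gamma>"

lemma wsum_add:
  assumes "x \<in> wsum \<Gamma>" "y \<in> wsum \<Gamma>"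
  shows "x + y \<in> wsum \<Gamma>"
proof -
  \<comment> \<open>An ideal element is absorbed into the second sum first; the induction over the
    first sum then needs only associativity.\<close>
  have J: "x + y \<in> wsum \<Gamma>" if "x \<in> ket_ideal r h lam" for x
    using assms(2)
  proof induction
    case (base y)
    show ?case by (rule wsum.base) (rule ket_ideal_add[OF that base])
  next
    case (step \<gamma> z y)
    have "z + (x + y) \<in> wsum \<Gamma>" by (rule wsum.step) (rule step)+
    then show ?case by (simp only: add.left_commute)
  qed
  show ?thesis
    using assms(1)
  proof induction
    case (base x)
    then show ?case by (rule J)
  next
    case (step \<gamma> x y')
    have "x + (y' + y) \<in> wsum \<Gamma>" by (rule wsum.step) (rule step)+
    then show ?case by (simp only: add.assoc)
  qed
qed

lemma wsum_mono: "x \<in> wsum \<Gamma> \<Longrightarrow> \<Gamma> \<subseteq> \<Delta> \<Longrightarrow> x \<in> wsum \<Delta>"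
proof (induction rule: wsum.induct)
  case (base x)
  then show ?case by (intro wsum.base)
next
  case (step \<gamma> x y)
  then show ?case by (intro wsum.step[of \<gamma>]) (simp_all add: subset_iff)
qed

lemma wsum_lmult:
  assumes "x \<in> wsum \<Gamma>" "a \<in> free_carrier r"
    and "\<And>\<gamma> x. \<gamma> \<in> \<Gamma> \<Longrightarrow> x \<in> wspace \<gamma> \<Longrightarrow> a * x \<in> wspace (g \<gamma>)"
  shows "a * x \<in> wsum (g ` \<Gamma>)"
  using assms(1)
proof induction
  case (base x)
  then show ?case by (rule wsum.base[OF ket_ideal_lmult[OF assms(2)]])
next
  case (step \<gamma> x y)
  have "a * x + a * y \<in> wsum (g ` \<Gamma>)"
    by (rule wsum.step[OF imageI[OF step(1)] assms(3)[OF step(1,2)] step.IH])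
  then show ?case by (simp add: distrib_left)
qed

lemma wsum_F: "x \<in> wsum \<Gamma> \<Longrightarrow> j \<in> {1..r} \<Longrightarrow> gF j * x \<in> wsum ((\<lambda>\<gamma>. \<gamma> - sroot j) ` \<Gamma>)"
  by (rule wsum_lmult) (simp_all add: wspace_F)

lemma wsum_const: "x \<in> wsum \<Gamma> \<Longrightarrow> const c * x \<in> wsum \<Gamma>"
  using wsum_lmult[of x \<Gamma> "const c" "\<lambda>\<gamma>. \<gamma>"] by (simp add: wspace_const)

lemma wspace_K:
  assumes "x \<in> wspace \<nu>" "i \<in> {1..r}" shows "gK i * x \<in> wspace \<nu>"
  using wspace_keq[OF wspace_const[OF assms(1)] keq_K[OF assms]] .

lemma wsum_K: "x \<in> wsum \<Gamma> \<Longrightarrow> i \<in> {1..r} \<Longrightarrow> gK i * x \<in> wsum \<Gamma>"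
  using wsum_lmult[of x \<Gamma> "gK i" "\<lambda>\<gamma>. \<gamma>"] by (simp add: wspace_K)

lemma wsum_keq: "x \<in> wsum \<Gamma> \<Longrightarrow> keq y x \<Longrightarrow> y \<in> wsum \<Gamma>"
  using wsum_add[of x \<Gamma> "y - x"] wsum.base[of "y - x"] by (simp add: keq_def)

text \<open>Each weight vector of the sum is killed by one factor \<open>K_i - c\<close>, with
  \<open>c\<close> its own eigenvalue. The separation of its weight from \<nu> allows
  \<open>i\<close> to be chosen so that this factor is invertible on weight \<nu>.\<close>

lemma wsum_kshift:
  assumes "y \<in> wsum \<Gamma>"
    and sep: "\<And>\<gamma>. \<gamma> \<in> \<Gamma> \<Longrightarrow> \<exists>i\<in>{1..r}. chi \<gamma> i \<noteq> chi \<nu> i"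
  shows "\<exists>L. fst ` set L \<subseteq> {1..r} \<and> (\<Prod>(i, c)\<leftarrow>L. chi \<nu> i - c) \<noteq> 0 \<and> kshift L y \<in> ket_ideal r h lam"
  using assms(1)
proof induction
  case (base x)
  then have "kshift [] x \<in> ket_ideal r h lam" by simp
  then show ?case by (intro exI[of _ "[]"]) simp
next
  case (step \<gamma> x y)
  from step.IH obtain L where L: "fst ` set L \<subseteq> {1..r}" "(\<Prod>(i, c)\<leftarrow>L. chi \<nu> i - c) \<noteq> 0"
    "kshift L y \<in> ket_ideal r h lam" by blast
  obtain i where i: "i \<in> {1..r}" "chi \<gamma> i \<noteq> chi \<nu> i" using sep step(1) by blast
  \<comment> \<open>The new factor annihilates the new summand \<open>x\<close>; the old factors
    already annihilate \<open>y\<close>.\<close>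
  let ?L = "(i, chi \<gamma> i) # L"
  have L': "fst ` set ?L \<subseteq> {1..r}" using L i by simp
  have "keq (kshift ?L x) (const (\<Prod>(i, c)\<leftarrow>?L. chi \<gamma> i - c) * x)"
    using L' step(2) by (rule kshift_wspace)
  then have 1: "kshift ?L x \<in> ket_ideal r h lam" by (simp add: keq_zero_iff)
  have 2: "kshift ?L y \<in> ket_ideal r h lam"
    unfolding kshift.simps using L i by (intro ket_ideal_diff ket_ideal_lmult) simp_all
  have "kshift ?L (x + y) \<in> ket_ideal r h lam"
    unfolding kshift_add using 1 2 by (rule ket_ideal_add)
  moreover have "(\<Prod>(i, c)\<leftarrow>?L. chi \<nu> i - c) \<noteq> 0" using L i by simp
  ultimately show ?case using L' by blast
qed

text \<open>The separating product multiplies \<open>x\<close> by a nonzero scalar and yet sends it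
  into the ideal. This is the independence of distinct weight spaces.\<close>

lemma wspace_inter_wsum:
  assumes "x \<in> wspace \<nu>" "x \<in> wsum \<Gamma>"
    and "\<And>\<gamma>. \<gamma> \<in> \<Gamma> \<Longrightarrow> \<exists>i\<in>{1..r}. chi \<gamma> i \<noteq> chi \<nu> i"
  shows "x \<in> ket_ideal r h lam"
proof -
  obtain L where L: "fst ` set L \<subseteq> {1..r}" "(\<Prod>(i, c)\<leftarrow>L. chi \<nu> i - c) \<noteq> 0"
    "kshift L x \<in> ket_ideal r h lam"
    using wsum_kshift[OF assms(2,3)] by blast
  show ?thesis
    using keq_ket_ideal[OF kshift_wspace[OF L(1) assms(1)]] L(2,3) ket_ideal_const_cancel[of _ x] by simp
qed

end

section \<open>Heights in the positive root lattice and words in the lowering operators\<close>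

section \<open>Modules generated by highest weight vectors\<close>

text \<open>The height of \<beta>, which serves as the measure in all inductions over the positive
  root lattice.\<close>

definition qdeg :: "nat \<Rightarrow> (nat \<Rightarrow>\<^sub>0 nat) \<Rightarrow> nat" where
  "qdeg r \<beta> = (\<Sum>i=1..r. Poly_Mapping.lookup \<beta> i)"

lemma lookup_qroot: "Poly_Mapping.lookup (qroot i) j = (if i = j then 1 else 0)"
  by (simp add: qroot_def lookup_single when_def)

lemma Qplus_lookup: "\<beta> \<in> Qplus r \<Longrightarrow> k \<notin> {1..r} \<Longrightarrow> Poly_Mapping.lookup \<beta> k = 0"
  by (auto simp: Qplus_def in_keys_iff subset_iff)

lemma Qplus_eqI:
  assumes "\<beta> \<in> Qplus r" "\<gamma> \<in> Qplus r"
    and "\<And>k. k \<in> {1..r} \<Longrightarrow> Poly_Mapping.lookup \<beta> k = Poly_Mapping.lookup \<gamma> k"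
  shows "\<beta> = \<gamma>"
proof (rule poly_mapping_eqI)
  fix k show "Poly_Mapping.lookup \<beta> k = Poly_Mapping.lookup \<gamma> k"
    using assms Qplus_lookup[of _ r k] by (cases "k \<in> {1..r}") auto
qed

text \<open>Subtraction of natural coordinates is truncated at 0, hence the positivity
  condition.\<close>

lemma diff_qroot_add: "0 < Poly_Mapping.lookup \<beta> i \<Longrightarrow> \<beta> - qroot i + qroot i = \<beta>"
  by (rule poly_mapping_eqI) (auto simp: lookup_add lookup_minus lookup_qroot)

lemma Qplus_diff_qroot: "\<beta> \<in> Qplus r \<Longrightarrow> \<beta> - qroot i \<in> Qplus r"
  by (auto simp: Qplus_def in_keys_iff lookup_minus subset_iff)

lemma qdeg_add_qroot: "i \<in> {1..r} \<Longrightarrow> qdeg r (\<beta> + qroot i) = Suc (qdeg r \<beta>)"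
  by (simp add: qdeg_def lookup_add lookup_qroot sum.distrib)

lemma qdeg_diff_qroot:
  "i \<in> {1..r} \<Longrightarrow> 0 < Poly_Mapping.lookup \<beta> i \<Longrightarrow> qdeg r (\<beta> - qroot i) < qdeg r \<beta>"
  using qdeg_add_qroot[of i r "\<beta> - qroot i"] by (simp add: diff_qroot_add)

lemma Qplus_nonzero: "\<beta> \<in> Qplus r \<Longrightarrow> \<beta> \<noteq> 0 \<Longrightarrow> \<exists>i\<in>{1..r}. 0 < Poly_Mapping.lookup \<beta> i"
  using Qplus_eqI[of \<beta> r 0] by (metis Qplus_zero lookup_zero gr0I)

text \<open>The amount by which the corresponding word in the \<open>F_i\<close> lowers a
  weight.\<close>

definition content :: "nat list \<Rightarrow> (nat \<Rightarrow>\<^sub>0 nat)" where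
  "content is = sum_list (map qroot is)"

lemma content_Qplus: "set is \<subseteq> {1..r} \<Longrightarrow> content is \<in> Qplus r"
  by (induction "is") (auto simp: content_def)

lemma content_Cons: "content (i # is) = qroot i + content is"
  by (simp add: content_def)

lemma content_nonzero: "content (i # is) \<noteq> 0"
proof
  assume "content (i # is) = 0"
  then have "Poly_Mapping.lookup (content (i # is)) i = 0" by simp
  then show False by (simp add: content_Cons lookup_add lookup_qroot)
qed

context verma_params
begin

fun Fword :: "nat list \<Rightarrow> freealg \<Rightarrow> freealg" where
  "Fword [] d = d"
| "Fword (i # is) d = gF i * Fword is d"

lemma Fword_wspace:
  "set is \<subseteq> {1..r} \<Longrightarrow> d \<in> wspace \<nu> \<Longrightarrow> Fword is d \<in> wspace (\<nu> - wt (content is))"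
proof (induction "is")
  case (Cons i "is")
  then have "gF i * Fword is d \<in> wspace (\<nu> - wt (content is) - sroot i)"
    by (intro wspace_F) auto
  then show ?case by (simp add: content_Cons wt_add wt_qroot diff_diff_eq add.commute)
qed (simp add: content_def)

text \<open>The span of all words in the \<open>F_i\<close> applied to \<open>d\<close>, modulo the
  ideal.\<close>

inductive_set hwspan :: "freealg \<Rightarrow> freealg set" for d where
  base: "x \<in> ket_ideal r h lam \<Longrightarrow> x \<in> hwspan d"
| step: "set is \<subseteq> {1..r} \<Longrightarrow> y \<in> hwspan d \<Longrightarrow> const c * Fword is d + y \<in> hwspan d"

lemma hwspan_add:
  assumes "x \<in> hwspan d" "y \<in> hwspan d"
  shows "x + y \<in> hwspan d"
proof -
  have J: "x + y \<in> hwspan d" if "x \<in> ket_ideal r h lam" for x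
    using assms(2)
  proof induction
    case (base y)
    show ?case by (rule hwspan.base) (rule ket_ideal_add[OF that base])
  next
    case (step "is" y c)
    have "const c * Fword is d + (x + y) \<in> hwspan d" by (rule hwspan.step) (rule step)+
    then show ?case by (simp only: add.left_commute)
  qed
  show ?thesis
    using assms(1)
  proof induction
    case (base x)
    then show ?case by (rule J)
  next
    case (step "is" y' c)
    have "const c * Fword is d + (y' + y) \<in> hwspan d" by (rule hwspan.step) (rule step)+
    then show ?case by (simp only: add.assoc)
  qed
qed

lemma hwspan_keq: "x \<in> hwspan d \<Longrightarrow> keq y x \<Longrightarrow> y \<in> hwspan d"
  using hwspan_add[of x d "y - x"] hwspan.base[of "y - x"] by (simp add: keq_def)

lemma hwspan_Fword: "set is \<subseteq> {1..r} \<Longrightarrow> const c * Fword is d \<in> hwspan d"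
  using hwspan.step[of "is" 0 d c] hwspan.base[OF ket_ideal_zero] by simp

lemma hwspan_lmult:
  assumes "a \<in> free_carrier r"
    and "\<And>is c. set is \<subseteq> {1..r} \<Longrightarrow> a * (const c * Fword is d) \<in> hwspan d"
    and "x \<in> hwspan d"
  shows "a * x \<in> hwspan d"
  using assms(3)
proof induction
  case (base x)
  then show ?case by (rule hwspan.base[OF ket_ideal_lmult[OF assms(1)]])
next
  case (step "is" y c)
  have "a * (const c * Fword is d) + a * y \<in> hwspan d"
    by (rule hwspan_add[OF assms(2)[OF step(1)] step.IH])
  then show ?case by (simp only: distrib_left)
qed

lemma hwspan_F: "i \<in> {1..r} \<Longrightarrow> x \<in> hwspan d \<Longrightarrow> gF i * x \<in> hwspan d"
proof (rule hwspan_lmult)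
  fix "is" c assume "i \<in> {1..r}" "set is \<subseteq> {1..r}"
  then show "gF i * (const c * Fword is d) \<in> hwspan d"
    using hwspan_Fword[of "i # is" c d] by (simp add: const_left_commute[of "gF i"])
qed auto

lemma hwspan_const: "x \<in> hwspan d \<Longrightarrow> const c * x \<in> hwspan d"
  by (rule hwspan_lmult) (auto simp: const_mult_left hwspan_Fword)

text \<open>\<open>E_i\<close> is moved to the right through the word. Each passage past an
  \<open>F_i\<close> leaves a scalar multiple of a shorter word, and in the end \<open>E_i\<close>
  reaches \<open>d\<close>, which it sends into the ideal.\<close>

lemma hwspan_E_Fword:
  assumes "d \<in> wspace \<nu>" "gE i * d \<in> ket_ideal r h lam" "i \<in> {1..r}"
  shows "set is \<subseteq> {1..r} \<Longrightarrow> gE i * Fword is d \<in> hwspan d"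
proof (induction "is")
  case Nil
  then show ?case using assms(2) hwspan.base by simp
next
  case (Cons j "is")
  then have w: "Fword is d \<in> wspace (\<nu> - wt (content is))"
    by (intro Fword_wspace assms(1)) auto
  show ?case
    unfolding Fword.simps
  proof (rule hwspan_keq[OF _ keq_EF_wspace[OF assms(3) _ w]])
    show "j \<in> {1..r}" using Cons by simp
    show "gF j * (gE i * Fword is d) + const (if i = j then qbracket (\<nu> - wt (content is)) i else 0) * Fword is d
      \<in> hwspan d"
      using Cons by (intro hwspan_add hwspan_F hwspan_Fword) auto
  qed
qed

text \<open>The span of the \<open>F\<close>-words on a singular weight vector is stable under every
  generator. This takes the place of the triangular decomposition.\<close>

lemma highest_weight_generates:
  assumes d: "d \<in> wspace \<nu>" and E: "\<And>i. i \<in> {1..r} \<Longrightarrow> gE i * d \<in> ket_ideal r h lam"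
    and a: "a \<in> free_carrier r"
  shows "a * d \<in> hwspan d"
  using a
proof (induction a rule: free_carrier_induct)
  case (const c)
  show ?case using hwspan_Fword[of "[]" c d] by simp
next
  case (add a b)
  then show ?case by (simp add: distrib_right hwspan_add)
next
  case (gen l a)
  have l: "gen l * (const c * Fword is d) \<in> hwspan d" if "set is \<subseteq> {1..r}" for "is" c
  proof -
    have w: "Fword is d \<in> wspace (\<nu> - wt (content is))" by (rule Fword_wspace[OF that d])
    from gen(1) have "gen l * Fword is d \<in> hwspan d"
    proof (elim UnE imageE)
      fix i assume "l = LE i" "i \<in> {1..r}"
      then show ?thesis using hwspan_E_Fword[OF d E _ that] by simp
    next
      fix i assume "l = LF i" "i \<in> {1..r}"
      then show ?thesis using hwspan_Fword[of "i # is" 1] that by simp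
    next
      fix i assume "l = LK i" "i \<in> {1..r}"
      then show ?thesis using hwspan_keq[OF hwspan_Fword[OF that] keq_K[OF w]] by simp
    next
      fix i assume "l = LKinv i" "i \<in> {1..r}"
      then show ?thesis using hwspan_keq[OF hwspan_Fword[OF that] keq_Kinv[OF w]] by simp
    qed
    then show ?thesis by (simp add: const_left_commute[of "gen l"] hwspan_const)
  qed
  show ?case
    unfolding mult.assoc by (rule hwspan_lmult[OF free_carrier_gen[OF gen(1)] l gen.IH])
qed

lemma hwspan_wsum:
  assumes "x \<in> hwspan d" "d \<in> wspace \<nu>"
  shows "x \<in> wsum ((\<lambda>\<gamma>. \<nu> - wt \<gamma>) ` Qplus r)"
  using assms(1)
proof induction
  case (base x)
  then show ?case by (rule wsum.base)
next
  case (step "is" y c)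
  show ?case
    by (rule wsum.step[OF _ wspace_const[OF Fword_wspace[OF step(1) assms(2)]] step.IH])
      (use content_Qplus[OF step(1)] in blast)
qed

text \<open>The empty word contributes the constant; every other word has weight strictly below
  \<lambda>.\<close>

lemma hwspan_one_split:
  assumes "x \<in> hwspan 1"
  shows "\<exists>c. \<exists>y\<in>wsum ((\<lambda>\<gamma>. lam - wt \<gamma>) ` (Qplus r - {0})). x = const c + y"
  using assms
proof induction
  case (base x)
  then show ?case using wsum.base[of x] by (intro exI[of _ 0] bexI[of _ x]) auto
next
  case (step "is" y c)
  then obtain c' y' where y: "y = const c' + y'" "y' \<in> wsum ((\<lambda>\<gamma>. lam - wt \<gamma>) ` (Qplus r - {0}))"
    by blast
  show ?case
  proof (cases "is")
    case Nil
    then show ?thesis using y by (intro exI[of _ "c + c'"] bexI[of _ y']) (auto simp: const_add)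
  next
    case (Cons i js)
    have "const c * Fword is 1 + y' \<in> wsum ((\<lambda>\<gamma>. lam - wt \<gamma>) ` (Qplus r - {0}))"
      by (rule wsum.step[OF _ wspace_const[OF Fword_wspace[OF step(1) wspace_one]] y(2)])
        (use content_Qplus[OF step(1)] content_nonzero Cons in blast)
    then show ?thesis
      using y by (intro exI[of _ c'] bexI[of _ "const c * Fword is 1 + y'"]) (auto simp: add_ac)
  qed
qed

lemma carrier_hwspan: "a \<in> free_carrier r \<Longrightarrow> a \<in> hwspan 1"
  using highest_weight_generates[OF wspace_one, of a] by (simp add: gE_in_ket_ideal)

section \<open>From representatives to cosets\<close>

lemma ket_coset_eq_iff: "a +o ket_ideal r h lam = b +o ket_ideal r h lam \<longleftrightarrow> keq a b"
proof
  assume "a +o ket_ideal r h lam = b +o ket_ideal r h lam"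
  moreover have "a \<in> a +o ket_ideal r h lam"
    using set_plus_intro2[OF ket_ideal_zero, of a] by simp
  ultimately show "keq a b" unfolding keq_def using set_plus_imp_minus by blast
next
  have sub: "a +o ket_ideal r h lam \<subseteq> b +o ket_ideal r h lam" if "keq a b" for a b
  proof
    fix x assume "x \<in> a +o ket_ideal r h lam"
    then have "keq x a" unfolding keq_def by (rule set_plus_imp_minus)
    from keq_trans[OF this that] show "x \<in> b +o ket_ideal r h lam"
      unfolding keq_def by (rule set_minus_imp_plus)
  qed
  assume "keq a b"
  then show "a +o ket_ideal r h lam = b +o ket_ideal r h lam"
    using sub keq_sym by blast
qed

lemma ket_ideal_plus_self: "ket_ideal r h lam + ket_ideal r h lam = ket_ideal r h lam"
  using ket_ideal_add ket_ideal_zero by (force simp: set_plus_def)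

text \<open>The image of a coset under left multiplication need not fill a coset; adding the ideal,
  as \<open>ket_act\<close> does, completes it.\<close>

lemma ket_act_coset:
  assumes a: "a \<in> free_carrier r"
  shows "ket_act r h lam a (x +o ket_ideal r h lam) = (a * x) +o ket_ideal r h lam"
proof -
  have "(\<lambda>y. a * y) ` (x +o ket_ideal r h lam) \<subseteq> (a * x) +o ket_ideal r h lam"
    using ket_ideal_lmult[OF a] by (auto simp: elt_set_plus_def distrib_left)
  then have "ket_act r h lam a (x +o ket_ideal r h lam) \<subseteq> (a * x) +o ket_ideal r h lam + ket_ideal r h lam"
    unfolding ket_act_def by (intro set_plus_mono2) auto
  also have "\<dots> = (a * x) +o ket_ideal r h lam"
    by (simp only: set_plus_rearrange3 ket_ideal_plus_self)
  finally have 1: "ket_act r h lam a (x +o ket_ideal r h lam) \<subseteq> (a * x) +o ket_ideal r h lam" .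
  have "a * x \<in> (\<lambda>y. a * y) ` (x +o ket_ideal r h lam)"
    using set_plus_intro2[OF ket_ideal_zero, of x] by simp
  then have 2: "(a * x) +o ket_ideal r h lam \<subseteq> ket_act r h lam a (x +o ket_ideal r h lam)"
    unfolding ket_act_def by (rule set_plus_mono3)
  from 1 2 show ?thesis by blast
qed

end

section \<open>Consequences of irreducibility\<close>

locale verma_irreducible_params = verma_params +
  assumes nonroot: "\<forall>n>0. exp h ^ n \<noteq> 1"
    and irreducible: "verma_irreducible r h lam"
begin

lemma chi_separated:
  assumes "\<And>k. k \<in> {1..r} \<Longrightarrow> Poly_Mapping.lookup x k - Poly_Mapping.lookup y k = of_int (m k)"
    and "k \<in> {1..r}" "m k \<noteq> 0"
  shows "\<exists>i\<in>{1..r}. chi x i \<noteq> chi y i"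
  using weights_separated[OF nonroot _ assms(1,2)] assms(3) unfolding chi_def by blast

lemma chi_separated_Qplus:
  assumes "\<beta> \<in> Qplus r" "\<gamma> \<in> Qplus r" "\<beta> \<noteq> \<gamma>"
  shows "\<exists>i\<in>{1..r}. chi (lam - wt \<beta>) i \<noteq> chi (lam - wt \<gamma>) i"
proof -
  obtain k where k: "k \<in> {1..r}" "Poly_Mapping.lookup \<beta> k \<noteq> Poly_Mapping.lookup \<gamma> k"
    using Qplus_eqI[OF assms(1,2)] assms(3) by blast
  show ?thesis
    by (rule chi_separated[OF _ k(1), where m = "\<lambda>k. int (Poly_Mapping.lookup \<gamma> k) - int (Poly_Mapping.lookup \<beta> k)"])
      (use k in \<open>auto simp: lookup_minus\<close>)
qed

text \<open>Otherwise the ideal would be the whole carrier and the module would be zero.\<close>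

lemma one_notin_ket_ideal: "1 \<notin> ket_ideal r h lam"
proof
  assume one: "1 \<in> ket_ideal r h lam"
  have "a +o ket_ideal r h lam = ket_ideal r h lam" if "a \<in> free_carrier r" for a
    using ket_ideal_lmult[OF that one] ket_coset_eq_iff[of a 0] by (simp add: keq_zero_iff)
  then have "verma r h lam = {ket_ideal r h lam}"
    unfolding verma_def using free_carrier_zero by blast
  with irreducible show False by (simp add: verma_irreducible_def)
qed

lemma const_in_ket_ideal: "const c \<in> ket_ideal r h lam \<Longrightarrow> c = 0"
  using ket_ideal_const_cancel[of c 1] one_notin_ket_ideal by auto

lemma wspace_lam_wsum:
  assumes "x \<in> wspace lam" "x \<in> wsum ((\<lambda>\<gamma>. lam - wt \<gamma>) ` (Qplus r - {0}))"
  shows "x \<in> ket_ideal r h lam"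
  using assms
proof (rule wspace_inter_wsum)
  fix \<gamma> assume "\<gamma> \<in> (\<lambda>\<gamma>. lam - wt \<gamma>) ` (Qplus r - {0})"
  then show "\<exists>i\<in>{1..r}. chi \<gamma> i \<noteq> chi lam i"
    using chi_separated_Qplus[of _ 0] by auto
qed

text \<open>The highest weight space is one-dimensional: once the constant is split off, the rest
  has weight \<lambda> and also lies in a sum of strictly lower weights, so it vanishes in the
  module.\<close>

lemma wspace_lam_const:
  assumes "x \<in> wspace lam"
  shows "\<exists>c. keq x (const c)"
proof -
  obtain c y where y: "x = const c + y" "y \<in> wsum ((\<lambda>\<gamma>. lam - wt \<gamma>) ` (Qplus r - {0}))"
    using hwspan_one_split[OF carrier_hwspan[OF wspace_carrier[OF assms]]] by blast
  have "y = x - const c * 1" using y by simp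
  then have "y \<in> wspace lam" using assms wspace_diff wspace_const wspace_one by metis
  then have "y \<in> ket_ideal r h lam" using y(2) by (rule wspace_lam_wsum)
  then have "keq x (const c)" using y by (simp add: keq_def)
  then show ?thesis ..
qed

text \<open>The submodule generated by \<open>d\<close> has all its weights in \<lambda> - \<beta> -
  Q_+, so it misses the vacuum vector. By irreducibility it is zero.\<close>

lemma singular_vector_zero:
  assumes d: "d \<in> wspace (lam - wt \<beta>)" and \<beta>: "\<beta> \<in> Qplus r" "\<beta> \<noteq> 0"
    and E: "\<And>i. i \<in> {1..r} \<Longrightarrow> gE i * d \<in> ket_ideal r h lam"
  shows "d \<in> ket_ideal r h lam"
proof -
  let ?J = "ket_ideal r h lam"
  define S where "S = {(a * d) +o ?J | a. a \<in> free_carrier r}"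
  have dA: "d \<in> free_carrier r" using d by (rule wspace_carrier)
  have "verma_submodule r h lam S"
    unfolding verma_submodule_def
  proof (intro conjI ballI)
    show "S \<subseteq> verma r h lam" unfolding S_def verma_def using dA by auto
    have "(0 * d) +o ?J \<in> S" unfolding S_def using free_carrier_zero by blast
    then show "?J \<in> S" by simp
  next
    fix X Y assume "X \<in> S" "Y \<in> S"
    then obtain a b where ab: "X = (a * d) +o ?J" "Y = (b * d) +o ?J" "a \<in> free_carrier r" "b \<in> free_carrier r"
      unfolding S_def by blast
    then have "X + Y = ((a + b) * d) +o ?J"
      by (simp add: set_plus_rearrange ket_ideal_plus_self distrib_right)
    then show "X + Y \<in> S" unfolding S_def using ab free_carrier_add by blast
  next
    fix a X assume a: "a \<in> free_carrier r" and "X \<in> S"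
    then obtain b where b: "X = (b * d) +o ?J" "b \<in> free_carrier r" unfolding S_def by blast
    then have "ket_act r h lam a X = ((a * b) * d) +o ?J"
      using a by (simp add: ket_act_coset mult.assoc)
    then show "ket_act r h lam a X \<in> S" unfolding S_def using a b free_carrier_mult by blast
  qed
  then consider "S = {?J}" | "S = verma r h lam"
    using irreducible unfolding verma_irreducible_def by blast
  then show ?thesis
  proof cases
    case 1
    have "(1 * d) +o ?J \<in> S" unfolding S_def using free_carrier_one by blast
    with 1 have "d +o ?J = 0 +o ?J" by simp
    then show ?thesis unfolding ket_coset_eq_iff by (simp add: keq_zero_iff)
  next
    \<comment> \<open>If \<open>d\<close> generated everything, the vacuum vector would be some
      \<open>a * d\<close>, which is a sum of vectors of weights strictly below \<lambda>.\<close>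
    case 2
    have "1 +o ?J \<in> verma r h lam" unfolding verma_def using free_carrier_one by blast
    with 2 obtain a where a: "1 +o ?J = (a * d) +o ?J" "a \<in> free_carrier r" unfolding S_def by blast
    then have "keq 1 (a * d)" by (simp add: ket_coset_eq_iff)
    moreover have "a * d \<in> wsum ((\<lambda>\<gamma>. lam - wt \<beta> - wt \<gamma>) ` Qplus r)"
      by (rule hwspan_wsum[OF highest_weight_generates[OF d E a(2)] d])
    ultimately have "1 \<in> wsum ((\<lambda>\<gamma>. lam - wt \<beta> - wt \<gamma>) ` Qplus r)" using wsum_keq by blast
    moreover have "(\<lambda>\<gamma>. lam - wt \<beta> - wt \<gamma>) ` Qplus r \<subseteq> (\<lambda>\<gamma>. lam - wt \<gamma>) ` (Qplus r - {0})"
    proof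
      fix x assume "x \<in> (\<lambda>\<gamma>. lam - wt \<beta> - wt \<gamma>) ` Qplus r"
      then obtain \<gamma> where \<gamma>: "\<gamma> \<in> Qplus r" "x = lam - wt \<beta> - wt \<gamma>" by blast
      obtain i where "0 < Poly_Mapping.lookup \<beta> i" using Qplus_nonzero[OF \<beta>] by blast
      then have "Poly_Mapping.lookup (\<beta> + \<gamma>) i \<noteq> 0" by (simp add: lookup_add)
      then have "\<beta> + \<gamma> \<noteq> 0" by (metis lookup_zero)
      moreover have "x = lam - wt (\<beta> + \<gamma>)" using \<gamma> by (simp add: wt_add diff_diff_eq)
      ultimately show "x \<in> (\<lambda>\<gamma>. lam - wt \<gamma>) ` (Qplus r - {0})" using \<beta> \<gamma> by auto
    qed
    ultimately have "1 \<in> wsum ((\<lambda>\<gamma>. lam - wt \<gamma>) ` (Qplus r - {0}))" by (rule wsum_mono)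
    with wspace_lam_wsum[OF wspace_one] one_notin_ket_ideal show ?thesis by blast
  qed
qed

text \<open>The weight \<lambda> - \<beta> + \<alpha>_i lies outside \<lambda> - Q_+ when \<beta>
  does not contain \<alpha>_i, and the Verma module has no such weight.\<close>

lemma E_outside_Qplus:
  assumes x: "x \<in> wspace (lam - wt \<beta>)" and \<beta>: "\<beta> \<in> Qplus r"
    and i: "i \<in> {1..r}" "Poly_Mapping.lookup \<beta> i = 0"
  shows "gE i * x \<in> ket_ideal r h lam"
proof (rule wspace_inter_wsum)
  show "gE i * x \<in> wspace (lam - wt \<beta> + sroot i)" using x i by (intro wspace_E)
  have "gE i * x \<in> free_carrier r" using wspace_carrier[OF x] i by auto
  then show "gE i * x \<in> wsum ((\<lambda>\<gamma>. lam - wt \<gamma>) ` Qplus r)"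
    by (intro hwspan_wsum[OF carrier_hwspan wspace_one])
  fix \<gamma> assume "\<gamma> \<in> (\<lambda>\<gamma>. lam - wt \<gamma>) ` Qplus r"
  then obtain \<delta> where \<delta>: "\<gamma> = lam - wt \<delta>" by blast
  \<comment> \<open>At the coordinate \<open>i\<close> the difference of the two weights is at most
    -1, since \<beta> has coordinate 0 there.\<close>
  show "\<exists>j\<in>{1..r}. chi \<gamma> j \<noteq> chi (lam - wt \<beta> + sroot i) j"
    by (rule chi_separated[OF _ i(1), where m = "\<lambda>k. int (Poly_Mapping.lookup \<beta> k) - int (Poly_Mapping.lookup \<delta> k)
        - (if i = k then 1 else 0)"])
      (use i \<delta> in \<open>auto simp: lookup_minus lookup_add sroot_def lookup_single when_def\<close>)
qed

end

section \<open>Whittaker vectors from the path recursion\<close>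

lemma wform_fweight_outside: "i = 0 \<or> i = Suc r \<Longrightarrow> wform r x (fweight r i) = 0"
  by (auto simp: fweight_0 fweight_Suc_r wform_def)

lemma wform_sroot_fweight:
  assumes "j \<in> {1..r}" "i \<le> Suc r"
  shows "wform r (sroot j) (fweight r i) = (if i = j then 1 else 0)"
  using assms wform_fweight[of i r "sroot j"] wform_fweight_outside[of i r "sroot j"]
  by (cases "i = 0 \<or> i = Suc r") (auto simp: sroot_def lookup_single when_def)

text \<open>A simple root is the combination of fundamental weights given by a row of the Cartan
  matrix; \<omega>_0 and \<omega>_{r+1} vanish, so the ends of the diagram are no exception.\<close>

lemma wform_sroot_eq_fweights:
  assumes "j \<in> {1..r}"
  shows "wform r x (sroot j)
    = 2 * wform r x (fweight r j) - wform r x (fweight r (j - 1)) - wform r x (fweight r (j + 1))"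
proof -
  define y where "y k = wform r x (fweight r k)" for k
  have y0: "y 0 = 0" and yr: "y (r + 1) = 0"
    by (simp_all add: y_def wform_fweight_outside)
  have "wform r x (sroot j) = (\<Sum>k=1..r. y k * of_int (cartan k j))"
    using assms by (simp add: wform_sroot_right y_def wform_fweight)
  \<comment> \<open>The range is extended by two zero terms so that \<open>j - 1\<close>,
    \<open>j\<close> and \<open>j + 1\<close> always belong to it.\<close>
  also have "\<dots> = (\<Sum>k=0..r+1. y k * of_int (cartan k j))"
    using y0 yr by (simp add: sum.atLeast_Suc_atMost[of 0])
  also have "\<dots> = (\<Sum>k\<in>{j-1, j, j+1}. y k * of_int (cartan k j))"
    using assms by (intro sum.mono_neutral_right) (auto simp: cartan_def)
  also have "\<dots> = 2 * y j - y (j - 1) - y (j + 1)"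
    using assms by (cases j) (auto simp: cartan_def)
  finally show ?thesis by (simp add: y_def)
qed

lemma wform_weyl_vector_sroot:
  assumes "j \<in> {1..r}" shows "wform r (weyl_vector r) (sroot j) = 1"
proof -
  have "wform r (\<Sum>i\<in>I. fweight r i) (sroot j) = (\<Sum>i\<in>I. wform r (fweight r i) (sroot j))" for I
  proof (induction I rule: infinite_finite_induct)
    case (insert i I)
    then show ?case by (simp add: wform_add_left)
  qed (simp_all add: wform_def)
  then have "wform r (weyl_vector r) (sroot j) = (\<Sum>i=1..r. if i = j then 1 else 0)"
    unfolding weyl_vector_def using assms by (simp add: wform_fweight_sroot)
  then show ?thesis using assms by simp
qed

text \<open>The pairing of \<alpha>_j with \<omega>_{i+1} - \<omega>_{i-1} is 1 for j = i+1, -1 for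
  j = i-1 and 0 otherwise. Writing it as (i-j) times a Cartan entry lets it combine later with the
  exponents i-1 and j-1 of the \<open>K\<close>'s.\<close>

lemma path_tau_add_qroot:
  assumes "i \<in> {1..r}" "j \<in> {1..r}"
  shows "path_tau r lam i (\<beta> + qroot j) = path_tau r lam i \<beta> - of_int ((int i - int j) * cartan i j)"
proof -
  have "path_tau r lam i (\<beta> + qroot j)
      = path_tau r lam i \<beta> - wform r (sroot j) (fweight r (i + 1) - fweight r (i - 1))"
    by (simp add: path_tau_def wt_add wt_qroot wform_diff_left wform_add_left)
  also have "wform r (sroot j) (fweight r (i + 1) - fweight r (i - 1)) = of_int ((int i - int j) * cartan i j)"
    using assms by (auto simp: wform_diff_right wform_sroot_fweight cartan_def)
  finally show ?thesis .
qed

text \<open>Adding \<alpha>_j multiplies the exponentials of index j-1 and j by q^2 and q^-2 and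
  leaves the others unchanged. Their joint change contains a factor q - 1/q; the two remaining terms
  are the two halves of the q-number of (\<lambda>-\<beta>|\<alpha>_j).\<close>

lemma path_v_add_qroot:
  assumes j: "j \<in> {1..r}" and k: "exp k - inverse (exp k) \<noteq> 0"
  shows "path_v r k lam (\<beta> + qroot j) - path_v r k lam \<beta>
    = qpow k (- path_tau r lam j (\<beta> + qroot j))
      * ((qpow k (wform r (lam - wt \<beta>) (sroot j)) - inverse (qpow k (wform r (lam - wt \<beta>) (sroot j))))
         / (exp k - inverse (exp k)))"
proof -
  define q where "q = exp k"
  have q: "q \<noteq> 0" "q - inverse q \<noteq> 0" using k by (auto simp: q_def)
  have q1: "qpow k 1 = q" by (simp add: q_def qpow_def)
  define X where "X = lam + weyl_vector r - wt \<beta>"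
  define y where "y i = wform r X (fweight r i)" for i
  \<comment> \<open>\<open>P i\<close> is the full exponential of index \<open>i\<close> in
    \<open>path_v\<close> at \<beta>; \<open>D i\<close>, defined below, is the factor it acquires
    from \<alpha>_j.\<close>
  define P where "P i = qpow k (2 * (y i - y (i + 1)))" for i
  have P: "qpow k (2 * wform r (lam + weyl_vector r) (fweight r i - fweight r (i + 1)))
      * qpow k (2 * wform r (wt \<beta>) (fweight r (i + 1) - fweight r i)) = P i" for i
    unfolding P_def y_def X_def qpow_add[symmetric] wform_diff_left wform_diff_right
    by (simp add: algebra_simps)
  define D where "D i = qpow k (2 * wform r (sroot j) (fweight r (i + 1) - fweight r i))" for i
  have D: "D i = (if i + 1 = j then q^2 else if i = j then inverse (q^2) else 1)" if "i \<in> {0..r}" for i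
  proof -
    have "wform r (sroot j) (fweight r (i + 1) - fweight r i) = (if i + 1 = j then 1 else if i = j then -1 else 0)"
      using that j by (auto simp: wform_diff_right wform_sroot_fweight)
    then show ?thesis
      unfolding D_def using qpow_add[of k 1 1] qpow_minus[of k 2] q1 by (auto simp: power2_eq_square)
  qed
  have v: "path_v r k lam \<gamma> = 1 / (q - inverse q)^2 * (\<Sum>i=0..r. qpow k (2 * wform r (lam + weyl_vector r) (fweight r i - fweight r (i + 1)))
       * (1 - qpow k (2 * wform r (wt \<gamma>) (fweight r (i + 1) - fweight r i))))" for \<gamma>
    by (simp add: path_v_def q_def)
  have "path_v r k lam (\<beta> + qroot j) - path_v r k lam \<beta> = 1 / (q - inverse q)^2 * (\<Sum>i=0..r. P i * (1 - D i))"
    unfolding v right_diff_distrib[symmetric] sum_subtractf[symmetric] P[symmetric] D_def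
    by (simp add: wt_add wt_qroot wform_add_left distrib_left qpow_add algebra_simps)
  also have "(\<Sum>i=0..r. P i * (1 - D i)) = (\<Sum>i\<in>{j - 1, j}. P i * (1 - D i))"
    using j by (intro sum.mono_neutral_right) (auto simp: D)
  also have "\<dots> = P (j - 1) * (1 - q^2) + P j * (1 - inverse (q^2))"
    using j by (auto simp: D)
  also have "\<dots> = (q - inverse q) * (inverse q * P j - q * P (j - 1))"
    using q by (simp add: field_simps power2_eq_square)
  finally have diff: "path_v r k lam (\<beta> + qroot j) - path_v r k lam \<beta>
      = (inverse q * P j - q * P (j - 1)) / (q - inverse q)"
    using q by (simp add: power2_eq_square)
  have tau: "path_tau r lam j (\<beta> + qroot j) = y (j + 1) - y (j - 1)"
    unfolding path_tau_add_qroot[OF j j] by (simp add: path_tau_def y_def X_def wform_diff_right)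
  \<comment> \<open>The shift by 1 is (\<rho>|\<alpha>_j); it accounts for the factors q and 1/q in
    \<open>diff\<close>.\<close>
  have "wform r X (sroot j) = wform r (lam - wt \<beta>) (sroot j) + 1"
    using wform_weyl_vector_sroot[OF j] by (simp add: X_def wform_add_left wform_diff_left)
  then have lamb: "wform r (lam - wt \<beta>) (sroot j) = 2 * y j - y (j - 1) - y (j + 1) - 1"
    using wform_sroot_eq_fweights[OF j, of X] by (simp add: y_def)
  have "inverse q * P j = qpow k (- (y (j + 1) - y (j - 1))) * qpow k (2 * y j - y (j - 1) - y (j + 1) - 1)"
    unfolding P_def q1[symmetric] qpow_minus[symmetric] qpow_add[symmetric] by (simp add: algebra_simps)
  moreover have "q * P (j - 1) = qpow k (- (y (j + 1) - y (j - 1))) * inverse (qpow k (2 * y j - y (j - 1) - y (j + 1) - 1))"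
    unfolding P_def q1[symmetric] qpow_minus[symmetric] qpow_add[symmetric] using j by (simp add: algebra_simps)
  ultimately show ?thesis
    unfolding diff tau lamb q_def[symmetric] by (simp add: right_diff_distrib)
qed

lemma path_v_zero: "path_v r k lam 0 = 0"
  by (simp add: path_v_def wform_def)

section \<open>Solving the Whittaker equations by a recursion\<close>

context verma_params
begin

text \<open>Both Whittaker conditions in one form: \<open>L\<close> is \<open>LK\<close> for the
  ket, and \<open>LKinv\<close> for the bra after the anti-automorphism has turned
  \<open>F_i\<close> acting on the right into \<open>E_i\<close> acting on the left.\<close>

definition whittaker_rep ::
  "(nat \<Rightarrow> letter) \<Rightarrow> (nat \<Rightarrow> complex) \<Rightarrow> ((nat \<Rightarrow>\<^sub>0 nat) \<Rightarrow> freealg) \<Rightarrow> bool" where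
  "whittaker_rep L \<mu> w \<longleftrightarrow>
     (\<forall>\<beta>\<in>Qplus r. w \<beta> \<in> wspace (lam - wt \<beta>)) \<and> keq (w 0) 1 \<and>
     (\<forall>i\<in>{1..r}. \<forall>\<beta>\<in>Qplus r. keq (gE i * w (\<beta> + qroot i)) (const (\<mu> i) * gen (L i) ^ (i - 1) * w \<beta>))"

function path_vector :: "(nat \<Rightarrow> (nat \<Rightarrow>\<^sub>0 nat) \<Rightarrow> complex) \<Rightarrow> (nat \<Rightarrow>\<^sub>0 nat) \<Rightarrow> freealg" where
  "path_vector a \<beta> = (if \<beta> = 0 then 1 else
     \<Sum>i\<in>{i\<in>{1..r}. 0 < Poly_Mapping.lookup \<beta> i}. const (a i \<beta>) * (gF i * path_vector a (\<beta> - qroot i)))"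
  by auto
termination
  by (relation "measure (\<lambda>(a, \<beta>). qdeg r \<beta>)") (auto intro: qdeg_diff_qroot)

declare path_vector.simps [simp del]

lemma path_vector_zero: "path_vector a 0 = 1"
  by (simp add: path_vector.simps)

lemma path_vector_wspace: "\<beta> \<in> Qplus r \<Longrightarrow> path_vector a \<beta> \<in> wspace (lam - wt \<beta>)"
proof (induction "qdeg r \<beta>" arbitrary: \<beta> rule: less_induct)
  case less
  show ?case
  proof (cases "\<beta> = 0")
    case True
    then show ?thesis by (simp add: path_vector_zero wspace_one)
  next
    case False
    have "gF i * path_vector a (\<beta> - qroot i) \<in> wspace (lam - wt \<beta>)"
      if i: "i \<in> {i\<in>{1..r}. 0 < Poly_Mapping.lookup \<beta> i}" for i
    proof -
      have "gF i * path_vector a (\<beta> - qroot i) \<in> wspace (lam - wt (\<beta> - qroot i) - sroot i)"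
        using i less by (intro wspace_F less Qplus_diff_qroot qdeg_diff_qroot) auto
      moreover have "wt \<beta> = wt (\<beta> - qroot i) + sroot i"
        using i by (metis (no_types, lifting) diff_qroot_add mem_Collect_eq wt_add wt_qroot)
      ultimately show ?thesis by (simp add: diff_diff_eq)
    qed
    then show ?thesis
      using False by (subst path_vector.simps) (auto intro: wspace_sum wspace_const)
  qed
qed

text \<open>Passing \<open>E_j\<close> through the recursion gives, by induction, a multiple of the
  recursion for \<beta> - \<alpha>_j, plus one commutator term from i = j. The condition
  \<open>bc\<close> makes that multiple the same for all \<open>i\<close>, and \<open>vb\<close>
  makes the total coefficient equal to \<open>b j\<close>.\<close>

lemma E_path_vector:
  assumes v0: "v 0 = 0" and v: "\<And>\<beta>. \<beta> \<in> Qplus r \<Longrightarrow> \<beta> \<noteq> 0 \<Longrightarrow> v \<beta> \<noteq> 0"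
    and bc: "\<And>i j \<beta>. i \<in> {1..r} \<Longrightarrow> j \<in> {1..r} \<Longrightarrow>
        c i (\<beta> + qroot i + qroot j) * b j \<beta> = b j (\<beta> + qroot i) * c i (\<beta> + qroot i)"
    and vb: "\<And>j \<beta>. j \<in> {1..r} \<Longrightarrow>
        v (\<beta> + qroot j) * b j \<beta> = v \<beta> * b j \<beta> + c j (\<beta> + qroot j) * qbracket (lam - wt \<beta>) j"
    and "\<beta> \<in> Qplus r" "j \<in> {1..r}"
  defines "w \<equiv> path_vector (\<lambda>i \<beta>. c i \<beta> / v \<beta>)"
  shows "keq (gE j * w \<beta>)
    (if 0 < Poly_Mapping.lookup \<beta> j then const (b j (\<beta> - qroot j)) * w (\<beta> - qroot j) else 0)"
  using \<open>\<beta> \<in> Qplus r\<close>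
proof (induction "qdeg r \<beta>" arbitrary: \<beta> rule: less_induct)
  case less
  note j = \<open>j \<in> {1..r}\<close> and \<beta> = \<open>\<beta> \<in> Qplus r\<close>
  let ?l = "Poly_Mapping.lookup"
  show ?case
  proof (cases "\<beta> = 0")
    case True
    then show ?thesis using j by (simp add: w_def path_vector_zero keq_zero_iff gE_in_ket_ideal)
  next
    case False
    define I where "I \<gamma> = {i\<in>{1..r}. 0 < ?l \<gamma> i}" for \<gamma> :: "nat \<Rightarrow>\<^sub>0 nat"
    have w_eq: "w \<gamma> = (\<Sum>i\<in>I \<gamma>. const (c i \<gamma> / v \<gamma>) * (gF i * w (\<gamma> - qroot i)))" if "\<gamma> \<noteq> 0" for \<gamma>
      using that unfolding w_def I_def by (subst path_vector.simps) simp
    \<comment> \<open>The value of \<open>E_j\<close> on the component at \<beta> - \<alpha>_i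
      supplied by the induction hypothesis; \<open>B\<close> below is the commutator term.\<close>
    define T where "T i = (if 0 < ?l (\<beta> - qroot i) j
      then const (b j (\<beta> - qroot i - qroot j)) * w (\<beta> - qroot i - qroot j) else 0)" for i
    define B where "B = const (qbracket (lam - wt (\<beta> - qroot j)) j) * w (\<beta> - qroot j)"
    have step: "keq (gE j * (const (c i \<beta> / v \<beta>) * (gF i * w (\<beta> - qroot i))))
        (const (c i \<beta> / v \<beta>) * (gF i * T i + (if i = j then B else 0)))"
      if i: "i \<in> I \<beta>" for i
    proof -
      have i': "i \<in> {1..r}" "0 < ?l \<beta> i" using i by (auto simp: I_def)
      have ws: "w (\<beta> - qroot i) \<in> wspace (lam - wt (\<beta> - qroot i))"
        unfolding w_def by (intro path_vector_wspace Qplus_diff_qroot \<beta>)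
      have "keq (gE j * (gF i * w (\<beta> - qroot i)))
          (gF i * (gE j * w (\<beta> - qroot i)) + const (if j = i then qbracket (lam - wt (\<beta> - qroot i)) j else 0) * w (\<beta> - qroot i))"
        by (rule keq_EF_wspace[OF j i'(1) ws])
      also have "keq \<dots> (gF i * T i + (if i = j then B else 0))"
        unfolding T_def B_def
        using less.hyps[OF qdeg_diff_qroot[OF i'] Qplus_diff_qroot[OF \<beta>]] i'
        by (intro keq_add keq_lmult) auto
      finally show ?thesis
        unfolding const_left_commute[of "gE j"] by (intro keq_lmult) auto
    qed
    have "gE j * w \<beta> = (\<Sum>i\<in>I \<beta>. gE j * (const (c i \<beta> / v \<beta>) * (gF i * w (\<beta> - qroot i))))"
      by (simp only: w_eq[OF False] sum_distrib_left)
    also have "keq \<dots> (\<Sum>i\<in>I \<beta>. const (c i \<beta> / v \<beta>) * (gF i * T i + (if i = j then B else 0)))"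
      by (intro keq_sum step)
    also have "\<dots> = (\<Sum>i\<in>I \<beta>. const (c i \<beta> / v \<beta>) * (gF i * T i)) + (\<Sum>i\<in>I \<beta>. if i = j then const (c j \<beta> / v \<beta>) * B else 0)"
      unfolding sum.distrib[symmetric] by (intro sum.cong refl) (auto simp: distrib_left)
    also have "(\<Sum>i\<in>I \<beta>. if i = j then const (c j \<beta> / v \<beta>) * B else 0) = (if 0 < ?l \<beta> j then const (c j \<beta> / v \<beta>) * B else 0)"
      using j by (simp add: I_def)
    finally have main: "keq (gE j * w \<beta>) ((\<Sum>i\<in>I \<beta>. const (c i \<beta> / v \<beta>) * (gF i * T i)) + (if 0 < ?l \<beta> j then const (c j \<beta> / v \<beta>) * B else 0))" .
    show ?thesis
    proof (cases "0 < ?l \<beta> j")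
      case False
      then have "T i = 0" for i by (simp add: T_def lookup_minus)
      then show ?thesis using main False by simp
    next
      case True
      define \<gamma> where "\<gamma> = \<beta> - qroot j"
      have \<beta>\<gamma>: "\<beta> = \<gamma> + qroot j" using diff_qroot_add[OF True] by (simp add: \<gamma>_def)
      \<comment> \<open>The only index that can be lost is j itself, when \<beta> contains
        \<alpha>_j exactly once; then \<open>T j\<close> is 0.\<close>
      have "(\<Sum>i\<in>I \<beta>. const (c i \<beta> / v \<beta>) * (gF i * T i)) = (\<Sum>i\<in>I \<gamma>. const (c i \<beta> / v \<beta>) * (gF i * T i))"
      proof (rule sum.mono_neutral_right)
        show "finite (I \<beta>)" by (simp add: I_def)
        show "I \<gamma> \<subseteq> I \<beta>" by (auto simp: I_def \<beta>\<gamma> lookup_add)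
        show "\<forall>i\<in>I \<beta> - I \<gamma>. const (c i \<beta> / v \<beta>) * (gF i * T i) = 0"
          by (auto simp: I_def \<beta>\<gamma> T_def lookup_add lookup_minus lookup_qroot split: if_splits)
      qed
      also have "\<dots> = const (v \<gamma> / v \<beta> * b j \<gamma>) * w \<gamma>"
      proof (cases "\<gamma> = 0")
        \<comment> \<open>The sum is empty here, and \<open>v 0 = 0\<close> makes the claimed
          coefficient vanish too.\<close>
        case True
        then show ?thesis by (simp add: v0 I_def)
      next
        case False
        have "const (c i \<beta> / v \<beta>) * (gF i * T i)
            = const (v \<gamma> / v \<beta> * b j \<gamma>) * (const (c i \<gamma> / v \<gamma>) * (gF i * w (\<gamma> - qroot i)))" if i: "i \<in> I \<gamma>" for i
        proof -
          have i': "i \<in> {1..r}" "0 < ?l \<gamma> i" using i by (auto simp: I_def)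
          define \<delta> where "\<delta> = \<gamma> - qroot i"
          have \<gamma>\<delta>: "\<gamma> = \<delta> + qroot i" using diff_qroot_add[OF i'(2)] by (simp add: \<delta>_def)
          have "\<beta> - qroot i - qroot j = \<delta>"
            unfolding \<beta>\<gamma> \<gamma>\<delta> by (rule poly_mapping_eqI) (simp add: lookup_add lookup_minus)
          moreover have "0 < ?l (\<beta> - qroot i) j"
            unfolding \<beta>\<gamma> \<gamma>\<delta> by (simp add: lookup_add lookup_minus lookup_qroot)
          ultimately have T: "T i = const (b j \<delta>) * w \<delta>"
            by (simp add: T_def)
          have vg: "v \<gamma> \<noteq> 0"
            using False v Qplus_diff_qroot[OF \<beta>, of j] by (simp add: \<gamma>_def)
          have "c i \<beta> * b j \<delta> = b j \<gamma> * c i \<gamma>"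
            using bc[OF i'(1) j, of \<delta>] by (simp add: \<beta>\<gamma> \<gamma>\<delta>)
          then have "c i \<beta> / v \<beta> * b j \<delta> = v \<gamma> / v \<beta> * b j \<gamma> * (c i \<gamma> / v \<gamma>)"
            using vg by (simp add: field_simps)
          then show ?thesis
            unfolding T const_left_commute[of "gF i"] const_mult_left \<delta>_def by (simp add: mult.assoc)
        qed
        then show ?thesis by (simp add: w_eq[OF False] sum_distrib_left)
      qed
      finally have "keq (gE j * w \<beta>) (const (v \<gamma> / v \<beta> * b j \<gamma>) * w \<gamma> + const (c j \<beta> / v \<beta>) * B)"
        using main True by simp
      also have "\<dots> = const (v \<gamma> / v \<beta> * b j \<gamma> + c j \<beta> / v \<beta> * qbracket (lam - wt \<gamma>) j) * w \<gamma>"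
        by (simp add: B_def \<gamma>_def const_mult_left const_add distrib_right)
      \<comment> \<open>This is \<open>vb\<close> divided by \<open>v \<beta>\<close>.\<close>
      also have "v \<gamma> / v \<beta> * b j \<gamma> + c j \<beta> / v \<beta> * qbracket (lam - wt \<gamma>) j = b j \<gamma>"
        using vb[OF j, of \<gamma>] v[OF \<beta> \<open>\<beta> \<noteq> 0\<close>] by (simp add: \<beta>\<gamma>[symmetric] field_simps)
      finally show ?thesis using True by (simp add: \<gamma>_def)
    qed
  qed
qed

text \<open>A q-number is unchanged when q is replaced by its inverse: numerator and denominator
  both change sign. Hence one calculation serves bra and ket.\<close>

lemma qbracket_eq:
  assumes "k = h \<or> k = - h"
  shows "qbracket \<nu> j = (qpow k (wform r \<nu> (sroot j)) - inverse (qpow k (wform r \<nu> (sroot j))))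
    / (exp k - inverse (exp k))"
  using assms
proof
  assume "k = - h"
  then show ?thesis
    unfolding qbracket_def chi_def qpow_def
    by (simp add: exp_minus) (metis minus_diff_eq minus_divide_divide)
qed (simp add: qbracket_def chi_def)

lemma wspace_gen_power:
  assumes "x \<in> wspace \<nu>" "gen l \<in> free_carrier r" "keq (gen l * x) (const c * x)"
  shows "keq (gen l ^ n * x) (const (c ^ n) * x)"
proof (induction n)
  case (Suc n)
  have "gen l ^ Suc n * x = gen l ^ n * (gen l * x)"
    by (simp only: power_Suc2 mult.assoc)
  also have "keq \<dots> (gen l ^ n * (const c * x))"
    using assms by (intro keq_lmult) auto
  also have "\<dots> = const c * (gen l ^ n * x)"
    by (rule const_left_commute)
  also have "keq \<dots> (const c * (const (c ^ n) * x))"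
    using Suc by (intro keq_lmult) auto
  also have "\<dots> = const (c ^ Suc n) * x"
    by (simp add: const_mult_left)
  finally show ?case .
qed simp

text \<open>
  The parameter \<open>k\<close> is \<open>h\<close> for the vector \<open>|w\<rangle>\<close> and \<open>-h\<close> for the image of \<open>\<langle>w|\<close> under the
  anti-automorphism.
\<close>

definition path_coeff :: "complex \<Rightarrow> (nat \<Rightarrow> complex) \<Rightarrow> nat \<Rightarrow> (nat \<Rightarrow>\<^sub>0 nat) \<Rightarrow> complex" where
  "path_coeff k \<mu> i \<beta> = \<mu> i * qpow k (- path_tau r lam i \<beta>
     + of_nat (i - 1) * wform r (lam - wt \<beta> + sroot i) (sroot i)) / path_v r k lam \<beta>"

text \<open>An instance of \<open>E_path_vector\<close>: \<open>b j\<close> is \<mu>_j times the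
  eigenvalue of the required power of \<open>gen (L j)\<close>, and \<open>c\<close> is the
  numerator of \<open>path_coeff\<close>.\<close>

lemma whittaker_rep_path_vector:
  assumes k: "k = h \<or> k = - h" and h: "exp h - inverse (exp h) \<noteq> 0"
    and v: "\<And>\<beta>. \<beta> \<in> Qplus r \<Longrightarrow> \<beta> \<noteq> 0 \<Longrightarrow> path_v r k lam \<beta> \<noteq> 0"
    and L: "\<And>i. i \<in> {1..r} \<Longrightarrow> gen (L i) \<in> free_carrier r"
    and Lk: "\<And>i \<nu> x. i \<in> {1..r} \<Longrightarrow> x \<in> wspace \<nu> \<Longrightarrow>
        keq (gen (L i) * x) (const (qpow k (wform r \<nu> (sroot i))) * x)"
  shows "whittaker_rep L \<mu> (path_vector (path_coeff k \<mu>))"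
proof -
  define c where "c i \<beta> = \<mu> i * qpow k (- path_tau r lam i \<beta>
     + of_nat (i - 1) * wform r (lam - wt \<beta> + sroot i) (sroot i))" for i \<beta>
  define b where "b j \<beta> = \<mu> j * qpow k (of_nat (j - 1) * wform r (lam - wt \<beta>) (sroot j))" for j \<beta>
  have coeff: "path_coeff k \<mu> = (\<lambda>i \<beta>. c i \<beta> / path_v r k lam \<beta>)"
    by (intro ext) (simp add: path_coeff_def c_def)
  have bc: "c i (\<beta> + qroot i + qroot j) * b j \<beta> = b j (\<beta> + qroot i) * c i (\<beta> + qroot i)"
    if ij: "i \<in> {1..r}" "j \<in> {1..r}" for i j \<beta>
  proof -
    have n: "of_nat (i - 1) = (of_nat i - 1 :: complex)" "of_nat (j - 1) = (of_nat j - 1 :: complex)"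
      using ij by (auto simp: of_nat_diff)
    \<comment> \<open>With C the Cartan entry of i and j, adding \<alpha>_j to \<beta> + \<alpha>_i
      changes the exponent of \<open>c i\<close> by (i-j)C from tau and -(i-1)C from the power of
      \<open>K_i\<close>, in total -(j-1)C. This is also the change in the exponent of
      \<open>b j\<close> when \<alpha>_i is added to \<beta>. The exponents i-1 in the Whittaker
      equations are chosen for this balance.\<close>
    have "- path_tau r lam i (\<beta> + qroot i + qroot j)
        + of_nat (i - 1) * wform r (lam - wt (\<beta> + qroot i + qroot j) + sroot i) (sroot i)
        + of_nat (j - 1) * wform r (lam - wt \<beta>) (sroot j)
      = of_nat (j - 1) * wform r (lam - wt (\<beta> + qroot i)) (sroot j)
        + (- path_tau r lam i (\<beta> + qroot i) + of_nat (i - 1) * wform r (lam - wt (\<beta> + qroot i) + sroot i) (sroot i))"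
      unfolding path_tau_add_qroot[OF ij] n
      using ij by (simp add: wt_add wt_qroot wform_add_left wform_diff_left wform_sroot_sroot
        cartan_commute[of j i] algebra_simps)
    then have "qpow k (- path_tau r lam i (\<beta> + qroot i + qroot j)
        + of_nat (i - 1) * wform r (lam - wt (\<beta> + qroot i + qroot j) + sroot i) (sroot i))
        * qpow k (of_nat (j - 1) * wform r (lam - wt \<beta>) (sroot j))
      = qpow k (of_nat (j - 1) * wform r (lam - wt (\<beta> + qroot i)) (sroot j))
        * qpow k (- path_tau r lam i (\<beta> + qroot i) + of_nat (i - 1) * wform r (lam - wt (\<beta> + qroot i) + sroot i) (sroot i))"
      by (simp only: qpow_add[symmetric])
    then show ?thesis
      unfolding c_def b_def by (simp only: mult_ac)
  qed
  have k0: "exp k - inverse (exp k) \<noteq> 0"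
    using k h by (auto simp: exp_minus)
  have vb: "path_v r k lam (\<beta> + qroot j) * b j \<beta>
      = path_v r k lam \<beta> * b j \<beta> + c j (\<beta> + qroot j) * qbracket (lam - wt \<beta>) j"
    if j: "j \<in> {1..r}" for j \<beta>
  proof -
    \<comment> \<open>The power of \<open>K_j\<close> in \<open>c\<close> is evaluated at the weight
      before \<open>F_j\<close> is applied, here \<lambda> - \<beta>.\<close>
    have "c j (\<beta> + qroot j) = qpow k (- path_tau r lam j (\<beta> + qroot j)) * b j \<beta>"
      unfolding c_def b_def qpow_add by (simp add: wt_add wt_qroot)
    then have "(path_v r k lam (\<beta> + qroot j) - path_v r k lam \<beta>) * b j \<beta>
        = c j (\<beta> + qroot j) * qbracket (lam - wt \<beta>) j"
      unfolding path_v_add_qroot[OF j k0] qbracket_eq[OF k] by (simp only: mult_ac)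
    then show ?thesis by (simp add: algebra_simps)
  qed
  show ?thesis
    unfolding whittaker_rep_def
  proof (intro conjI ballI)
    fix \<beta> assume "\<beta> \<in> Qplus r"
    then show "path_vector (path_coeff k \<mu>) \<beta> \<in> wspace (lam - wt \<beta>)"
      by (rule path_vector_wspace)
  next
    show "keq (path_vector (path_coeff k \<mu>) 0) 1" by (simp add: path_vector_zero)
  next
    fix i \<beta> assume i: "i \<in> {1..r}" and \<beta>: "\<beta> \<in> Qplus r"
    let ?w = "path_vector (path_coeff k \<mu>)"
    have "keq (gE i * ?w (\<beta> + qroot i)) (const (b i \<beta>) * ?w \<beta>)"
      using E_path_vector[OF path_v_zero v bc vb Qplus_add[OF \<beta> Qplus_qroot[OF i]] i]
      by (simp add: coeff lookup_add lookup_qroot)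
    also have "const (b i \<beta>) * ?w \<beta> = const (\<mu> i) * (const (qpow k (wform r (lam - wt \<beta>) (sroot i)) ^ (i - 1)) * ?w \<beta>)"
      by (simp add: b_def const_mult_left qpow_power)
    also have "keq \<dots> (const (\<mu> i) * (gen (L i) ^ (i - 1) * ?w \<beta>))"
      using path_vector_wspace[OF \<beta>] i L Lk
      by (intro keq_lmult keq_sym[OF wspace_gen_power]) auto
    finally show "keq (gE i * ?w (\<beta> + qroot i)) (const (\<mu> i) * gen (L i) ^ (i - 1) * ?w \<beta>)"
      by (simp only: mult.assoc)
  qed
qed

end

section \<open>Uniqueness of the solution\<close>

context verma_irreducible_params
begin

text \<open>Induction on the height. The Whittaker equations express each \<open>E_i\<close>-image
  through lower components, where the solutions agree already, so the difference at \<beta> is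
  singular.\<close>

lemma whittaker_rep_unique:
  assumes L: "\<And>i. i \<in> {1..r} \<Longrightarrow> gen (L i) \<in> free_carrier r"
    and w: "whittaker_rep L \<mu> w" and w': "whittaker_rep L \<mu> w'"
    and "\<beta> \<in> Qplus r"
  shows "keq (w \<beta>) (w' \<beta>)"
  using assms(4)
proof (induction "qdeg r \<beta>" arbitrary: \<beta> rule: less_induct)
  case less
  note \<beta> = \<open>\<beta> \<in> Qplus r\<close>
  show ?case
  proof (cases "\<beta> = 0")
    case True
    then show ?thesis using w w' keq_trans[OF _ keq_sym] unfolding whittaker_rep_def by blast
  next
    case False
    have d: "w \<beta> - w' \<beta> \<in> wspace (lam - wt \<beta>)"
      using w w' \<beta> unfolding whittaker_rep_def by (intro wspace_diff) auto
    have "w \<beta> - w' \<beta> \<in> ket_ideal r h lam"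
    proof (rule singular_vector_zero[OF d \<beta> False])
      fix i assume i: "i \<in> {1..r}"
      show "gE i * (w \<beta> - w' \<beta>) \<in> ket_ideal r h lam"
      proof (cases "Poly_Mapping.lookup \<beta> i = 0")
        case True
        then show ?thesis using E_outside_Qplus[OF d \<beta> i] by simp
      next
        case False
        then have pos: "0 < Poly_Mapping.lookup \<beta> i" by simp
        define \<gamma> where "\<gamma> = \<beta> - qroot i"
        have \<gamma>: "\<beta> = \<gamma> + qroot i" "\<gamma> \<in> Qplus r"
          using diff_qroot_add[OF pos] Qplus_diff_qroot[OF \<beta>] by (simp_all add: \<gamma>_def)
        let ?a = "const (\<mu> i) * gen (L i) ^ (i - 1)"
        have "keq (gE i * w \<beta>) (?a * w \<gamma>)" "keq (gE i * w' \<beta>) (?a * w' \<gamma>)"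
          using w w' i \<gamma> unfolding whittaker_rep_def by blast+
        moreover have "keq (?a * w \<gamma>) (?a * w' \<gamma>)"
          using less.hyps[OF qdeg_diff_qroot[OF i pos]] \<gamma>(2) L[OF i]
          by (intro keq_lmult) (simp_all add: \<gamma>_def)
        ultimately have "keq (gE i * w \<beta>) (gE i * w' \<beta>)"
          using keq_trans keq_sym by blast
        then show ?thesis by (simp add: keq_def right_diff_distrib)
      qed
    qed
    then show ?thesis by (simp add: keq_def)
  qed
qed

end

section \<open>The anti-automorphism exchanging \<open>E\<^sub>i\<close> and \<open>F\<^sub>i\<close>\<close>

fun letter_swap :: "letter \<Rightarrow> letter" where
  "letter_swap (LE i) = LF i"
| "letter_swap (LF i) = LE i"
| "letter_swap (LK i) = LK i"
| "letter_swap (LKinv i) = LKinv i"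

definition word_swap :: "letter list \<Rightarrow> letter list" where
  "word_swap w = rev (map letter_swap w)"

lemma letter_swap_swap [simp]: "letter_swap (letter_swap l) = l"
  by (cases l) auto

lemma word_swap_swap [simp]: "word_swap (word_swap w) = w"
  by (simp add: word_swap_def rev_map comp_def)

lemma inj_word_swap: "inj word_swap"
  by (metis injI word_swap_swap)

text \<open>\<open>map_key\<close> precomposes the coefficient function with the word map; since
  \<open>word_swap\<close> is an involution, this also transports each word to its swapped
  reversal.\<close>

definition theta :: "freealg \<Rightarrow> freealg" where
  "theta = Poly_Mapping.map_key word_swap"

lemma theta_single: "theta (Poly_Mapping.single w c) = Poly_Mapping.single (word_swap w) c"
  using map_key_single[OF inj_word_swap, of "word_swap w" c] by (simp add: theta_def)

lemma theta_zero [simp]: "theta 0 = 0"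
  by (simp add: theta_def map_key_zero[OF inj_word_swap])

lemma theta_add: "theta (a + b) = theta a + theta b"
  by (simp add: theta_def map_key_plus[OF inj_word_swap])

lemma theta_uminus: "theta (- a) = - theta a"
  using theta_add[of a "- a"] by (simp add: eq_neg_iff_add_eq_0 add.commute)

lemma theta_diff: "theta (a - b) = theta a - theta b"
  using theta_add[of a "- b"] by (simp add: theta_uminus)

lemma theta_sum: "theta (\<Sum>i\<in>I. f i) = (\<Sum>i\<in>I. theta (f i))"
  by (induction I rule: infinite_finite_induct) (simp_all add: theta_add)

lemma theta_mult: "theta (a * b) = theta b * theta a"
proof (induction a rule: freealg_induct)
  case (single u c)
  show ?case
  proof (induction b rule: freealg_induct)
    case (single v d)
    show ?case by (simp add: mult_single theta_single plus_list_def word_swap_def mult.commute)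
  qed (simp_all add: distrib_left distrib_right theta_add)
qed (simp_all add: distrib_left distrib_right theta_add)

lemma theta_theta [simp]: "theta (theta a) = a"
  by (induction a rule: freealg_induct) (simp_all add: theta_single theta_add)

lemma theta_const [simp]: "theta (const c) = const c"
  by (simp add: const_def theta_single word_swap_def)

lemma theta_one [simp]: "theta 1 = 1"
  using theta_const[of 1] by simp

lemma theta_gen: "theta (gen l) = gen (letter_swap l)"
  by (simp add: gen_def theta_single word_swap_def)

lemma theta_power: "theta (a ^ n) = theta a ^ n"
  by (induction n) (simp_all add: theta_mult power_commutes)

lemma theta_carrier: "a \<in> free_carrier r \<Longrightarrow> theta a \<in> free_carrier r"
proof (induction a rule: free_carrier_induct)
  case (gen l a)
  from gen(1) have "letter_swap l \<in> letters r" by auto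
  then show ?case using gen by (simp add: theta_mult theta_gen free_carrier_gen)
qed (auto simp: theta_add)

section \<open>Invariance of the relations and exchange of the two module ideals\<close>

lemma uq_ideal_base: "s \<in> uq_relations r q \<Longrightarrow> s \<in> uq_ideal r q"
  unfolding uq_ideal_def by (rule ideal_gen.base)

lemma uq_ideal_const: "x \<in> uq_ideal r q \<Longrightarrow> const c * x \<in> uq_ideal r q"
  unfolding uq_ideal_def by (rule ideal_gen.lmult) auto

lemma uq_ideal_uminus: "x \<in> uq_ideal r q \<Longrightarrow> - x \<in> uq_ideal r q"
  using uq_ideal_const[of x r q "-1"] by (simp add: const_uminus)

text \<open>The cubic relation reads the same in reverse order, while the commutator of distant
  generators changes sign.\<close>

lemma theta_serre:
  assumes i: "i \<in> {1..r}" "j \<in> {1..r}" "i \<noteq> j"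
    and L: "\<And>i. letter_swap (L i) = L' i" and rel: "serre q L' i j \<in> uq_relations r q"
  shows "theta (serre q L i j) \<in> uq_ideal r q"
proof (cases "cartan i j = -1")
  case True
  then have "theta (serre q L i j) = serre q L' i j"
    unfolding serre_def
    by (simp add: theta_add theta_diff theta_mult theta_gen theta_power L const_commute
        const_left_commute mult.assoc)
  then show ?thesis using uq_ideal_base[OF rel] by simp
next
  case False
  then have "theta (serre q L i j) = - serre q L' i j"
    unfolding serre_def by (simp add: theta_diff theta_mult theta_gen L)
  then show ?thesis using uq_ideal_uminus[OF uq_ideal_base[OF rel]] by simp
qed

lemma theta_uq_relations:
  assumes q: "q \<noteq> 0" and s: "s \<in> uq_relations r q"
  shows "theta s \<in> uq_ideal r q"
proof -
  obtain i j where ij: "i \<in> {1..r}" "j \<in> {1..r}" and "s \<in> {gK i * gKinv i - 1, gKinv i * gK i - 1,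
      gK i * gK j - gK j * gK i,
      gE i * gF j - gF j * gE i
        - (if i = j then const (inverse (q - inverse q)) * (gK i - gKinv i) else 0),
      gK i * gE j - const (q powi cartan j i) * gE j * gK i,
      gK i * gF j - const (q powi (- cartan j i)) * gF j * gK i}
     \<union> (if i = j then {} else {serre q LE i j, serre q LF i j})"
    using s unfolding uq_relations_def by blast
  then consider "s = gK i * gKinv i - 1" | "s = gKinv i * gK i - 1"
    | "s = gK i * gK j - gK j * gK i"
    | "s = gE i * gF j - gF j * gE i
        - (if i = j then const (inverse (q - inverse q)) * (gK i - gKinv i) else 0)"
    | "s = gK i * gE j - const (q powi cartan j i) * gE j * gK i"
    | "s = gK i * gF j - const (q powi (- cartan j i)) * gF j * gK i"
    | "i \<noteq> j" "s = serre q LE i j" | "i \<noteq> j" "s = serre q LF i j"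
    by (auto split: if_splits)
  then show ?thesis
  proof cases
    case 1
    have "gKinv i * gK i - 1 \<in> uq_relations r q" using ij unfolding uq_relations_def by blast
    from uq_ideal_base[OF this] show ?thesis
      unfolding 1 by (simp add: theta_diff theta_mult theta_gen)
  next
    case 2
    have "gK i * gKinv i - 1 \<in> uq_relations r q" using ij unfolding uq_relations_def by blast
    from uq_ideal_base[OF this] show ?thesis
      unfolding 2 by (simp add: theta_diff theta_mult theta_gen)
  next
    case 3
    have "gK j * gK i - gK i * gK j \<in> uq_relations r q" using ij unfolding uq_relations_def by blast
    from uq_ideal_base[OF this] show ?thesis
      unfolding 3 by (simp add: theta_diff theta_mult theta_gen)
  next
    case 4
    \<comment> \<open>Reversal and swap exchange the roles of \<open>i\<close> and \<open>j\<close>,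
      while the diagonal term is fixed.\<close>
    have "gE j * gF i - gF i * gE j
        - (if j = i then const (inverse (q - inverse q)) * (gK j - gKinv j) else 0) \<in> uq_relations r q"
      using ij unfolding uq_relations_def by blast
    from uq_ideal_base[OF this] show ?thesis
      unfolding 4 by (cases "i = j") (simp_all add: theta_diff theta_mult theta_gen const_commute)
  next
    case 5
    \<comment> \<open>The image is the relation between \<open>K_i\<close> and \<open>F_j\<close>
      multiplied by \<open>- ?p\<close>, because its own coefficient is the inverse of
      \<open>?p\<close>.\<close>
    let ?p = "q powi cartan j i"
    have p: "?p * q powi (- cartan j i) = 1" using q by (simp add: power_int_minus)
    have "gK i * gF j - const (q powi (- cartan j i)) * gF j * gK i \<in> uq_relations r q"
      using ij unfolding uq_relations_def by blast
    from uq_ideal_uminus[OF uq_ideal_const[OF uq_ideal_base[OF this], of ?p]]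
    have "gF j * gK i - const ?p * (gK i * gF j) \<in> uq_ideal r q"
      by (simp add: right_diff_distrib const_mult_left mult.assoc p)
    then show ?thesis
      unfolding 5 by (simp add: theta_diff theta_mult theta_gen const_commute mult.assoc const_left_commute)
  next
    case 6
    let ?p = "q powi (- cartan j i)"
    have p: "?p * q powi (cartan j i) = 1" using q by (simp add: power_int_minus)
    have "gK i * gE j - const (q powi (cartan j i)) * gE j * gK i \<in> uq_relations r q"
      using ij unfolding uq_relations_def by blast
    from uq_ideal_uminus[OF uq_ideal_const[OF uq_ideal_base[OF this], of ?p]]
    have "gE j * gK i - const ?p * (gK i * gE j) \<in> uq_ideal r q"
      by (simp add: right_diff_distrib const_mult_left mult.assoc p)
    then show ?thesis
      unfolding 6 by (simp add: theta_diff theta_mult theta_gen const_commute mult.assoc const_left_commute)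
  next
    case 7
    have "serre q LF i j \<in> uq_relations r q" using ij 7 unfolding uq_relations_def by force
    then show ?thesis unfolding 7 using ij 7 by (intro theta_serre) auto
  next
    case 8
    have "serre q LE i j \<in> uq_relations r q" using ij 8 unfolding uq_relations_def by force
    then show ?thesis unfolding 8 using ij 8 by (intro theta_serre) auto
  qed
qed

lemma theta_uq_ideal:
  assumes "q \<noteq> 0" "x \<in> uq_ideal r q"
  shows "theta x \<in> uq_ideal r q"
  using assms(2) unfolding uq_ideal_def
proof induction
  case (base s)
  then show ?case using theta_uq_relations[OF assms(1)] by (simp add: uq_ideal_def)
qed (auto simp: theta_add theta_mult theta_carrier intro: ideal_gen.intros)

text \<open>The generators of the two ideals correspond, and left multiples become right multiples.
  So the dual module is the Verma module with its action transported by
  \<open>theta\<close>.\<close>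

lemma theta_ket_ideal:
  assumes "x \<in> ket_ideal r h lam"
  shows "theta x \<in> bra_ideal r h lam"
  using assms unfolding ket_ideal_def bra_ideal_def
proof induction
  case (base s)
  then consider "s \<in> uq_ideal r (exp h)" | i where "i \<in> {1..r}" "s = gE i"
    | i where "i \<in> {1..r}" "s = gK i - const (qpow h (wform r lam (sroot i)))"
    by blast
  then show ?case
  proof cases
    case 1
    then show ?thesis using theta_uq_ideal[of "exp h" s r] by (intro right_ideal_gen.base) auto
  qed (intro right_ideal_gen.base; auto simp: theta_gen theta_diff)+
qed (auto simp: theta_add theta_mult theta_carrier intro: right_ideal_gen.intros)

lemma theta_bra_ideal:
  assumes "x \<in> bra_ideal r h lam"
  shows "theta x \<in> ket_ideal r h lam"
  using assms unfolding ket_ideal_def bra_ideal_def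
proof induction
  case (base s)
  then consider "s \<in> uq_ideal r (exp h)" | i where "i \<in> {1..r}" "s = gF i"
    | i where "i \<in> {1..r}" "s = gK i - const (qpow h (wform r lam (sroot i)))"
    by blast
  then show ?case
  proof cases
    case 1
    then show ?thesis using theta_uq_ideal[of "exp h" s r] by (intro left_ideal_gen.base) auto
  qed (intro left_ideal_gen.base; auto simp: theta_gen theta_diff)+
qed (auto simp: theta_add theta_mult theta_carrier intro: left_ideal_gen.intros)

lemma theta_in_bra_ideal_iff: "theta x \<in> bra_ideal r h lam \<longleftrightarrow> x \<in> ket_ideal r h lam"
  using theta_ket_ideal[of x r h lam] theta_bra_ideal[of "theta x" r h lam] by auto

section \<open>The dual module in terms of kets\<close>

context verma_params
begin

lemma bra_ideal_zero [simp]: "0 \<in> bra_ideal r h lam"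
  unfolding bra_ideal_def by (rule right_ideal_gen.zero)

lemma bra_ideal_add: "x \<in> bra_ideal r h lam \<Longrightarrow> y \<in> bra_ideal r h lam \<Longrightarrow> x + y \<in> bra_ideal r h lam"
  unfolding bra_ideal_def by (rule right_ideal_gen.add)

lemma bra_ideal_rmult: "a \<in> free_carrier r \<Longrightarrow> x \<in> bra_ideal r h lam \<Longrightarrow> x * a \<in> bra_ideal r h lam"
  unfolding bra_ideal_def by (rule right_ideal_gen.rmult)

lemma bra_ideal_uminus: "x \<in> bra_ideal r h lam \<Longrightarrow> - x \<in> bra_ideal r h lam"
  using bra_ideal_rmult[of "const (-1)" x] by (simp add: const_uminus)

text \<open>With bras written as \<open>theta a\<close>, their equality is again decided by
  \<open>keq\<close>, so nothing about weight vectors has to be proved twice.\<close>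

lemma bra_coset_eq_iff:
  "theta a +o bra_ideal r h lam = theta b +o bra_ideal r h lam \<longleftrightarrow> keq a b"
proof
  assume "theta a +o bra_ideal r h lam = theta b +o bra_ideal r h lam"
  moreover have "theta a \<in> theta a +o bra_ideal r h lam"
    using set_plus_intro2[OF bra_ideal_zero, of "theta a"] by simp
  ultimately have "theta a - theta b \<in> bra_ideal r h lam" using set_plus_imp_minus by blast
  then show "keq a b" unfolding keq_def theta_diff[symmetric] theta_in_bra_ideal_iff .
next
  have sub: "a +o bra_ideal r h lam \<subseteq> b +o bra_ideal r h lam" if "a - b \<in> bra_ideal r h lam" for a b
  proof
    fix x assume "x \<in> a +o bra_ideal r h lam"
    then have "x - a \<in> bra_ideal r h lam" by (rule set_plus_imp_minus)
    from bra_ideal_add[OF this that] show "x \<in> b +o bra_ideal r h lam"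
      by (intro set_minus_imp_plus) simp
  qed
  assume "keq a b"
  then have "theta a - theta b \<in> bra_ideal r h lam"
    unfolding keq_def theta_diff[symmetric] theta_in_bra_ideal_iff .
  moreover from bra_ideal_uminus[OF this] have "theta b - theta a \<in> bra_ideal r h lam" by simp
  ultimately show "theta a +o bra_ideal r h lam = theta b +o bra_ideal r h lam"
    using sub by blast
qed

lemma bra_ideal_plus_self: "bra_ideal r h lam + bra_ideal r h lam = bra_ideal r h lam"
  using bra_ideal_add bra_ideal_zero by (force simp: set_plus_def)

lemma bra_act_coset:
  assumes a: "a \<in> free_carrier r"
  shows "bra_act r h lam (x +o bra_ideal r h lam) a = (x * a) +o bra_ideal r h lam"
proof -
  have "(\<lambda>y. y * a) ` (x +o bra_ideal r h lam) \<subseteq> (x * a) +o bra_ideal r h lam"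
    using bra_ideal_rmult[OF a] by (auto simp: elt_set_plus_def distrib_right)
  then have "bra_act r h lam (x +o bra_ideal r h lam) a \<subseteq> (x * a) +o bra_ideal r h lam + bra_ideal r h lam"
    unfolding bra_act_def by (intro set_plus_mono2) auto
  also have "\<dots> = (x * a) +o bra_ideal r h lam"
    by (simp only: set_plus_rearrange3 bra_ideal_plus_self)
  finally have 1: "bra_act r h lam (x +o bra_ideal r h lam) a \<subseteq> (x * a) +o bra_ideal r h lam" .
  have "x * a \<in> (\<lambda>y. y * a) ` (x +o bra_ideal r h lam)"
    using set_plus_intro2[OF bra_ideal_zero, of x] by simp
  then have 2: "(x * a) +o bra_ideal r h lam \<subseteq> bra_act r h lam (x +o bra_ideal r h lam) a"
    unfolding bra_act_def by (rule set_plus_mono3)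
  from 1 2 show ?thesis by blast
qed

lemma ket_space_eq:
  "ket_space r h lam \<beta> = (\<lambda>x. x +o ket_ideal r h lam) ` wspace (lam - wt \<beta>)"
proof -
  have iff: "x +o ket_ideal r h lam \<in> ket_space r h lam \<beta> \<longleftrightarrow> x \<in> wspace (lam - wt \<beta>)"
    if x: "x \<in> free_carrier r" for x
  proof -
    have "x +o ket_ideal r h lam \<in> verma r h lam" using x unfolding verma_def by blast
    then show ?thesis
      using x by (simp add: ket_space_def wspace_def ket_act_coset ket_coset_eq_iff chi_def)
  qed
  show ?thesis
  proof (intro equalityI subsetI)
    fix X assume X: "X \<in> ket_space r h lam \<beta>"
    then obtain x where x: "X = x +o ket_ideal r h lam" "x \<in> free_carrier r"
      unfolding ket_space_def verma_def by blast
    with X iff[OF x(2)] show "X \<in> (\<lambda>x. x +o ket_ideal r h lam) ` wspace (lam - wt \<beta>)" by blast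
  next
    fix X assume "X \<in> (\<lambda>x. x +o ket_ideal r h lam) ` wspace (lam - wt \<beta>)"
    then obtain x where x: "X = x +o ket_ideal r h lam" "x \<in> wspace (lam - wt \<beta>)" by blast
    then show "X \<in> ket_space r h lam \<beta>" using iff[OF wspace_carrier[OF x(2)]] by simp
  qed
qed

lemma bra_space_eq:
  "bra_space r h lam \<beta> = (\<lambda>x. theta x +o bra_ideal r h lam) ` wspace (lam - wt \<beta>)"
proof -
  have K: "theta x * gK i = theta (gK i * x)" for x i
    by (simp add: theta_mult theta_gen)
  have c: "theta x * const c = theta (const c * x)" for x c
    by (simp add: theta_mult)
  have iff: "theta x +o bra_ideal r h lam \<in> bra_space r h lam \<beta> \<longleftrightarrow> x \<in> wspace (lam - wt \<beta>)"
    if x: "x \<in> free_carrier r" for x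
  proof -
    have "theta x +o bra_ideal r h lam \<in> dual_verma r h lam"
      using theta_carrier[OF x] unfolding dual_verma_def by blast
    then show ?thesis
      using x by (simp add: bra_space_def wspace_def bra_act_coset K c bra_coset_eq_iff chi_def)
  qed
  show ?thesis
  proof (intro equalityI subsetI)
    fix X assume X: "X \<in> bra_space r h lam \<beta>"
    then obtain x where x: "X = x +o bra_ideal r h lam" "x \<in> free_carrier r"
      unfolding bra_space_def dual_verma_def by blast
    then have "X = theta (theta x) +o bra_ideal r h lam" by simp
    with X iff[OF theta_carrier[OF x(2)]]
    show "X \<in> (\<lambda>x. theta x +o bra_ideal r h lam) ` wspace (lam - wt \<beta>)" by blast
  next
    fix X assume "X \<in> (\<lambda>x. theta x +o bra_ideal r h lam) ` wspace (lam - wt \<beta>)"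
    then obtain x where x: "X = theta x +o bra_ideal r h lam" "x \<in> wspace (lam - wt \<beta>)" by blast
    then show "X \<in> bra_space r h lam \<beta>" using iff[OF wspace_carrier[OF x(2)]] by simp
  qed
qed

section \<open>Vacuum expectation values and the pairing\<close>

lemma bra_plus_ket_add:
  assumes "x \<in> bra_ideal r h lam + ket_ideal r h lam" "y \<in> bra_ideal r h lam + ket_ideal r h lam"
  shows "x + y \<in> bra_ideal r h lam + ket_ideal r h lam"
proof -
  have "bra_ideal r h lam + ket_ideal r h lam + (bra_ideal r h lam + ket_ideal r h lam)
      = bra_ideal r h lam + bra_ideal r h lam + (ket_ideal r h lam + ket_ideal r h lam)"
    by (simp only: ac_simps)
  then show ?thesis
    using set_plus_intro[OF assms] unfolding bra_ideal_plus_self ket_ideal_plus_self by simp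
qed

lemma bra_plus_ket_uminus:
  assumes "x \<in> bra_ideal r h lam + ket_ideal r h lam"
  shows "- x \<in> bra_ideal r h lam + ket_ideal r h lam"
proof -
  obtain b k where "x = b + k" "b \<in> bra_ideal r h lam" "k \<in> ket_ideal r h lam"
    using assms by (rule set_plus_elim)
  then show ?thesis
    using set_plus_intro[OF bra_ideal_uminus ket_ideal_uminus] by (simp add: add.commute)
qed

lemma ket_in_bra_plus_ket: "x \<in> ket_ideal r h lam \<Longrightarrow> x \<in> bra_ideal r h lam + ket_ideal r h lam"
  using set_plus_intro[OF bra_ideal_zero, of x] by simp

lemma bra_in_bra_plus_ket: "x \<in> bra_ideal r h lam \<Longrightarrow> x \<in> bra_ideal r h lam + ket_ideal r h lam"
  using set_plus_intro[OF _ ket_ideal_zero, of x] by simp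

lemma vev_cong:
  assumes "x - y \<in> bra_ideal r h lam + ket_ideal r h lam"
  shows "vev r h lam x = vev r h lam y"
proof -
  have "x - const c \<in> bra_ideal r h lam + ket_ideal r h lam \<longleftrightarrow> y - const c \<in> bra_ideal r h lam + ket_ideal r h lam" for c
    using bra_plus_ket_add[OF assms, of "y - const c"]
      bra_plus_ket_add[OF bra_plus_ket_uminus[OF assms], of "x - const c"] by auto
  then show ?thesis by (simp add: vev_def)
qed

text \<open>The pairing does not depend on the representatives: a'b' - ab = (a' - a)b' + a(b' - b),
  with the first summand in the right ideal and the second in the left ideal.\<close>

lemma pairing_cosets:
  assumes a: "a \<in> free_carrier r" and b: "b \<in> free_carrier r"
  shows "pairing r h lam (a +o bra_ideal r h lam) (b +o ket_ideal r h lam) = vev r h lam (a * b)"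
proof -
  have eq: "vev r h lam (a' * b') = vev r h lam (a * b)"
    if a': "a' \<in> a +o bra_ideal r h lam" and b': "b' \<in> b +o ket_ideal r h lam" for a' b'
  proof (rule vev_cong)
    have j: "a' - a \<in> bra_ideal r h lam" "b' - b \<in> ket_ideal r h lam"
      using a' b' by (auto dest: set_plus_imp_minus)
    have "b' \<in> free_carrier r"
      using j(2) ket_ideal_subset free_carrier_add[of "b' - b" r b] b by auto
    then have "(a' - a) * b' + a * (b' - b) \<in> bra_ideal r h lam + ket_ideal r h lam"
      using a j by (intro set_plus_intro bra_ideal_rmult ket_ideal_lmult)
    then show "a' * b' - a * b \<in> bra_ideal r h lam + ket_ideal r h lam"
      by (simp add: algebra_simps)
  qed
  have "a \<in> a +o bra_ideal r h lam" "b \<in> b +o ket_ideal r h lam"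
    using set_plus_intro2[OF bra_ideal_zero, of a] set_plus_intro2[OF ket_ideal_zero, of b] by simp_all
  then show ?thesis
    unfolding pairing_def by (intro the_equality) (use eq in blast)+
qed

text \<open>Applied to the vacuum, the right ideal yields only weights strictly below \<lambda>:
  \<open>F_i\<close> lowers, \<open>K_i\<close> minus its vacuum eigenvalue kills the vacuum part,
  and the relations act as 0. The factor \<open>a\<close> is arbitrary so that the induction absorbs
  right multiplication.\<close>

lemma bra_ideal_wsum:
  assumes "x \<in> bra_ideal r h lam" "a \<in> free_carrier r"
  shows "x * a \<in> wsum ((\<lambda>\<gamma>. lam - wt \<gamma>) ` (Qplus r - {0}))"
  using assms unfolding bra_ideal_def
proof (induction arbitrary: a)
  case zero
  show ?case by (simp add: wsum.base)
next
  case (base s)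
  let ?\<Gamma> = "(\<lambda>\<gamma>. lam - wt \<gamma>) ` (Qplus r - {0})"
  from base(1) consider "s \<in> uq_ideal r (exp h)" | i where "i \<in> {1..r}" "s = gF i"
    | i where "i \<in> {1..r}" "s = gK i - const (qpow h (wform r lam (sroot i)))"
    by blast
  then show ?case
  proof cases
    case 1
    then have "s * a \<in> uq_ideal r (exp h)"
      unfolding uq_ideal_def by (rule ideal_gen.rmult[OF base(2)])
    then show ?thesis
      unfolding ket_ideal_def by (intro wsum.base) (auto simp: ket_ideal_def intro: left_ideal_gen.base)
  next
    case 2
    have "a \<in> wsum ((\<lambda>\<gamma>. lam - wt \<gamma>) ` Qplus r)"
      by (rule hwspan_wsum[OF carrier_hwspan[OF base(2)] wspace_one])
    from wsum_F[OF this 2(1)] show ?thesis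
      unfolding 2(2)
    proof (rule wsum_mono)
      show "(\<lambda>\<gamma>. \<gamma> - sroot i) ` (\<lambda>\<gamma>. lam - wt \<gamma>) ` Qplus r \<subseteq> ?\<Gamma>"
      proof clarify
        fix \<gamma> assume \<gamma>: "\<gamma> \<in> Qplus r"
        have "Poly_Mapping.lookup (\<gamma> + qroot i) i \<noteq> 0" by (simp add: lookup_add lookup_qroot)
        then have "\<gamma> + qroot i \<noteq> 0" by (metis lookup_zero)
        moreover have "lam - wt \<gamma> - sroot i = lam - wt (\<gamma> + qroot i)"
          by (simp add: wt_add wt_qroot diff_diff_eq)
        ultimately show "lam - wt \<gamma> - sroot i \<in> ?\<Gamma>"
          using \<gamma> 2(1) by (intro image_eqI[of _ _ "\<gamma> + qroot i"]) auto
      qed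
    qed
  next
    case 3
    let ?c = "qpow h (wform r lam (sroot i))"
    obtain c y where y: "a = const c + y" "y \<in> wsum ?\<Gamma>"
      using hwspan_one_split[OF carrier_hwspan[OF base(2)]] by blast
    have "s \<in> ket_ideal r h lam"
      using keq_K_vac[OF 3(1)] by (simp add: 3(2) keq_def)
    then have "const c * s \<in> wsum ?\<Gamma>" by (intro wsum.base ket_ideal_lmult) auto
    moreover have "gK i * y + const (- ?c) * y \<in> wsum ?\<Gamma>"
      using y(2) 3(1) by (intro wsum_add wsum_K wsum_const)
    ultimately have "const c * s + (gK i * y + const (- ?c) * y) \<in> wsum ?\<Gamma>" by (rule wsum_add)
    moreover have "s * a = const c * s + (gK i * y + const (- ?c) * y)"
      by (simp add: y(1) 3(2) distrib_left const_commute left_diff_distrib const_uminus)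
    ultimately show ?thesis by simp
  qed
next
  case (add x y)
  then show ?case by (simp add: distrib_right wsum_add)
next
  case (rmult b x)
  then show ?case by (simp add: mult.assoc)
qed

end

context verma_irreducible_params
begin

text \<open>A constant has weight \<lambda>, while an element of the sum of the two ideals lies in
  strictly lower weights modulo \<open>ket_ideal\<close>. This gives the uniqueness behind
  \<open>vev\<close>.\<close>

lemma const_in_bra_plus_ket:
  assumes "const c \<in> bra_ideal r h lam + ket_ideal r h lam"
  shows "c = 0"
proof -
  obtain b k where bk: "const c = b + k" "b \<in> bra_ideal r h lam" "k \<in> ket_ideal r h lam"
    using assms by (rule set_plus_elim)
  have "b \<in> wsum ((\<lambda>\<gamma>. lam - wt \<gamma>) ` (Qplus r - {0}))"
    using bra_ideal_wsum[OF bk(2) free_carrier_one] by simp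
  then have "const c \<in> wsum ((\<lambda>\<gamma>. lam - wt \<gamma>) ` (Qplus r - {0}))"
    unfolding bk(1) using wsum_add wsum.base[OF bk(3)] by blast
  moreover have "const c \<in> wspace lam" using wspace_const[OF wspace_one, of c] by simp
  ultimately show ?thesis using wspace_lam_wsum const_in_ket_ideal by blast
qed

lemma vev_eqI:
  assumes "x - const c \<in> bra_ideal r h lam + ket_ideal r h lam"
  shows "vev r h lam x = c"
  unfolding vev_def
proof (rule the_equality)
  show "x - const c \<in> bra_ideal r h lam + ket_ideal r h lam" by (rule assms)
  fix c' assume "x - const c' \<in> bra_ideal r h lam + ket_ideal r h lam"
  from bra_plus_ket_add[OF bra_plus_ket_uminus[OF this] assms]
  have "const (c' - c) \<in> bra_ideal r h lam + ket_ideal r h lam"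
    by (simp only: const_diff) (simp add: algebra_simps)
  then have "c' - c = 0" by (rule const_in_bra_plus_ket)
  then show "c' = c" by simp
qed

text \<open>The highest weight space is one-dimensional, so the normalisation of a Whittaker vector
  determines its top component.\<close>

lemma pairing_bra_vac:
  assumes "x \<in> wspace lam"
  shows "pairing r h lam (bra_vac r h lam) (x +o ket_ideal r h lam) = 1 \<longleftrightarrow> keq x 1"
proof -
  obtain c where c: "keq x (const c)" using wspace_lam_const[OF assms] by blast
  have "pairing r h lam (bra_vac r h lam) (x +o ket_ideal r h lam) = vev r h lam (1 * x)"
    unfolding bra_vac_def using wspace_carrier[OF assms] by (intro pairing_cosets) auto
  also have "\<dots> = c"
    using c unfolding keq_def by (intro vev_eqI ket_in_bra_plus_ket) simp
  finally have p: "pairing r h lam (bra_vac r h lam) (x +o ket_ideal r h lam) = c" .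
  show ?thesis
  proof
    assume "keq x 1"
    then have "keq (const c) 1" using c keq_trans keq_sym by blast
    then have "const (c - 1) \<in> ket_ideal r h lam" by (simp add: keq_def const_diff)
    then show "pairing r h lam (bra_vac r h lam) (x +o ket_ideal r h lam) = 1"
      using const_in_ket_ideal[of "c - 1"] p by simp
  qed (use c p in simp)
qed

lemma pairing_ket_vac:
  assumes "x \<in> wspace lam"
  shows "pairing r h lam (theta x +o bra_ideal r h lam) (ket_vac r h lam) = 1 \<longleftrightarrow> keq x 1"
proof -
  obtain c where c: "keq x (const c)" using wspace_lam_const[OF assms] by blast
  have "pairing r h lam (theta x +o bra_ideal r h lam) (ket_vac r h lam) = vev r h lam (theta x * 1)"
    unfolding ket_vac_def using wspace_carrier[OF assms] theta_carrier by (intro pairing_cosets) auto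
  also have "\<dots> = c"
    using theta_ket_ideal[of "x - const c"] c unfolding keq_def
    by (intro vev_eqI bra_in_bra_plus_ket) (simp add: theta_diff)
  finally have p: "pairing r h lam (theta x +o bra_ideal r h lam) (ket_vac r h lam) = c" .
  show ?thesis
  proof
    assume "keq x 1"
    then have "keq (const c) 1" using c keq_trans keq_sym by blast
    then have "const (c - 1) \<in> ket_ideal r h lam" by (simp add: keq_def const_diff)
    then show "pairing r h lam (theta x +o bra_ideal r h lam) (ket_vac r h lam) = 1"
      using const_in_ket_ideal[of "c - 1"] p by simp
  qed (use c p in simp)
qed

section \<open>Whittaker vectors in the completions and their representatives\<close>

lemma is_whittaker_ket_iff:
  "is_whittaker_ket r h lam \<mu> W \<longleftrightarrow>
     (\<exists>w. whittaker_rep LK \<mu> w \<and> W = (\<lambda>\<beta>\<in>Qplus r. w \<beta> +o ket_ideal r h lam))"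
proof -
  have "is_whittaker_ket r h lam \<mu> (\<lambda>\<beta>\<in>Qplus r. w \<beta> +o ket_ideal r h lam) \<longleftrightarrow> whittaker_rep LK \<mu> w"
    if w: "\<forall>\<beta>\<in>Qplus r. w \<beta> \<in> wspace (lam - wt \<beta>)" for w
  proof -
    have "(\<lambda>\<beta>\<in>Qplus r. w \<beta> +o ket_ideal r h lam) \<in> ket_completion r h lam"
      using w unfolding ket_completion_def ket_space_eq by auto
    moreover have "pairing r h lam (bra_vac r h lam) ((\<lambda>\<beta>\<in>Qplus r. w \<beta> +o ket_ideal r h lam) 0) = 1 \<longleftrightarrow> keq (w 0) 1"
      using pairing_bra_vac[of "w 0"] bspec[OF w Qplus_zero] by simp
    moreover have "ket_act r h lam (gE i) ((\<lambda>\<beta>\<in>Qplus r. w \<beta> +o ket_ideal r h lam) (\<beta> + qroot i))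
          = ket_act r h lam (const (\<mu> i) * gK i ^ (i - 1)) ((\<lambda>\<beta>\<in>Qplus r. w \<beta> +o ket_ideal r h lam) \<beta>)
        \<longleftrightarrow> keq (gE i * w (\<beta> + qroot i)) (const (\<mu> i) * gK i ^ (i - 1) * w \<beta>)"
      if "i \<in> {1..r}" "\<beta> \<in> Qplus r" for i \<beta>
      using that Qplus_add[OF that(2) Qplus_qroot[OF that(1)]] by (simp add: ket_act_coset ket_coset_eq_iff)
    ultimately show ?thesis
      unfolding is_whittaker_ket_def whittaker_rep_def using w by auto
  qed
  moreover have "\<exists>w. (\<forall>\<beta>\<in>Qplus r. w \<beta> \<in> wspace (lam - wt \<beta>)) \<and> W = (\<lambda>\<beta>\<in>Qplus r. w \<beta> +o ket_ideal r h lam)"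
    if "is_whittaker_ket r h lam \<mu> W"
  proof -
    have W: "W \<in> ket_completion r h lam" using that by (simp add: is_whittaker_ket_def)
    then have "\<forall>\<beta>\<in>Qplus r. \<exists>x\<in>wspace (lam - wt \<beta>). W \<beta> = x +o ket_ideal r h lam"
      unfolding ket_completion_def ket_space_eq by (blast dest: PiE_mem)
    then obtain w where w: "\<forall>\<beta>\<in>Qplus r. w \<beta> \<in> wspace (lam - wt \<beta>) \<and> W \<beta> = w \<beta> +o ket_ideal r h lam"
      by metis
    moreover have "W = (\<lambda>\<beta>\<in>Qplus r. w \<beta> +o ket_ideal r h lam)"
      using W w unfolding ket_completion_def by (auto simp: fun_eq_iff dest: PiE_arb)
    ultimately show ?thesis by blast
  qed
  moreover have "whittaker_rep LK \<mu> w \<Longrightarrow> \<forall>\<beta>\<in>Qplus r. w \<beta> \<in> wspace (lam - wt \<beta>)" for w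
    by (simp add: whittaker_rep_def)
  ultimately show ?thesis by blast
qed

text \<open>Under \<open>theta\<close> the right action of \<open>F_i\<close> becomes the left
  action of \<open>E_i\<close>, while \<open>gKinv i\<close> is fixed; hence
  \<open>LKinv\<close>.\<close>

lemma is_whittaker_bra_iff:
  "is_whittaker_bra r h lam \<mu> W \<longleftrightarrow>
     (\<exists>w. whittaker_rep LKinv \<mu> w \<and> W = (\<lambda>\<beta>\<in>Qplus r. theta (w \<beta>) +o bra_ideal r h lam))"
proof -
  have "is_whittaker_bra r h lam \<mu> (\<lambda>\<beta>\<in>Qplus r. theta (w \<beta>) +o bra_ideal r h lam) \<longleftrightarrow> whittaker_rep LKinv \<mu> w"
    if w: "\<forall>\<beta>\<in>Qplus r. w \<beta> \<in> wspace (lam - wt \<beta>)" for w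
  proof -
    have "(\<lambda>\<beta>\<in>Qplus r. theta (w \<beta>) +o bra_ideal r h lam) \<in> bra_completion r h lam"
      using w unfolding bra_completion_def bra_space_eq by auto
    moreover have "pairing r h lam ((\<lambda>\<beta>\<in>Qplus r. theta (w \<beta>) +o bra_ideal r h lam) 0) (ket_vac r h lam) = 1 \<longleftrightarrow> keq (w 0) 1"
      using pairing_ket_vac[of "w 0"] bspec[OF w Qplus_zero] by simp
    moreover have "bra_act r h lam ((\<lambda>\<beta>\<in>Qplus r. theta (w \<beta>) +o bra_ideal r h lam) (\<beta> + qroot i)) (gF i)
          = bra_act r h lam ((\<lambda>\<beta>\<in>Qplus r. theta (w \<beta>) +o bra_ideal r h lam) \<beta>) (const (\<mu> i) * gKinv i ^ (i - 1))
        \<longleftrightarrow> keq (gE i * w (\<beta> + qroot i)) (const (\<mu> i) * gKinv i ^ (i - 1) * w \<beta>)"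
      if "i \<in> {1..r}" "\<beta> \<in> Qplus r" for i \<beta>
    proof -
      have E: "theta (w (\<beta> + qroot i)) * gF i = theta (gE i * w (\<beta> + qroot i))"
        by (simp add: theta_mult theta_gen)
      have K: "theta (w \<beta>) * (const (\<mu> i) * gKinv i ^ (i - 1)) = theta (const (\<mu> i) * gKinv i ^ (i - 1) * w \<beta>)"
        by (simp add: theta_mult theta_gen theta_power const_commute)
      show ?thesis
        using that Qplus_add[OF that(2) Qplus_qroot[OF that(1)]]
        by (simp add: bra_act_coset E K[unfolded One_nat_def] bra_coset_eq_iff)
    qed
    ultimately show ?thesis
      unfolding is_whittaker_bra_def whittaker_rep_def using w by auto
  qed
  moreover have "\<exists>w. (\<forall>\<beta>\<in>Qplus r. w \<beta> \<in> wspace (lam - wt \<beta>)) \<and> W = (\<lambda>\<beta>\<in>Qplus r. theta (w \<beta>) +o bra_ideal r h lam)"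
    if "is_whittaker_bra r h lam \<mu> W"
  proof -
    have W: "W \<in> bra_completion r h lam" using that by (simp add: is_whittaker_bra_def)
    then have "\<forall>\<beta>\<in>Qplus r. \<exists>x\<in>wspace (lam - wt \<beta>). W \<beta> = theta x +o bra_ideal r h lam"
      unfolding bra_completion_def bra_space_eq by (blast dest: PiE_mem)
    then obtain w where w: "\<forall>\<beta>\<in>Qplus r. w \<beta> \<in> wspace (lam - wt \<beta>) \<and> W \<beta> = theta (w \<beta>) +o bra_ideal r h lam"
      by metis
    moreover have "W = (\<lambda>\<beta>\<in>Qplus r. theta (w \<beta>) +o bra_ideal r h lam)"
      using W w unfolding bra_completion_def by (auto simp: fun_eq_iff dest: PiE_arb)
    ultimately show ?thesis by blast
  qed
  moreover have "whittaker_rep LKinv \<mu> w \<Longrightarrow> \<forall>\<beta>\<in>Qplus r. w \<beta> \<in> wspace (lam - wt \<beta>)" for w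
    by (simp add: whittaker_rep_def)
  ultimately show ?thesis by blast
qed

lemma whittaker_ket_eq:
  assumes w: "whittaker_rep LK \<mu> w"
  shows "whittaker_ket r h lam \<mu> = (\<lambda>\<beta>\<in>Qplus r. w \<beta> +o ket_ideal r h lam)"
  unfolding whittaker_ket_def is_whittaker_ket_iff
proof (rule the_equality)
  fix W assume "\<exists>w'. whittaker_rep LK \<mu> w' \<and> W = (\<lambda>\<beta>\<in>Qplus r. w' \<beta> +o ket_ideal r h lam)"
  then obtain w' where w': "whittaker_rep LK \<mu> w'" "W = (\<lambda>\<beta>\<in>Qplus r. w' \<beta> +o ket_ideal r h lam)" by blast
  have "keq (w' \<beta>) (w \<beta>)" if "\<beta> \<in> Qplus r" for \<beta>
    using whittaker_rep_unique[OF _ w'(1) w that] by simp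
  then show "W = (\<lambda>\<beta>\<in>Qplus r. w \<beta> +o ket_ideal r h lam)"
    unfolding w'(2) by (intro restrict_ext) (simp add: ket_coset_eq_iff)
qed (use w in blast)

lemma whittaker_bra_eq:
  assumes w: "whittaker_rep LKinv \<mu> w"
  shows "whittaker_bra r h lam \<mu> = (\<lambda>\<beta>\<in>Qplus r. theta (w \<beta>) +o bra_ideal r h lam)"
  unfolding whittaker_bra_def is_whittaker_bra_iff
proof (rule the_equality)
  fix W assume "\<exists>w'. whittaker_rep LKinv \<mu> w' \<and> W = (\<lambda>\<beta>\<in>Qplus r. theta (w' \<beta>) +o bra_ideal r h lam)"
  then obtain w' where w': "whittaker_rep LKinv \<mu> w'" "W = (\<lambda>\<beta>\<in>Qplus r. theta (w' \<beta>) +o bra_ideal r h lam)" by blast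
  have "keq (w' \<beta>) (w \<beta>)" if "\<beta> \<in> Qplus r" for \<beta>
    using whittaker_rep_unique[OF _ w'(1) w that] by simp
  then show "W = (\<lambda>\<beta>\<in>Qplus r. theta (w \<beta>) +o bra_ideal r h lam)"
    unfolding w'(2) by (intro restrict_ext) (simp add: bra_coset_eq_iff)
qed (use w in blast)

end

section \<open>The path model\<close>

lemma qroot_inject: "qroot i = qroot j \<longleftrightarrow> i = j"
  by (metis lookup_qroot zero_neq_one)

text \<open>Every step raises the height by one, so all paths to \<beta> have the same
  length.\<close>

lemma qdeg_path_nth:
  assumes "p \<in> paths r \<beta>" "k < length p"
  shows "qdeg r (p ! k) = k"
  using assms(2)
proof (induction k)
  case 0
  then show ?case using assms(1) by (simp add: paths_def hd_conv_nth qdeg_def)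
next
  case (Suc k)
  then have "Suc k \<in> {1..length p - 1}" by auto
  moreover have "\<forall>k\<in>{1..length p - 1}. \<exists>i\<in>{1..r}. p ! k = p ! (k - 1) + qroot i"
    using assms(1) by (simp add: paths_def)
  ultimately obtain i where i: "i \<in> {1..r}" "p ! Suc k = p ! k + qroot i"
    by fastforce
  have "qdeg r (p ! Suc k) = Suc (qdeg r (p ! k))"
    unfolding i(2) by (rule qdeg_add_qroot[OF i(1)])
  with Suc show ?case by simp
qed

lemma paths_length: "p \<in> paths r \<beta> \<Longrightarrow> length p = Suc (qdeg r \<beta>)"
  using qdeg_path_nth[of p r \<beta> "length p - 1"] by (auto simp: paths_def last_conv_nth)

lemma paths_zero: "paths r 0 = {[0]}"
proof
  show "paths r 0 \<subseteq> {[0]}"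
  proof
    fix p assume p: "p \<in> paths r 0"
    then have "length p = 1" using paths_length[OF p] by (simp add: qdeg_def)
    then obtain x where "p = [x]" by (auto simp: length_Suc_conv)
    with p show "p \<in> {[0]}" by (simp add: paths_def)
  qed
qed (simp add: paths_def)

lemma paths_snoc_iff:
  assumes \<beta>: "\<beta> \<in> Qplus r" and p: "p \<noteq> []"
  shows "p @ [\<beta>] \<in> paths r \<beta> \<longleftrightarrow>
    (\<exists>i\<in>{i\<in>{1..r}. 0 < Poly_Mapping.lookup \<beta> i}. p \<in> paths r (\<beta> - qroot i))"
proof -
  have steps: "(\<forall>k\<in>{1..length (p @ [\<beta>]) - 1}. \<exists>i\<in>{1..r}. (p @ [\<beta>]) ! k = (p @ [\<beta>]) ! (k - 1) + qroot i)
    \<longleftrightarrow> (\<forall>k\<in>{1..length p - 1}. \<exists>i\<in>{1..r}. p ! k = p ! (k - 1) + qroot i)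
      \<and> (\<exists>i\<in>{1..r}. \<beta> = last p + qroot i)"
  proof -
    have "{1..length (p @ [\<beta>]) - 1} = insert (length p) {1..length p - 1}"
      using p by (cases p) auto
    moreover have "(p @ [\<beta>]) ! k = p ! k" "(p @ [\<beta>]) ! (k - 1) = p ! (k - 1)" if "k \<in> {1..length p - 1}" for k
      using that by (auto simp: nth_append)
    moreover have "(p @ [\<beta>]) ! length p = \<beta>" "(p @ [\<beta>]) ! (length p - 1) = last p"
      using p by (auto simp: nth_append last_conv_nth)
    ultimately show ?thesis by auto
  qed
  have last: "\<beta> = \<gamma> + qroot i \<longleftrightarrow> 0 < Poly_Mapping.lookup \<beta> i \<and> \<gamma> = \<beta> - qroot i" for \<gamma> i
    by (auto simp: diff_qroot_add lookup_add lookup_qroot)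
  show ?thesis
    unfolding paths_def mem_Collect_eq steps using p \<beta> by (auto simp: last)
qed

text \<open>Paths are sorted by their last step; as \<beta> is nonzero, removing the endpoint leaves
  a nonempty path.\<close>

lemma paths_rec:
  assumes \<beta>: "\<beta> \<in> Qplus r" "\<beta> \<noteq> 0"
  shows "paths r \<beta> = (\<Union>i\<in>{i\<in>{1..r}. 0 < Poly_Mapping.lookup \<beta> i}. (\<lambda>p. p @ [\<beta>]) ` paths r (\<beta> - qroot i))"
    (is "_ = ?R")
proof (intro equalityI subsetI)
  fix p assume p: "p \<in> paths r \<beta>"
  then have "p \<noteq> []" "last p = \<beta>" "hd p = 0" by (auto simp: paths_def)
  then have eq: "p = butlast p @ [\<beta>]" "butlast p \<noteq> []"
    using \<beta> by (metis append_butlast_last_id, metis append_butlast_last_id append_self_conv2 list.sel(1))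
  then show "p \<in> ?R" using p paths_snoc_iff[OF \<beta>(1) eq(2)] by (metis (no_types, lifting) UN_I imageI)
next
  fix p assume "p \<in> ?R"
  then obtain i p' where i: "i \<in> {i\<in>{1..r}. 0 < Poly_Mapping.lookup \<beta> i}"
    and p': "p' \<in> paths r (\<beta> - qroot i)" "p = p' @ [\<beta>]" by blast
  then have "p' \<noteq> []" by (auto simp: paths_def)
  from paths_snoc_iff[OF \<beta>(1) this] i p' show "p \<in> paths r \<beta>" by blast
qed

lemma finite_paths: "\<beta> \<in> Qplus r \<Longrightarrow> finite (paths r \<beta>)"
proof (induction "qdeg r \<beta>" arbitrary: \<beta> rule: less_induct)
  case less
  show ?case
  proof (cases "\<beta> = 0")
    case False
    then show ?thesis
      unfolding paths_rec[OF less.prems False]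
      using less.hyps[OF qdeg_diff_qroot Qplus_diff_qroot[OF less.prems]] by auto
  qed (simp add: paths_zero)
qed

lemma path_Z_zero: "path_Z r h lam 0 = 1"
  by (simp add: path_Z_def paths_zero)

text \<open>The last step contributes the factor with the weight at \<beta>. The classes are
  disjoint because the penultimate vertex determines the last step.\<close>

lemma path_Z_rec:
  assumes \<beta>: "\<beta> \<in> Qplus r" "\<beta> \<noteq> 0"
  shows "path_Z r h lam \<beta> = (\<Sum>i\<in>{i\<in>{1..r}. 0 < Poly_Mapping.lookup \<beta> i}.
    1 / path_weight r h lam i \<beta> * path_Z r h lam (\<beta> - qroot i))"
proof -
  let ?I = "{i\<in>{1..r}. 0 < Poly_Mapping.lookup \<beta> i}"
  define W where "W p = (\<Prod>k=1..length p - 1. 1 / path_weight r h lam (path_step p k) (p ! k))" for p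
  have W: "W (p @ [\<beta>]) = 1 / path_weight r h lam i \<beta> * W p"
    if i: "i \<in> ?I" and p: "p \<in> paths r (\<beta> - qroot i)" for i p
  proof -
    have ne: "p \<noteq> []" and lastp: "p ! (length p - 1) = \<beta> - qroot i"
      using p by (auto simp: paths_def last_conv_nth)
    have "\<beta> - qroot i + qroot i = \<beta>" using i by (intro diff_qroot_add) auto
    then have "(\<beta> = \<beta> - qroot i + qroot j) = (j = i)" for j
      by (metis add_left_cancel qroot_inject)
    then have step: "path_step (p @ [\<beta>]) (length p) = i"
      using ne lastp by (simp add: path_step_def nth_append)
    have "{1..length (p @ [\<beta>]) - 1} = insert (length p) {1..length p - 1}"
      using ne by (cases p) auto
    moreover have "length p \<notin> {1..length p - 1}" using ne by (cases p) auto
    ultimately have "W (p @ [\<beta>]) = 1 / path_weight r h lam i \<beta>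
        * (\<Prod>k=1..length p - 1. 1 / path_weight r h lam (path_step (p @ [\<beta>]) k) ((p @ [\<beta>]) ! k))"
      unfolding W_def by (simp add: step)
    also have "(\<Prod>k=1..length p - 1. 1 / path_weight r h lam (path_step (p @ [\<beta>]) k) ((p @ [\<beta>]) ! k)) = W p"
      unfolding W_def
    proof (intro prod.cong refl)
      fix k assume "k \<in> {1..length p - 1}"
      then have "(p @ [\<beta>]) ! k = p ! k" "(p @ [\<beta>]) ! (k - 1) = p ! (k - 1)"
        by (auto simp: nth_append)
      then show "1 / path_weight r h lam (path_step (p @ [\<beta>]) k) ((p @ [\<beta>]) ! k)
          = 1 / path_weight r h lam (path_step p k) (p ! k)"
        by (simp only: path_step_def)
    qed
    finally show ?thesis .
  qed
  have disj: "(\<lambda>p. p @ [\<beta>]) ` paths r (\<beta> - qroot i) \<inter> (\<lambda>p. p @ [\<beta>]) ` paths r (\<beta> - qroot j) = {}"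
    if "i \<in> ?I" "j \<in> ?I" "i \<noteq> j" for i j
  proof -
    have "\<beta> - qroot i \<noteq> \<beta> - qroot j"
    proof
      assume "\<beta> - qroot i = \<beta> - qroot j"
      then have "Poly_Mapping.lookup (\<beta> - qroot i) i = Poly_Mapping.lookup (\<beta> - qroot j) i" by simp
      with that show False by (auto simp: lookup_minus lookup_qroot)
    qed
    then show ?thesis by (auto simp: paths_def)
  qed
  have "path_Z r h lam \<beta> = (\<Sum>p\<in>paths r \<beta>. W p)"
    by (simp add: path_Z_def W_def)
  also have "\<dots> = (\<Sum>i\<in>?I. \<Sum>p\<in>(\<lambda>p. p @ [\<beta>]) ` paths r (\<beta> - qroot i). W p)"
    unfolding paths_rec[OF \<beta>]
    by (rule sum.UNION_disjoint) (use disj finite_paths[OF Qplus_diff_qroot[OF \<beta>(1)]] in auto)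
  also have "\<dots> = (\<Sum>i\<in>?I. 1 / path_weight r h lam i \<beta> * path_Z r h lam (\<beta> - qroot i))"
  proof (intro sum.cong refl)
    fix i assume i: "i \<in> ?I"
    have "(\<Sum>p\<in>(\<lambda>p. p @ [\<beta>]) ` paths r (\<beta> - qroot i). W p) = (\<Sum>p\<in>paths r (\<beta> - qroot i). W (p @ [\<beta>]))"
      by (subst sum.reindex) (auto simp: inj_on_def)
    also have "\<dots> = (\<Sum>p\<in>paths r (\<beta> - qroot i). 1 / path_weight r h lam i \<beta> * W p)"
      by (intro sum.cong refl W i)
    finally show "(\<Sum>p\<in>(\<lambda>p. p @ [\<beta>]) ` paths r (\<beta> - qroot i). W p)
        = 1 / path_weight r h lam i \<beta> * path_Z r h lam (\<beta> - qroot i)"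
      by (simp add: path_Z_def W_def sum_distrib_left)
  qed
  finally show ?thesis .
qed

definition mult_power :: "nat \<Rightarrow> (nat \<Rightarrow> complex) \<Rightarrow> (nat \<Rightarrow>\<^sub>0 nat) \<Rightarrow> complex" where
  "mult_power r \<nu> \<beta> = (\<Prod>i=1..r. \<nu> i ^ Poly_Mapping.lookup \<beta> i)"

lemma mult_power_add_qroot:
  assumes "i \<in> {1..r}"
  shows "mult_power r \<nu> (\<beta> + qroot i) = \<nu> i * mult_power r \<nu> \<beta>"
proof -
  have "mult_power r \<nu> (\<beta> + qroot i) = (\<Prod>k=1..r. \<nu> k ^ Poly_Mapping.lookup \<beta> k * (if i = k then \<nu> k else 1))"
    unfolding mult_power_def by (intro prod.cong refl) (simp add: lookup_add lookup_qroot)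
  then show ?thesis using assms by (simp add: prod.distrib mult_power_def mult.commute)
qed

section \<open>Pairing the two Whittaker vectors\<close>

context verma_irreducible_params
begin

text \<open>The bra coefficient is formed with 1/q and the ket eigenvalue with q, so the two powers
  of \<open>K_i\<close> cancel. What remains is q^tau divided by v at 1/q, the reciprocal of the
  path weight.\<close>

lemma path_coeff_weight:
  assumes "i \<in> {1..r}"
  shows "path_coeff (- h) \<mu>' i (\<beta> + qroot i) * (\<mu> i * chi (lam - wt \<beta>) i ^ (i - 1))
    = \<mu> i * \<mu>' i / path_weight r h lam i (\<beta> + qroot i)"
proof -
  let ?t = "path_tau r lam i (\<beta> + qroot i)" and ?x = "of_nat (i - 1) * wform r (lam - wt \<beta>) (sroot i)"
  have "qpow (- h) (- ?t + ?x) * qpow h ?x = inverse (qpow h (- ?t))"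
    by (simp add: qpow_def exp_add[symmetric] exp_minus[symmetric] algebra_simps)
  moreover have "lam - wt (\<beta> + qroot i) + sroot i = lam - wt \<beta>"
    by (simp add: wt_add wt_qroot)
  then have "path_coeff (- h) \<mu>' i (\<beta> + qroot i)
      = \<mu>' i * qpow (- h) (- ?t + ?x) / path_v r (- h) lam (\<beta> + qroot i)"
    by (simp only: path_coeff_def)
  then have "path_coeff (- h) \<mu>' i (\<beta> + qroot i) * (\<mu> i * chi (lam - wt \<beta>) i ^ (i - 1))
      = \<mu> i * \<mu>' i * (qpow (- h) (- ?t + ?x) * qpow h ?x) / path_v r (- h) lam (\<beta> + qroot i)"
    by (simp only: chi_def qpow_power divide_inverse mult_ac)
  ultimately show ?thesis
    by (simp only: path_weight_def divide_inverse inverse_mult_distrib mult_ac)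
qed

text \<open>Expanding \<open>theta (u \<beta>)\<close> by its recursion puts \<open>E_i\<close>
  directly in front of \<open>w \<beta>\<close>, where the Whittaker equation lowers \<beta> by
  \<alpha>_i. The pairing thus obeys the last-step recursion of the partition function.\<close>

lemma pairing_path_vector:
  fixes \<mu> \<mu>' :: "nat \<Rightarrow> complex"
  assumes w: "whittaker_rep LK \<mu> w" and "\<beta> \<in> Qplus r"
  defines "u \<equiv> path_vector (path_coeff (- h) \<mu>')"
  shows "theta (u \<beta>) * w \<beta> - const (mult_power r (\<lambda>i. \<mu> i * \<mu>' i) \<beta> * path_Z r h lam \<beta>)
    \<in> bra_ideal r h lam + ket_ideal r h lam"
  using assms(2)
proof (induction "qdeg r \<beta>" arbitrary: \<beta> rule: less_induct)
  case less
  note \<beta> = \<open>\<beta> \<in> Qplus r\<close>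
  let ?BJ = "bra_ideal r h lam + ket_ideal r h lam"
  define Z where "Z \<beta> = mult_power r (\<lambda>i. \<mu> i * \<mu>' i) \<beta> * path_Z r h lam \<beta>" for \<beta>
  show ?case
    unfolding Z_def[symmetric]
  proof (cases "\<beta> = 0")
    case True
    have "keq (w 0) 1" using w by (simp add: whittaker_rep_def)
    then show "theta (u \<beta>) * w \<beta> - const (Z \<beta>) \<in> ?BJ"
      by (simp add: True u_def path_vector_zero Z_def mult_power_def path_Z_zero keq_def ket_in_bra_plus_ket)
  next
    case False
    let ?I = "{i\<in>{1..r}. 0 < Poly_Mapping.lookup \<beta> i}"
    let ?a = "\<lambda>i. path_coeff (- h) \<mu>' i \<beta>"
    have step: "const (?a i) * (theta (u (\<beta> - qroot i)) * (gE i * w \<beta>))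
        - const (\<mu> i * \<mu>' i / path_weight r h lam i \<beta> * Z (\<beta> - qroot i)) \<in> ?BJ" if "i \<in> ?I" for i
    proof -
      define \<gamma> where "\<gamma> = \<beta> - qroot i"
      have i: "i \<in> {1..r}" "0 < Poly_Mapping.lookup \<beta> i" using that by auto
      have \<gamma>: "\<beta> = \<gamma> + qroot i" "\<gamma> \<in> Qplus r" "qdeg r \<gamma> < qdeg r \<beta>"
        using diff_qroot_add[OF i(2)] Qplus_diff_qroot[OF \<beta>] qdeg_diff_qroot[OF i] by (simp_all add: \<gamma>_def)
      have wg: "w \<gamma> \<in> wspace (lam - wt \<gamma>)" using w \<gamma>(2) by (simp add: whittaker_rep_def)
      let ?c = "\<mu> i * chi (lam - wt \<gamma>) i ^ (i - 1)"
      have "keq (gE i * w \<beta>) (const (\<mu> i) * gK i ^ (i - 1) * w \<gamma>)"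
        using w i(1) \<gamma>(1,2) unfolding whittaker_rep_def by blast
      also have "\<dots> = const (\<mu> i) * (gK i ^ (i - 1) * w \<gamma>)" by (rule mult.assoc)
      also have "keq \<dots> (const (\<mu> i) * (const (chi (lam - wt \<gamma>) i ^ (i - 1)) * w \<gamma>))"
        using i by (intro keq_lmult wspace_gen_power[OF wg] keq_K[OF wg]) auto
      finally have E: "keq (gE i * w \<beta>) (const ?c * w \<gamma>)" by (simp add: const_mult_left)
      have th: "theta (u \<gamma>) \<in> free_carrier r"
        unfolding u_def by (intro theta_carrier wspace_carrier[OF path_vector_wspace[OF \<gamma>(2)]])
      have "keq (const (?a i) * (theta (u \<gamma>) * (gE i * w \<beta>))) (const (?a i) * (theta (u \<gamma>) * (const ?c * w \<gamma>)))"
        using E th by (intro keq_lmult) auto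
      also have "\<dots> = const (?a i * ?c) * (theta (u \<gamma>) * w \<gamma>)"
        by (simp only: const_left_commute[of "theta (u \<gamma>)"] const_mult_left)
      also have "?a i * ?c = \<mu> i * \<mu>' i / path_weight r h lam i \<beta>" (is "_ = ?d")
        using path_coeff_weight[OF i(1), of \<mu>' \<gamma> \<mu>] by (simp add: \<gamma>(1))
      finally have 1: "const (?a i) * (theta (u \<gamma>) * (gE i * w \<beta>)) - const ?d * (theta (u \<gamma>) * w \<gamma>) \<in> ?BJ"
        unfolding keq_def by (rule ket_in_bra_plus_ket)
      have "theta (u \<gamma>) * w \<gamma> - const (Z \<gamma>) \<in> ?BJ"
        using less.hyps[OF \<gamma>(3,2)] by (simp add: Z_def)
      then obtain b k where bk: "theta (u \<gamma>) * w \<gamma> - const (Z \<gamma>) = b + k"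
        "b \<in> bra_ideal r h lam" "k \<in> ket_ideal r h lam" by (rule set_plus_elim)
      \<comment> \<open>The scalar is placed to the right of \<open>b\<close> and to the left of
        \<open>k\<close>, the sides on which the two ideals are stable.\<close>
      have "b * const ?d + const ?d * k \<in> ?BJ"
        using bk by (intro set_plus_intro bra_ideal_rmult ket_ideal_lmult) auto
      then have "const ?d * (theta (u \<gamma>) * w \<gamma> - const (Z \<gamma>)) \<in> ?BJ"
        by (simp add: bk(1) const_commute distrib_left)
      from bra_plus_ket_add[OF 1 this] show ?thesis
        by (simp only: \<gamma>_def[symmetric] right_diff_distrib const_mult add_diff_eq diff_add_cancel)
    qed
    have "u \<beta> = (\<Sum>i\<in>?I. const (?a i) * (gF i * u (\<beta> - qroot i)))"
      unfolding u_def by (subst path_vector.simps) (simp add: False)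
    then have "theta (u \<beta>) = (\<Sum>i\<in>?I. const (?a i) * (theta (u (\<beta> - qroot i)) * gE i))"
      by (simp add: theta_sum theta_mult theta_gen const_commute)
    then have u: "theta (u \<beta>) * w \<beta> = (\<Sum>i\<in>?I. const (?a i) * (theta (u (\<beta> - qroot i)) * (gE i * w \<beta>)))"
      by (simp add: sum_distrib_right mult.assoc)
    have "mult_power r (\<lambda>i. \<mu> i * \<mu>' i) \<beta> = \<mu> i * \<mu>' i * mult_power r (\<lambda>i. \<mu> i * \<mu>' i) (\<beta> - qroot i)"
      if "i \<in> ?I" for i
      using mult_power_add_qroot[of i r "\<lambda>i. \<mu> i * \<mu>' i" "\<beta> - qroot i"] that by (simp add: diff_qroot_add)
    then have Z: "Z \<beta> = (\<Sum>i\<in>?I. \<mu> i * \<mu>' i / path_weight r h lam i \<beta> * Z (\<beta> - qroot i))"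
      unfolding Z_def path_Z_rec[OF \<beta> False] sum_distrib_left
      by (intro sum.cong refl) simp
    have sum: "(\<Sum>i\<in>I. f i) \<in> ?BJ" if "\<And>i. i \<in> I \<Longrightarrow> f i \<in> ?BJ" for I :: "nat set" and f
      using that
    proof (induction I rule: infinite_finite_induct)
      case (insert i I)
      then show ?case by (simp add: bra_plus_ket_add)
    qed (simp_all add: ket_in_bra_plus_ket)
    show "theta (u \<beta>) * w \<beta> - const (Z \<beta>) \<in> ?BJ"
      unfolding u Z const_sum sum_subtractf[symmetric] by (rule sum) (rule step)
  qed
qed

end

lemma fsum_cong:
  assumes "\<And>\<beta>. \<beta> \<in> Qplus r \<Longrightarrow> f \<beta> = g \<beta>"
  shows "fsum r f = fsum r g"
  unfolding fsum_def using assms by (intro ext sum.cong) auto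

theorem theorem6p16:
  fixes r :: nat and h :: complex and lam :: weight and \<mu> \<mu>' :: "nat \<Rightarrow> complex"
  assumes "r \<ge> 1"
    and "lam \<in> weights r"
    and "generic r h lam"
    and "\<forall>i\<in>{1..r}. \<mu> i \<noteq> 0"
    and "\<forall>i\<in>{1..r}. \<mu>' i \<noteq> 0"
  shows "whittaker_function r h lam \<mu> \<mu>' =
    fsum r (\<lambda>\<beta>. fscale ((\<Prod>i=1..r. (\<mu> i * \<mu>' i) ^ Poly_Mapping.lookup \<beta> i) * path_Z r h lam \<beta>)
      (qpow_phi r (lam - wt \<beta>)))"
proof -
  interpret verma_irreducible_params r h lam
    using assms(3) by unfold_locales (simp_all add: generic_def)
  \<comment> \<open>The denominator q - 1/q vanishes only if q^2 = 1.\<close>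
  have "exp h ^ 2 \<noteq> 1" using nonroot by simp
  then have q: "exp h - inverse (exp h) \<noteq> 0" by (simp add: field_simps power2_eq_square)
  have v: "path_v r h lam \<beta> \<noteq> 0" "path_v r (- h) lam \<beta> \<noteq> 0" if "\<beta> \<in> Qplus r" "\<beta> \<noteq> 0" for \<beta>
    using assms(3) that by (auto simp: generic_def)
  let ?w = "path_vector (path_coeff h \<mu>)" and ?u = "path_vector (path_coeff (- h) \<mu>')"
  have w: "whittaker_rep LK \<mu> ?w"
  proof (rule whittaker_rep_path_vector[OF _ q v(1)])
    fix i \<nu> x assume "i \<in> {1..r}" "x \<in> wspace \<nu>"
    then show "keq (gK i * x) (const (qpow h (wform r \<nu> (sroot i))) * x)"
      using keq_K by (simp add: chi_def)
  qed auto
  \<comment> \<open>The inverse of \<open>K_i\<close> has the inverse eigenvalue, which is why the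
    bra uses the parameter \<open>- h\<close> and its coefficients contain v at 1/q.\<close>
  have u: "whittaker_rep LKinv \<mu>' ?u"
  proof (rule whittaker_rep_path_vector[OF _ q v(2)])
    fix i \<nu> x assume "i \<in> {1..r}" "x \<in> wspace \<nu>"
    then show "keq (gKinv i * x) (const (qpow (- h) (wform r \<nu> (sroot i))) * x)"
      using keq_Kinv by (simp add: chi_def qpow_def exp_minus)
  qed auto
  have pairing: "pairing r h lam (whittaker_bra r h lam \<mu>' \<beta>) (whittaker_ket r h lam \<mu> \<beta>)
      = (\<Prod>i=1..r. (\<mu> i * \<mu>' i) ^ Poly_Mapping.lookup \<beta> i) * path_Z r h lam \<beta>"
    if \<beta>: "\<beta> \<in> Qplus r" for \<beta>
  proof -
    have "pairing r h lam (whittaker_bra r h lam \<mu>' \<beta>) (whittaker_ket r h lam \<mu> \<beta>)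
        = pairing r h lam (theta (?u \<beta>) +o bra_ideal r h lam) (?w \<beta> +o ket_ideal r h lam)"
      using \<beta> by (simp add: whittaker_ket_eq[OF w] whittaker_bra_eq[OF u])
    also have "\<dots> = vev r h lam (theta (?u \<beta>) * ?w \<beta>)"
      using wspace_carrier[OF path_vector_wspace[OF \<beta>]] theta_carrier by (intro pairing_cosets) auto
    also have "\<dots> = (\<Prod>i=1..r. (\<mu> i * \<mu>' i) ^ Poly_Mapping.lookup \<beta> i) * path_Z r h lam \<beta>"
      using pairing_path_vector[OF w \<beta>, of \<mu>'] by (intro vev_eqI) (simp add: mult_power_def)
    finally show ?thesis .
  qed
  show ?thesis
    unfolding whittaker_function_def by (rule fsum_cong) (simp only: pairing)
qed

end
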